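(* Let $\mathfrak g$ be an $n$-Lie algebra and let $\rho:\bigwedge^{n-1}\mathfrak g\to\mathrm{End}(V)$ be a representation of $\mathfrak g$ on a vector space $V$. Then there is a one-to-one correspondence between the equivalence classes of abelian extensions of $\mathfrak g$ by $V$ (inducing the representation $\rho$ on $V$) and the first cohomology group $\mathbf H^1(\mathfrak g,V)$.
   Context: $K$ is a field of characteristic zero; vector spaces are over $K$; $n\ge2$. An $n$-Lie algebra is a vector space with an alternating $n$-linear bracket satisfying $[x_1,\dots,x_{n-1},[y_1,\dots,y_n]]=\sum_{i=1}^n[y_1,\dots,y_{i-1},[x_1,\dots,x_{n-1},y_i],y_{i+1},\dots,y_n]$. A representation of $\mathfrak g$ on $V$ is a linear map $\rho:\bigwedge^{n-1}\mathfrak g\to\mathrm{End}(V)$ with $[\rho(x_1,\dots,x_{n-1}),\rho(y_1,\dots,y_{n-1})]=\sum_{i=1}^{n-1}\rho(y_1,\dots,[x_1,\dots,x_{n-1},y_i],\dots,y_{n-1})$ and $\rho(x_1,\dots,x_{n-2},[y_1,\dots,y_n])=\sum_{i=1}^n(-1)^{n-i}\rho(y_1,\dots,\widehat{y_i},\dots,y_n)\rho(x_1,\dots,x_{n-2},y_i)$. An extension of $\mathfrak g$ by $V$ is a short exact sequence $0\to V\xrightarrow{i}\hat{\mathfrak g}\xrightarrow{p}\mathfrak g\to0$ of $n$-Lie algebras and homomorphisms; it is abelian if $V$ (identified with $i(V)$) is an abelian ideal of $\hat{\mathfrak g}$, meaning an ideal such that any bracket in $\hat{\mathfrak g}$ with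 at least two entries in $V$ is zero. It induces on $V$ the representation $\rho(x_1,\dots,x_{n-1})(u)=[\sigma(x_1),\dots,\sigma(x_{n-1}),u]_{\hat{\mathfrak g}}$, where $\sigma:\mathfrak g\to\hat{\mathfrak g}$ is any linear section of $p$ (independent of $\sigma$). Two extensions $\hat{\mathfrak g},\tilde{\mathfrak g}$ with maps $(i,p)$, $(j,q)$ are equivalent if there is an $n$-Lie algebra homomorphism $F:\hat{\mathfrak g}\to\tilde{\mathfrak g}$ with $F\circ i=j$ and $q\circ F=p$. $\mathbf H^1(\mathfrak g,V)$ is the quotient of the space of 1-cocycles by the space of 1-coboundaries. A 1-cocycle is a linear map $\omega:\bigwedge^n\mathfrak g\to V$ such that for all $x_i,y_i\in\mathfrak g$ $$\omega(x_1,\dots,x_{n-1},[y_1,\dots,y_n])+\rho(x_1,\dots,x_{n-1})\omega(y_1,\dots,y_n)=\sum_{i=1}^n\omega(y_1,\dots,[x_1,\dots,x_{n-1},y_i],\dots,y_n)+\sum_{i=1}^n(-1)^{n-i}\rho(y_1,\dots,\widehat{y_i},\dots,y_n)\omega(x_1,\dots,x_{n-1},y_i).$$ A 1-coboundary is a map of the form $d^0\nu(x_1,\dots,x_n)=\sum_{i=1}^n(-1)^{n-i}\rho(x_1,\dots,\widehat{x_i},\dots,x_n)\nu(x_i)-\nu([x_1,\dots,x_n])$ with $\nu\in\mathrm{Hom}(\mathfrak g,V)$. *)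

theory Defs
  imports "HOL-Algebra.Algebra"
begin

text \<open>
  Vector spaces are modules of \<open>HOL-Algebra\<close> over a field \<open>K\<close>: the underlying set is the carrier, and
  a type is only an ambient universe.  A tuple \<open>x\<^sub>1, \<dots>, x\<^sub>k\<close> is a list of length \<open>k\<close>, with entries
  numbered from \<open>0\<close>; so the sign \<open>(-1)\<^bsup>n-i\<^esup>\<close> at the \<open>i\<close>-th entry becomes \<open>(-1)\<^bsup>n - Suc i\<^esup>\<close>.
\<close>

definition vector_space_over :: "('k, 'r) ring_scheme \<Rightarrow> ('k, 'a, 'm) module_scheme \<Rightarrow> bool" where
  "vector_space_over K M \<longleftrightarrow> field K \<and> module K M"

definition char_zero :: "('k, 'r) ring_scheme \<Rightarrow> bool" where
  "char_zero K \<longleftrightarrow> (\<forall>m::nat. m > 0 \<longrightarrow> [m] \<cdot>\<^bsub>K\<^esub> \<one>\<^bsub>K\<^esub> \<noteq> \<zero>\<^bsub>K\<^esub>)"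

definition tuples :: "nat \<Rightarrow> ('a, 'm) partial_object_scheme \<Rightarrow> 'a list set" where
  "tuples k M = {xs. length xs = k \<and> set xs \<subseteq> carrier M}"

definition omit_nth :: "nat \<Rightarrow> 'a list \<Rightarrow> 'a list" where
  "omit_nth i xs = take i xs @ drop (Suc i) xs"

definition sgn_smult :: "('k, 'r) ring_scheme \<Rightarrow> ('k, 'a, 'm) module_scheme \<Rightarrow> nat \<Rightarrow> 'a \<Rightarrow> 'a" where
  "sgn_smult K M m v = ((\<ominus>\<^bsub>K\<^esub> \<one>\<^bsub>K\<^esub>) [^]\<^bsub>K\<^esub> m) \<odot>\<^bsub>M\<^esub> v"

definition linear_map ::
  "('k, 'r) ring_scheme \<Rightarrow> ('k, 'a, 'm) module_scheme \<Rightarrow> ('k, 'b, 'l) module_scheme \<Rightarrow> ('a \<Rightarrow> 'b) \<Rightarrow> bool"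
where
  "linear_map K M N f \<longleftrightarrow>
     f \<in> carrier M \<rightarrow> carrier N \<and>
     (\<forall>x\<in>carrier M. \<forall>y\<in>carrier M. f (x \<oplus>\<^bsub>M\<^esub> y) = f x \<oplus>\<^bsub>N\<^esub> f y) \<and>
     (\<forall>a\<in>carrier K. \<forall>x\<in>carrier M. f (a \<odot>\<^bsub>M\<^esub> x) = a \<odot>\<^bsub>N\<^esub> f x)"

text \<open>
  Linear maps on the exterior power \<open>\<And>\<^sup>k M\<close> are rendered, by its universal property, as alternating
  \<open>k\<close>-linear maps on \<open>M\<close>.
\<close>

definition alternating_map ::
  "('k, 'r) ring_scheme \<Rightarrow> nat \<Rightarrow> ('k, 'a, 'm) module_scheme \<Rightarrow> ('k, 'b, 'l) module_scheme
     \<Rightarrow> ('a list \<Rightarrow> 'b) \<Rightarrow> bool"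
where
  "alternating_map K k M N f \<longleftrightarrow>
     f \<in> tuples k M \<rightarrow> carrier N \<and>
     (\<forall>xs\<in>tuples k M. \<forall>i<k. linear_map K M N (\<lambda>x. f (xs[i := x]))) \<and>
     (\<forall>xs\<in>tuples k M. \<forall>i<k. \<forall>j<k. i \<noteq> j \<and> xs ! i = xs ! j \<longrightarrow> f xs = \<zero>\<^bsub>N\<^esub>)"

record ('k, 'a) nlie = "('k, 'a) module" +
  nbracket :: "'a list \<Rightarrow> 'a"

definition n_Lie_algebra :: "('k, 'r) ring_scheme \<Rightarrow> nat \<Rightarrow> ('k, 'a, 'm) nlie_scheme \<Rightarrow> bool" where
  "n_Lie_algebra K n L \<longleftrightarrow>
     vector_space_over K L \<and>
     alternating_map K n L L (nbracket L) \<and>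
     (\<forall>xs\<in>tuples (n - 1) L. \<forall>ys\<in>tuples n L.
        nbracket L (xs @ [nbracket L ys]) =
        (\<Oplus>\<^bsub>L\<^esub>i\<in>{..<n}. nbracket L (ys[i := nbracket L (xs @ [ys ! i])])))"

definition n_Lie_hom ::
  "('k, 'r) ring_scheme \<Rightarrow> nat \<Rightarrow> ('k, 'a, 'm) nlie_scheme \<Rightarrow> ('k, 'b, 'l) nlie_scheme
     \<Rightarrow> ('a \<Rightarrow> 'b) \<Rightarrow> bool"
where
  "n_Lie_hom K n L L' f \<longleftrightarrow>
     linear_map K L L' f \<and>
     (\<forall>xs\<in>tuples n L. f (nbracket L xs) = nbracket L' (map f xs))"

definition n_Lie_representation ::
  "('k, 'r) ring_scheme \<Rightarrow> nat \<Rightarrow> ('k, 'g, 'm) nlie_scheme \<Rightarrow> ('k, 'v, 'l) module_scheme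
     \<Rightarrow> ('g list \<Rightarrow> 'v \<Rightarrow> 'v) \<Rightarrow> bool"
where
  "n_Lie_representation K n G V \<rho> \<longleftrightarrow>
     (\<forall>xs\<in>tuples (n - 1) G. linear_map K V V (\<rho> xs)) \<and>
     (\<forall>v\<in>carrier V. alternating_map K (n - 1) G V (\<lambda>xs. \<rho> xs v)) \<and>
     (\<forall>xs\<in>tuples (n - 1) G. \<forall>ys\<in>tuples (n - 1) G. \<forall>v\<in>carrier V.
        \<rho> xs (\<rho> ys v) \<ominus>\<^bsub>V\<^esub> \<rho> ys (\<rho> xs v) =
        (\<Oplus>\<^bsub>V\<^esub>i\<in>{..<n - 1}. \<rho> (ys[i := nbracket G (xs @ [ys ! i])]) v)) \<and>
     (\<forall>xs\<in>tuples (n - 2) G. \<forall>ys\<in>tuples n G. \<forall>v\<in>carrier V.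
        \<rho> (xs @ [nbracket G ys]) v =
        (\<Oplus>\<^bsub>V\<^esub>i\<in>{..<n}. sgn_smult K V (n - Suc i) (\<rho> (omit_nth i ys) (\<rho> (xs @ [ys ! i]) v))))"

text \<open>An extension of \<open>G\<close> by \<open>A\<close> is encoded as the triple \<open>(E, i, p)\<close>.\<close>

type_synonym ('k, 'a, 'e, 'g) ext = "('k, 'e) nlie \<times> ('a \<Rightarrow> 'e) \<times> ('e \<Rightarrow> 'g)"

definition n_Lie_extension ::
  "('k, 'r) ring_scheme \<Rightarrow> nat \<Rightarrow> ('k, 'g, 'm) nlie_scheme \<Rightarrow> ('k, 'a, 'l) nlie_scheme
     \<Rightarrow> ('k, 'a, 'e, 'g) ext \<Rightarrow> bool"
where
  "n_Lie_extension K n G A = (\<lambda>(E, i, p).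
     n_Lie_algebra K n A \<and> n_Lie_algebra K n E \<and> n_Lie_algebra K n G \<and>
     n_Lie_hom K n A E i \<and> n_Lie_hom K n E G p \<and>
     inj_on i (carrier A) \<and>
     i ` carrier A = {e \<in> carrier E. p e = \<zero>\<^bsub>G\<^esub>} \<and>
     p ` carrier E = carrier G)"

definition abelian_ideal :: "('k, 'r) ring_scheme \<Rightarrow> nat \<Rightarrow> ('k, 'a, 'm) nlie_scheme \<Rightarrow> 'a set \<Rightarrow> bool"
where
  "abelian_ideal K n L I \<longleftrightarrow>
     submodule I K L \<and>
     (\<forall>xs\<in>tuples n L. \<forall>i<n. xs ! i \<in> I \<longrightarrow> nbracket L xs \<in> I) \<and>
     (\<forall>xs\<in>tuples n L. \<forall>i<n. \<forall>j<n. i \<noteq> j \<and> xs ! i \<in> I \<and> xs ! j \<in> I \<longrightarrow> nbracket L xs = \<zero>\<^bsub>L\<^esub>)"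

text \<open>
  The vector space \<open>V\<close> with zero bracket.  If \<open>i(V)\<close> is an abelian ideal then, \<open>i\<close> being an injective
  homomorphism and \<open>n \<ge> 2\<close>, the bracket of \<open>V\<close> has to be zero.
\<close>

definition abelian_nlie :: "('k, 'a) module \<Rightarrow> ('k, 'a) nlie" where
  "abelian_nlie V = module.extend V \<lparr>nbracket = (\<lambda>_. \<zero>\<^bsub>V\<^esub>)\<rparr>"

definition linear_section ::
  "('k, 'r) ring_scheme \<Rightarrow> ('k, 'e, 'm) module_scheme \<Rightarrow> ('k, 'g, 'l) module_scheme
     \<Rightarrow> ('e \<Rightarrow> 'g) \<Rightarrow> ('g \<Rightarrow> 'e) \<Rightarrow> bool"
where
  "linear_section K E G p \<sigma> \<longleftrightarrow> linear_map K G E \<sigma> \<and> (\<forall>x\<in>carrier G. p (\<sigma> x) = x)"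

text \<open>
  Linear sections of the surjection \<open>p\<close> exist because \<open>K\<close> is a field, so quantifying over all of
  them below is not vacuous.
\<close>

definition induces_representation ::
  "('k, 'r) ring_scheme \<Rightarrow> nat \<Rightarrow> ('k, 'g, 'm) nlie_scheme \<Rightarrow> ('k, 'v, 'l) module_scheme
     \<Rightarrow> ('g list \<Rightarrow> 'v \<Rightarrow> 'v) \<Rightarrow> ('k, 'v, 'e, 'g) ext \<Rightarrow> bool"
where
  "induces_representation K n G V \<rho> = (\<lambda>(E, i, p).
     \<forall>\<sigma>. linear_section K E G p \<sigma> \<longrightarrow>
       (\<forall>xs\<in>tuples (n - 1) G. \<forall>u\<in>carrier V.
          i (\<rho> xs u) = nbracket E (map \<sigma> xs @ [i u])))"

definition abelian_extensions ::
  "('k, 'r) ring_scheme \<Rightarrow> nat \<Rightarrow> ('k, 'g, 'm) nlie_scheme \<Rightarrow> ('k, 'v) module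
     \<Rightarrow> ('g list \<Rightarrow> 'v \<Rightarrow> 'v) \<Rightarrow> ('k, 'v, 'e, 'g) ext set"
where
  "abelian_extensions K n G V \<rho> =
     {S. n_Lie_extension K n G (abelian_nlie V) S \<and>
         (case S of (E, i, p) \<Rightarrow> abelian_ideal K n E (i ` carrier V)) \<and>
         induces_representation K n G V \<rho> S}"

definition equivalent_extensions ::
  "('k, 'r) ring_scheme \<Rightarrow> nat \<Rightarrow> ('k, 'v, 'm) module_scheme
     \<Rightarrow> ('k, 'v, 'e, 'g) ext \<Rightarrow> ('k, 'v, 'f, 'g) ext \<Rightarrow> bool"
where
  "equivalent_extensions K n V = (\<lambda>(E, i, p) (E', j, q).
     \<exists>F. n_Lie_hom K n E E' F \<and>
         (\<forall>v\<in>carrier V. F (i v) = j v) \<and>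
         (\<forall>e\<in>carrier E. q (F e) = p e))"

definition abelian_extension_classes ::
  "('k, 'r) ring_scheme \<Rightarrow> nat \<Rightarrow> ('k, 'g, 'm) nlie_scheme \<Rightarrow> ('k, 'v) module
     \<Rightarrow> ('g list \<Rightarrow> 'v \<Rightarrow> 'v) \<Rightarrow> ('k, 'v, 'e, 'g) ext set set"
where
  "abelian_extension_classes K n G V \<rho> =
     abelian_extensions K n G V \<rho> //
       {(S, T). S \<in> abelian_extensions K n G V \<rho> \<and> T \<in> abelian_extensions K n G V \<rho> \<and>
                equivalent_extensions K n V S T}"

text \<open>
  Cochains are taken to be \<^const>\<open>extensional\<close>, so that equality of functions is equality of the
  maps on tuples of elements of the carrier.
\<close>

definition one_cocycles ::
  "('k, 'r) ring_scheme \<Rightarrow> nat \<Rightarrow> ('k, 'g, 'm) nlie_scheme \<Rightarrow> ('k, 'v, 'l) module_scheme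
     \<Rightarrow> ('g list \<Rightarrow> 'v \<Rightarrow> 'v) \<Rightarrow> ('g list \<Rightarrow> 'v) set"
where
  "one_cocycles K n G V \<rho> =
     {\<omega> \<in> extensional (tuples n G).
        alternating_map K n G V \<omega> \<and>
        (\<forall>xs\<in>tuples (n - 1) G. \<forall>ys\<in>tuples n G.
           \<omega> (xs @ [nbracket G ys]) \<oplus>\<^bsub>V\<^esub> \<rho> xs (\<omega> ys) =
           (\<Oplus>\<^bsub>V\<^esub>i\<in>{..<n}. \<omega> (ys[i := nbracket G (xs @ [ys ! i])])) \<oplus>\<^bsub>V\<^esub>
           (\<Oplus>\<^bsub>V\<^esub>i\<in>{..<n}. sgn_smult K V (n - Suc i) (\<rho> (omit_nth i ys) (\<omega> (xs @ [ys ! i])))))}"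

definition d0 ::
  "('k, 'r) ring_scheme \<Rightarrow> nat \<Rightarrow> ('k, 'g, 'm) nlie_scheme \<Rightarrow> ('k, 'v, 'l) module_scheme
     \<Rightarrow> ('g list \<Rightarrow> 'v \<Rightarrow> 'v) \<Rightarrow> ('g \<Rightarrow> 'v) \<Rightarrow> 'g list \<Rightarrow> 'v"
where
  "d0 K n G V \<rho> \<nu> =
     (\<lambda>xs\<in>tuples n G.
        (\<Oplus>\<^bsub>V\<^esub>i\<in>{..<n}. sgn_smult K V (n - Suc i) (\<rho> (omit_nth i xs) (\<nu> (xs ! i))))
          \<ominus>\<^bsub>V\<^esub> \<nu> (nbracket G xs))"

definition one_coboundaries ::
  "('k, 'r) ring_scheme \<Rightarrow> nat \<Rightarrow> ('k, 'g, 'm) nlie_scheme \<Rightarrow> ('k, 'v, 'l) module_scheme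
     \<Rightarrow> ('g list \<Rightarrow> 'v \<Rightarrow> 'v) \<Rightarrow> ('g list \<Rightarrow> 'v) set"
where
  "one_coboundaries K n G V \<rho> = {d0 K n G V \<rho> \<nu> | \<nu>. linear_map K G V \<nu>}"

definition H1 ::
  "('k, 'r) ring_scheme \<Rightarrow> nat \<Rightarrow> ('k, 'g, 'm) nlie_scheme \<Rightarrow> ('k, 'v, 'l) module_scheme
     \<Rightarrow> ('g list \<Rightarrow> 'v \<Rightarrow> 'v) \<Rightarrow> ('g list \<Rightarrow> 'v) set set"
where
  "H1 K n G V \<rho> =
     one_cocycles K n G V \<rho> //
       {(\<omega>, \<omega>'). \<omega> \<in> one_cocycles K n G V \<rho> \<and> \<omega>' \<in> one_cocycles K n G V \<rho> \<and>
                 (\<lambda>xs\<in>tuples n G. \<omega> xs \<ominus>\<^bsub>V\<^esub> \<omega>' xs) \<in> one_coboundaries K n G V \<rho>}"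

end

theory Submission
  imports Defs
begin

text \<open>
  A linear section of an abelian extension \<open>0 \<rightarrow> V \<rightarrow> E \<rightarrow> G \<rightarrow> 0\<close> exists because \<open>K\<close> is a field
  (\<open>linear_section_exists\<close>), and it identifies \<open>E\<close> with \<open>G \<times> V\<close> as a vector space.  A bracket in \<open>E\<close> with two entries
  in \<open>V\<close> vanishes, and one with a single entry in \<open>V\<close> is given by \<open>\<rho>\<close>, so the bracket is determined by an
  alternating map \<open>\<omega>\<close>, the defect of the section from being a homomorphism:
  \<open>[(x\<^sub>1, v\<^sub>1), \<dots>, (x\<^sub>n, v\<^sub>n)] = ([x\<^sub>1, \<dots>, x\<^sub>n], \<omega>(x\<^sub>1, \<dots>, x\<^sub>n) + \<Sum>\<^sub>i (-1)\<^bsup>n-i\<^esup> \<rho>(x\<^sub>1, \<dots>, x\<^sub>n without x\<^sub>i) v\<^sub>i)\<close>.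
  Such a description of an extension is called a presentation by \<open>\<omega>\<close>.

  The fundamental identity for this bracket amounts, besides the fundamental identity of \<open>G\<close> and the two axioms of
  a representation, to the cocycle identity for \<open>\<omega>\<close>.  Read in one direction this shows that each abelian
  extension is presented by a cocycle (\<open>presentation_exists\<close>); read in the other, that each cocycle presents an abelian extension
  (\<open>twisted_fundamental_identity\<close>, \<open>cocycle_presented\<close>).

  An equivalence of two presented extensions has the form \<open>(x, v) \<mapsto> (x, v + \<nu> x)\<close> with \<open>\<nu>\<close> linear, and such a map is a
  homomorphism if and only if the two cocycles differ by \<open>d\<^sup>0 \<nu>\<close> (\<open>equivalent_imp_cohomologous\<close>,
  \<open>cohomologous_imp_equivalent\<close>).  Hence the relation of presentation between abelian extensions and
  cocycles is total on both sides and matches equivalence with cohomology, so that it induces a bijection of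
  the quotients (\<open>bij_betw_quotients\<close>).
\<close>

section \<open>Finite sums\<close>

context abelian_monoid
begin

lemma finsum_lessThan_Suc:
  assumes "\<And>i. i \<le> k \<Longrightarrow> f i \<in> carrier G"
  shows "(\<Oplus>i\<in>{..<Suc k}. f i) = f k \<oplus> (\<Oplus>i\<in>{..<k}. f i)"
  using assms by (simp add: lessThan_Suc finsum_insert Pi_def)

lemma finsum_lessThan_Suc_shift:
  assumes "\<And>i. i \<le> k \<Longrightarrow> f i \<in> carrier G"
  shows "(\<Oplus>i\<in>{..<Suc k}. f i) = f 0 \<oplus> (\<Oplus>i\<in>{..<k}. f (Suc i))"
proof -
  have "(\<Oplus>i\<in>{..<Suc k}. f i) = f 0 \<oplus> (\<Oplus>i\<in>Suc ` {..<k}. f i)"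
    unfolding lessThan_Suc_eq_insert_0 using assms by (subst finsum_insert) (auto simp: Pi_def)
  also have "(\<Oplus>i\<in>Suc ` {..<k}. f i) = (\<Oplus>i\<in>{..<k}. f (Suc i))"
    using assms by (intro finsum_reindex) (auto simp: Pi_def)
  finally show ?thesis .
qed

lemma finsum_single:
  assumes "finite A" "j \<in> A" "f j \<in> carrier G" "\<And>i. i \<in> A \<Longrightarrow> i \<noteq> j \<Longrightarrow> f i = \<zero>"
  shows "(\<Oplus>i\<in>A. f i) = f j"
proof -
  have "(\<Oplus>i\<in>A. f i) = (\<Oplus>i\<in>A. if j = i then f i else \<zero>)"
    using assms by (intro finsum_cong') auto
  also have "\<dots> = f j"
  proof -
    have "(\<Oplus>i\<in>A. if j = i then f i else \<zero>) = (\<Oplus>i\<in>A. if j = i then f j else \<zero>)"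
      using assms by (intro finsum_cong') auto
    also have "\<dots> = f j"
      using assms(1-3) finsum_singleton[of j A "\<lambda>_. f j"] by simp
    finally show ?thesis .
  qed
  finally show ?thesis .
qed

lemma finsum_swap:
  assumes "finite A" "finite B" "\<And>a b. a \<in> A \<Longrightarrow> b \<in> B \<Longrightarrow> f a b \<in> carrier G"
  shows "(\<Oplus>a\<in>A. \<Oplus>b\<in>B. f a b) = (\<Oplus>b\<in>B. \<Oplus>a\<in>A. f a b)"
  using assms(1,3)
proof (induction A)
  case empty
  then show ?case by (simp add: finsum_empty finsum_zero)
next
  case (insert x A)
  have "(\<Oplus>a\<in>insert x A. \<Oplus>b\<in>B. f a b) = (\<Oplus>b\<in>B. f x b) \<oplus> (\<Oplus>a\<in>A. \<Oplus>b\<in>B. f a b)"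
    using insert by (intro finsum_insert) (auto intro!: finsum_closed)
  also have "(\<Oplus>a\<in>A. \<Oplus>b\<in>B. f a b) = (\<Oplus>b\<in>B. \<Oplus>a\<in>A. f a b)"
    using insert by auto
  also have "(\<Oplus>b\<in>B. f x b) \<oplus> \<dots> = (\<Oplus>b\<in>B. f x b \<oplus> (\<Oplus>a\<in>A. f a b))"
    using insert by (intro finsum_addf[symmetric]) (auto intro!: finsum_closed)
  also have "\<dots> = (\<Oplus>b\<in>B. \<Oplus>a\<in>insert x A. f a b)"
    using insert by (intro finsum_cong') (auto intro!: finsum_closed)
  finally show ?case .
qed

text \<open>
  The map \<open>i \<mapsto> (if i < j then i else Suc i)\<close> enumerates the indices different from \<open>j\<close>; it is the
  index shift between a tuple and the tuple with its \<open>j\<close>-th entry omitted.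
\<close>

lemma finsum_split_off:
  assumes "\<And>i. i < n \<Longrightarrow> f i \<in> carrier G" "j < n"
  shows "(\<Oplus>i\<in>{..<n}. f i) = f j \<oplus> (\<Oplus>i\<in>{..<n - 1}. f (if i < j then i else Suc i))"
proof -
  let ?s = "\<lambda>i. if i < j then i else Suc i"
  have img: "?s ` {..<n - 1} = {..<n} - {j}"
  proof (intro equalityI subsetI)
    fix x assume "x \<in> ?s ` {..<n - 1}" then show "x \<in> {..<n} - {j}" by (auto split: if_splits)
  next
    fix x assume x: "x \<in> {..<n} - {j}"
    show "x \<in> ?s ` {..<n - 1}"
    proof (cases "x < j")
      case True then show ?thesis using assms(2) by (intro image_eqI[of _ _ x]) auto
    next
      case False then show ?thesis using x by (intro image_eqI[of _ _ "x - 1"]) auto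
    qed
  qed
  have "(\<Oplus>i\<in>{..<n}. f i) = (\<Oplus>i\<in>insert j ({..<n} - {j}). f i)"
    using assms(2) by (simp add: insert_absorb)
  also have "\<dots> = f j \<oplus> (\<Oplus>i\<in>?s ` {..<n - 1}. f i)"
    unfolding img using assms by (intro finsum_insert) auto
  also have "(\<Oplus>i\<in>?s ` {..<n - 1}. f i) = (\<Oplus>i\<in>{..<n - 1}. f (?s i))"
  proof (rule finsum_reindex)
    show "f \<in> ?s ` {..<n - 1} \<rightarrow> carrier G" unfolding img using assms by auto
    show "inj_on ?s {..<n - 1}" by (auto simp: inj_on_def split: if_splits)
  qed
  finally show ?thesis .
qed

end

text \<open>
  Both sides are the sum of \<open>f l j\<close> over all pairs \<open>l \<noteq> j\<close>; the equality is the interchange of the full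
  double sums with the diagonal cancelled.
\<close>

lemma (in abelian_group) finsum_off_diagonal:
  assumes "\<And>l j. l < n \<Longrightarrow> j < n \<Longrightarrow> f l j \<in> carrier G"
  shows "(\<Oplus>j\<in>{..<n}. \<Oplus>i\<in>{..<n - 1}. f (if i < j then i else Suc i) j) =
         (\<Oplus>l\<in>{..<n}. \<Oplus>i\<in>{..<n - 1}. f l (if i < l then i else Suc i))"
    (is "?A = ?B")
proof -
  let ?D = "\<Oplus>j\<in>{..<n}. f j j"
  have shift: "(if i < j then i else Suc i) < n" if "i < n - 1" for i j
    using that by auto
  have A: "?A \<in> carrier G" and B: "?B \<in> carrier G" and D: "?D \<in> carrier G"
    using assms shift by (auto intro!: finsum_closed)
  have "?D \<oplus> ?A = (\<Oplus>j\<in>{..<n}. f j j \<oplus> (\<Oplus>i\<in>{..<n - 1}. f (if i < j then i else Suc i) j))"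
    using assms shift by (intro finsum_addf[symmetric]) (auto intro!: finsum_closed)
  also have "\<dots> = (\<Oplus>j\<in>{..<n}. \<Oplus>l\<in>{..<n}. f l j)"
    using assms by (intro finsum_cong' refl) (auto simp: finsum_split_off[of n "\<lambda>l. f l _"] intro!: finsum_closed)
  also have "\<dots> = (\<Oplus>l\<in>{..<n}. \<Oplus>j\<in>{..<n}. f l j)"
    using assms by (intro finsum_swap) auto
  also have "\<dots> = (\<Oplus>l\<in>{..<n}. f l l \<oplus> (\<Oplus>i\<in>{..<n - 1}. f l (if i < l then i else Suc i)))"
    using assms shift by (intro finsum_cong' refl) (auto simp: finsum_split_off[of n "\<lambda>j. f _ j"] intro!: finsum_closed)
  also have "\<dots> = ?D \<oplus> ?B"
    using assms shift by (intro finsum_addf) (auto intro!: finsum_closed)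
  finally show ?thesis using A B D by simp
qed

section \<open>Linear maps\<close>

lemma linear_map_closed: "linear_map K M N f \<Longrightarrow> x \<in> carrier M \<Longrightarrow> f x \<in> carrier N"
  by (auto simp: linear_map_def)

lemma linear_map_add:
  "linear_map K M N f \<Longrightarrow> x \<in> carrier M \<Longrightarrow> y \<in> carrier M \<Longrightarrow> f (x \<oplus>\<^bsub>M\<^esub> y) = f x \<oplus>\<^bsub>N\<^esub> f y"
  by (auto simp: linear_map_def)

lemma linear_map_smult:
  "linear_map K M N f \<Longrightarrow> a \<in> carrier K \<Longrightarrow> x \<in> carrier M \<Longrightarrow> f (a \<odot>\<^bsub>M\<^esub> x) = a \<odot>\<^bsub>N\<^esub> f x"
  by (auto simp: linear_map_def)

lemma linear_map_cong:
  assumes "linear_map K M N f" "module K M" "\<And>x. x \<in> carrier M \<Longrightarrow> g x = f x"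
  shows "linear_map K M N g"
proof -
  interpret M: module K M by fact
  show ?thesis using assms by (auto simp: linear_map_def Pi_def)
qed

lemma linear_map_comp:
  assumes "linear_map K M N f" "linear_map K N P g"
  shows "linear_map K M P (\<lambda>x. g (f x))"
  using assms by (auto simp: linear_map_def Pi_def)

locale linear_map_between = M: module K M + N: module K N
  for K :: "('k, 'r) ring_scheme" and M :: "('k, 'a, 'm) module_scheme"
    and N :: "('k, 'b, 'l) module_scheme" +
  fixes f
  assumes linear: "linear_map K M N f"
begin

lemmas closed [simp, intro] = linear_map_closed[OF linear]
lemmas add = linear_map_add[OF linear]
lemmas smult = linear_map_smult[OF linear]

lemma zero [simp]: "f \<zero>\<^bsub>M\<^esub> = \<zero>\<^bsub>N\<^esub>"
  using smult[of "\<zero>\<^bsub>K\<^esub>" "\<zero>\<^bsub>M\<^esub>"] by simp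

lemma neg: "x \<in> carrier M \<Longrightarrow> f (\<ominus>\<^bsub>M\<^esub> x) = \<ominus>\<^bsub>N\<^esub> f x"
  using add[of x "\<ominus>\<^bsub>M\<^esub> x"]
  by (intro N.minus_equality[symmetric]) (simp_all add: M.r_neg N.a_comm)

lemma minus: "x \<in> carrier M \<Longrightarrow> y \<in> carrier M \<Longrightarrow> f (x \<ominus>\<^bsub>M\<^esub> y) = f x \<ominus>\<^bsub>N\<^esub> f y"
  by (simp add: M.minus_eq N.minus_eq add neg)

lemma finsum:
  assumes "finite A" "\<And>i. i \<in> A \<Longrightarrow> g i \<in> carrier M"
  shows "f (\<Oplus>\<^bsub>M\<^esub>i\<in>A. g i) = (\<Oplus>\<^bsub>N\<^esub>i\<in>A. f (g i))"
  using assms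
proof (induction A)
  case (insert x A)
  then show ?case
    by (subst M.finsum_insert) (auto simp: add intro!: M.finsum_closed N.finsum_insert[symmetric])
qed simp

lemma sgn: "x \<in> carrier M \<Longrightarrow> f (sgn_smult K M m x) = sgn_smult K N m (f x)"
  by (simp add: sgn_smult_def smult)

end

context module
begin

lemma sgn_smult_closed [simp, intro]: "x \<in> carrier M \<Longrightarrow> sgn_smult R M m x \<in> carrier M"
  by (simp add: sgn_smult_def)

lemma sgn_smult_0 [simp]: "x \<in> carrier M \<Longrightarrow> sgn_smult R M 0 x = x"
  by (simp add: sgn_smult_def)

lemma sgn_smult_zero [simp]: "sgn_smult R M m \<zero>\<^bsub>M\<^esub> = \<zero>\<^bsub>M\<^esub>"
  by (simp add: sgn_smult_def)

lemma sgn_smult_Suc: "x \<in> carrier M \<Longrightarrow> sgn_smult R M (Suc m) x = \<ominus>\<^bsub>M\<^esub> sgn_smult R M m x"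
  by (simp add: sgn_smult_def smult_l_minus R.r_minus)

lemma sgn_smult_add: "x \<in> carrier M \<Longrightarrow> sgn_smult R M (m + k) x = sgn_smult R M m (sgn_smult R M k x)"
  by (simp add: sgn_smult_def smult_assoc1 R.nat_pow_mult[symmetric])

lemma minus_eq_zero_iff:
  "x \<in> carrier M \<Longrightarrow> y \<in> carrier M \<Longrightarrow> x \<ominus>\<^bsub>M\<^esub> y = \<zero>\<^bsub>M\<^esub> \<longleftrightarrow> x = y"
  by (metis M.minus_eq M.r_neg M.minus_equality M.minus_minus M.a_inv_closed)

lemma add_minus_cancel:
  "x \<in> carrier M \<Longrightarrow> y \<in> carrier M \<Longrightarrow> y \<oplus>\<^bsub>M\<^esub> (x \<ominus>\<^bsub>M\<^esub> y) = x"
  by (simp add: M.minus_eq M.r_neg2 M.a_comm[of x])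

lemma minus_eq_minus_iff:
  assumes "a \<in> carrier M" "b \<in> carrier M" "c \<in> carrier M" "d \<in> carrier M"
  shows "a \<ominus>\<^bsub>M\<^esub> b = c \<ominus>\<^bsub>M\<^esub> d \<longleftrightarrow> a \<oplus>\<^bsub>M\<^esub> d = b \<oplus>\<^bsub>M\<^esub> c"
proof
  assume eq: "a \<ominus>\<^bsub>M\<^esub> b = c \<ominus>\<^bsub>M\<^esub> d"
  have "a \<oplus>\<^bsub>M\<^esub> d = (b \<oplus>\<^bsub>M\<^esub> (a \<ominus>\<^bsub>M\<^esub> b)) \<oplus>\<^bsub>M\<^esub> d" using assms add_minus_cancel by simp
  also have "\<dots> = b \<oplus>\<^bsub>M\<^esub> (d \<oplus>\<^bsub>M\<^esub> (c \<ominus>\<^bsub>M\<^esub> d))" unfolding eq using assms by (simp add: M.a_ac)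
  also have "\<dots> = b \<oplus>\<^bsub>M\<^esub> c" using assms add_minus_cancel by simp
  finally show "a \<oplus>\<^bsub>M\<^esub> d = b \<oplus>\<^bsub>M\<^esub> c" .
next
  assume eq: "a \<oplus>\<^bsub>M\<^esub> d = b \<oplus>\<^bsub>M\<^esub> c"
  have "(b \<oplus>\<^bsub>M\<^esub> d) \<oplus>\<^bsub>M\<^esub> (a \<ominus>\<^bsub>M\<^esub> b) = d \<oplus>\<^bsub>M\<^esub> (b \<oplus>\<^bsub>M\<^esub> (a \<ominus>\<^bsub>M\<^esub> b))"
    using assms by (simp add: M.a_ac)
  also have "\<dots> = d \<oplus>\<^bsub>M\<^esub> a" using assms add_minus_cancel by simp
  also have "\<dots> = b \<oplus>\<^bsub>M\<^esub> c" using eq assms by (simp add: M.a_comm)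
  also have "\<dots> = b \<oplus>\<^bsub>M\<^esub> (d \<oplus>\<^bsub>M\<^esub> (c \<ominus>\<^bsub>M\<^esub> d))" using assms add_minus_cancel by simp
  also have "\<dots> = (b \<oplus>\<^bsub>M\<^esub> d) \<oplus>\<^bsub>M\<^esub> (c \<ominus>\<^bsub>M\<^esub> d)" using assms by (simp add: M.a_assoc)
  finally show "a \<ominus>\<^bsub>M\<^esub> b = c \<ominus>\<^bsub>M\<^esub> d" using assms by simp
qed

lemma linear_map_sgn_smult: "linear_map R M M (sgn_smult R M m)"
proof -
  have "\<And>a x. a \<in> carrier R \<Longrightarrow> x \<in> carrier M \<Longrightarrow>
     (\<ominus> \<one>) [^] m \<odot>\<^bsub>M\<^esub> (a \<odot>\<^bsub>M\<^esub> x) = a \<odot>\<^bsub>M\<^esub> ((\<ominus> \<one>) [^] m \<odot>\<^bsub>M\<^esub> x)"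
    by (simp add: smult_assoc1[symmetric] R.m_comm)
  then show ?thesis
    unfolding linear_map_def sgn_smult_def by (auto simp: smult_r_distr)
qed

end

lemma linear_map_const_zero:
  assumes "module K M" "module K N"
  shows "linear_map K M N (\<lambda>_. \<zero>\<^bsub>N\<^esub>)"
proof -
  interpret N: module K N by fact
  show ?thesis by (auto simp: linear_map_def)
qed

lemma linear_map_pointwise_add:
  assumes "module K M" "module K N" "linear_map K M N f" "linear_map K M N g"
  shows "linear_map K M N (\<lambda>x. f x \<oplus>\<^bsub>N\<^esub> g x)"
proof -
  interpret f: linear_map_between K M N f using assms by (simp add: linear_map_between_def linear_map_between_axioms_def)
  interpret g: linear_map_between K M N g using assms by (simp add: linear_map_between_def linear_map_between_axioms_def)
  show ?thesis
    by (auto simp: linear_map_def f.add g.add f.smult g.smult f.N.smult_r_distr f.N.a_ac f.N.add.m_closed)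
qed

lemma linear_map_pointwise_minus:
  assumes "module K M" "module K N" "linear_map K M N f" "linear_map K M N g"
  shows "linear_map K M N (\<lambda>x. f x \<ominus>\<^bsub>N\<^esub> g x)"
proof -
  interpret f: linear_map_between K M N f using assms by (simp add: linear_map_between_def linear_map_between_axioms_def)
  interpret g: linear_map_between K M N g using assms by (simp add: linear_map_between_def linear_map_between_axioms_def)
  show ?thesis
    by (auto simp: linear_map_def f.N.minus_eq f.add g.add f.smult g.smult f.N.smult_r_distr
        f.N.smult_r_minus f.N.minus_add f.N.a_ac)
qed

lemma linear_map_finsum:
  assumes "module K M" "module K N" "finite A" "\<And>i. i \<in> A \<Longrightarrow> linear_map K M N (f i)"
  shows "linear_map K M N (\<lambda>x. \<Oplus>\<^bsub>N\<^esub>i\<in>A. f i x)"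
  using assms(3,4)
proof (induction A)
  interpret N: module K N by fact
  case empty
  show ?case using assms by (simp add: linear_map_const_zero)
next
  interpret N: module K N by fact
  case (insert j A)
  have "linear_map K M N (\<lambda>x. f j x \<oplus>\<^bsub>N\<^esub> (\<Oplus>\<^bsub>N\<^esub>i\<in>A. f i x))"
    using assms insert by (intro linear_map_pointwise_add) auto
  moreover have "\<And>x. x \<in> carrier M \<Longrightarrow>
      (\<Oplus>\<^bsub>N\<^esub>i\<in>insert j A. f i x) = f j x \<oplus>\<^bsub>N\<^esub> (\<Oplus>\<^bsub>N\<^esub>i\<in>A. f i x)"
    using insert by (intro N.finsum_insert) (auto intro: linear_map_closed)
  ultimately show ?case
    using assms(1) by (elim linear_map_cong) auto
qed

text \<open>Linearity may be tested after composition with an injective linear map.\<close>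

lemma linear_map_of_comp_inj:
  assumes "module K M" "module K N" "linear_map K N P i" "inj_on i (carrier N)"
    and "f \<in> carrier M \<rightarrow> carrier N" "linear_map K M P (\<lambda>x. i (f x))"
  shows "linear_map K M N f"
proof -
  interpret M: module K M by fact
  interpret N: module K N by fact
  have "f (x \<oplus>\<^bsub>M\<^esub> y) = f x \<oplus>\<^bsub>N\<^esub> f y" if "x \<in> carrier M" "y \<in> carrier M" for x y
    using that assms(5) linear_map_add[OF assms(6)] linear_map_add[OF assms(3)]
    by (intro inj_onD[OF assms(4)]) (auto simp: Pi_iff)
  moreover have "f (a \<odot>\<^bsub>M\<^esub> x) = a \<odot>\<^bsub>N\<^esub> f x" if "a \<in> carrier K" "x \<in> carrier M" for a x
    using that assms(5) linear_map_smult[OF assms(6)] linear_map_smult[OF assms(3)]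
    by (intro inj_onD[OF assms(4)]) (auto simp: Pi_iff)
  ultimately show ?thesis using assms(5) by (auto simp: linear_map_def)
qed

section \<open>Tuples\<close>

lemma tuples_iff: "xs \<in> tuples k M \<longleftrightarrow> length xs = k \<and> (\<forall>i<k. xs ! i \<in> carrier M)"
  by (auto simp: tuples_def subset_iff in_set_conv_nth)

lemma length_tuples: "xs \<in> tuples k M \<Longrightarrow> length xs = k"
  by (simp add: tuples_def)

lemma tuples_nth: "xs \<in> tuples k M \<Longrightarrow> i < k \<Longrightarrow> xs ! i \<in> carrier M"
  by (simp add: tuples_iff)

lemma tuples_update: "xs \<in> tuples k M \<Longrightarrow> a \<in> carrier M \<Longrightarrow> xs[i := a] \<in> tuples k M"
  by (auto simp: tuples_def dest: set_update_subset_insert[THEN subsetD])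

lemma tuples_snoc: "xs \<in> tuples k M \<Longrightarrow> a \<in> carrier M \<Longrightarrow> xs @ [a] \<in> tuples (Suc k) M"
  by (auto simp: tuples_def)

lemma tuples_map: "xs \<in> tuples k M \<Longrightarrow> (\<And>x. x \<in> carrier M \<Longrightarrow> f x \<in> carrier N) \<Longrightarrow> map f xs \<in> tuples k N"
  by (auto simp: tuples_def)

lemma length_omit_nth: "i < length xs \<Longrightarrow> length (omit_nth i xs) = length xs - 1"
  by (auto simp: omit_nth_def)

lemma nth_omit_nth:
  "i < length xs \<Longrightarrow> j < length xs - 1 \<Longrightarrow> omit_nth i xs ! j = xs ! (if j < i then j else Suc j)"
  by (auto simp: omit_nth_def nth_append min_def)

lemma omit_nth_map: "omit_nth i (map f xs) = map f (omit_nth i xs)"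
  by (simp add: omit_nth_def take_map drop_map)

lemma omit_nth_update_same [simp]: "omit_nth i (xs[i := a]) = omit_nth i xs"
  by (simp add: omit_nth_def)

lemma omit_nth_update:
  assumes "i < length xs" "l < length xs" "i \<noteq> l"
  shows "omit_nth l (xs[i := a]) = (omit_nth l xs)[(if i < l then i else i - 1) := a]"
  using assms by (auto intro!: nth_equalityI simp: length_omit_nth nth_omit_nth nth_list_update)

lemma omit_nth_snoc: "i < length xs \<Longrightarrow> omit_nth i (xs @ [a]) = omit_nth i xs @ [a]"
  by (simp add: omit_nth_def)

lemma omit_nth_snoc_last [simp]: "omit_nth (length xs) (xs @ [a]) = xs"
  by (simp add: omit_nth_def)

lemma tuples_omit_nth: "xs \<in> tuples k M \<Longrightarrow> i < k \<Longrightarrow> omit_nth i xs \<in> tuples (k - 1) M"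
  by (auto simp: tuples_def length_omit_nth) (auto simp: omit_nth_def dest: in_set_takeD in_set_dropD)

section \<open>Alternating maps\<close>

locale alternating = M: module K M + N: module K N
  for K :: "('k, 'r) ring_scheme" and M :: "('k, 'a, 'm) module_scheme"
    and N :: "('k, 'b, 'l) module_scheme" +
  fixes k :: nat and f
  assumes alternating: "alternating_map K k M N f"
begin

lemma closed [simp, intro]: "xs \<in> tuples k M \<Longrightarrow> f xs \<in> carrier N"
  using alternating by (auto simp: alternating_map_def)

lemma linear: "xs \<in> tuples k M \<Longrightarrow> i < k \<Longrightarrow> linear_map K M N (\<lambda>x. f (xs[i := x]))"
  using alternating by (auto simp: alternating_map_def)

lemma eq_zero: "xs \<in> tuples k M \<Longrightarrow> i < k \<Longrightarrow> j < k \<Longrightarrow> i \<noteq> j \<Longrightarrow> xs ! i = xs ! j \<Longrightarrow> f xs = \<zero>\<^bsub>N\<^esub>"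
  using alternating unfolding alternating_map_def by blast

lemma add_middle:
  assumes "pre @ a # post \<in> tuples k M" "b \<in> carrier M"
  shows "f (pre @ (a \<oplus>\<^bsub>M\<^esub> b) # post) = f (pre @ a # post) \<oplus>\<^bsub>N\<^esub> f (pre @ b # post)"
proof -
  have "a \<in> carrier M" "length pre < k" using assms by (auto simp: tuples_def)
  then show ?thesis
    using linear_map_add[OF linear[OF assms(1)], of "length pre" a b] assms(2) by simp
qed

lemma update_zero: "xs \<in> tuples k M \<Longrightarrow> i < k \<Longrightarrow> xs ! i = \<zero>\<^bsub>M\<^esub> \<Longrightarrow> f xs = \<zero>\<^bsub>N\<^esub>"
proof -
  assume *: "xs \<in> tuples k M" "i < k" "xs ! i = \<zero>\<^bsub>M\<^esub>"
  interpret linear_map_between K M N "\<lambda>x. f (xs[i := x])"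
    by unfold_locales (rule linear[OF *(1,2)])
  show "f xs = \<zero>\<^bsub>N\<^esub>" using zero *(3) by (metis list_update_id)
qed

text \<open>Expand \<open>f(\<dots>, a + b, a + b, \<dots>) = 0\<close>; the two diagonal terms vanish as well.\<close>

lemma swap_adjacent:
  assumes "pre @ a # b # post \<in> tuples k M"
  shows "f (pre @ a # b # post) = \<ominus>\<^bsub>N\<^esub> f (pre @ b # a # post)"
proof -
  have ab: "a \<in> carrier M" "b \<in> carrier M" and len: "Suc (length pre) < k"
    using assms by (auto simp: tuples_def)
  have tup: "pre @ x # y # post \<in> tuples k M" if "x \<in> carrier M" "y \<in> carrier M" for x y
    using assms that by (auto simp: tuples_def)
  have diag: "f (pre @ x # x # post) = \<zero>\<^bsub>N\<^esub>" if "x \<in> carrier M" for x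
    by (rule eq_zero[OF tup[OF that that], of "length pre" "Suc (length pre)"])
      (use len in \<open>auto simp: nth_append\<close>)
  have right: "f (pre @ x # (y \<oplus>\<^bsub>M\<^esub> z) # post) = f (pre @ x # y # post) \<oplus>\<^bsub>N\<^esub> f (pre @ x # z # post)"
    if "x \<in> carrier M" "y \<in> carrier M" "z \<in> carrier M" for x y z
    using add_middle[of "pre @ [x]" y post z] tup that by simp
  have "\<zero>\<^bsub>N\<^esub> = f (pre @ (a \<oplus>\<^bsub>M\<^esub> b) # (a \<oplus>\<^bsub>M\<^esub> b) # post)"
    using diag ab by simp
  also have "\<dots> = f (pre @ a # (a \<oplus>\<^bsub>M\<^esub> b) # post) \<oplus>\<^bsub>N\<^esub> f (pre @ b # (a \<oplus>\<^bsub>M\<^esub> b) # post)"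
    using ab by (intro add_middle tup) auto
  also have "\<dots> = f (pre @ a # b # post) \<oplus>\<^bsub>N\<^esub> f (pre @ b # a # post)"
    using ab tup by (simp add: right diag)
  finally show ?thesis
    using tup ab by (metis N.minus_equality closed)
qed

text \<open>
  Moving an entry to the last place takes one adjacent transposition per entry that it passes.  This is
  where the signs \<open>(-1)\<^bsup>n-i\<^esup>\<close> of the representation axiom, the cocycle identity and \<^const>\<open>d0\<close> come from.
\<close>

lemma move_to_end:
  assumes "pre @ a # post \<in> tuples k M"
  shows "f (pre @ a # post) = sgn_smult K N (length post) (f (pre @ post @ [a]))"
  using assms
proof (induction post arbitrary: pre)
  case Nil
  then show ?case by simp
next
  case (Cons b post)
  have t: "pre @ b # a # post \<in> tuples k M" "pre @ b # post @ [a] \<in> tuples k M"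
    using Cons.prems by (auto simp: tuples_def)
  have "f (pre @ a # b # post) = \<ominus>\<^bsub>N\<^esub> f ((pre @ [b]) @ a # post)"
    using swap_adjacent[OF Cons.prems] by simp
  also have "f ((pre @ [b]) @ a # post) = sgn_smult K N (length post) (f (pre @ b # post @ [a]))"
    using Cons.IH[of "pre @ [b]"] t by simp
  finally show ?case using t by (simp add: N.sgn_smult_Suc)
qed

lemma move_nth_to_end:
  assumes "xs \<in> tuples k M" "i < k"
  shows "f xs = sgn_smult K N (k - Suc i) (f (omit_nth i xs @ [xs ! i]))"
  using move_to_end[of "take i xs" "xs ! i" "drop (Suc i) xs"] assms
  by (simp add: omit_nth_def id_take_nth_drop[symmetric] length_tuples)

end

(* Lengths n - 1 and n - Suc i occur side by side below; without this the simplifier rewrites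
   n - 1 to n - Suc 0, and facts about tuples of length n - 1 no longer match. *)
declare One_nat_def [simp del]

context alternating
begin

text \<open>
  In the two lemmas below \<open>I\<close> plays the part of an abelian ideal.  If the prefix \<open>pre\<close> has already used up one
  entry of \<open>I\<close>, then the later entries may be changed by elements of \<open>I\<close>.
\<close>

lemma perturbation_after_ideal_entry:
  assumes "I \<subseteq> carrier M"
    and two: "\<And>xs i j. xs \<in> tuples k M \<Longrightarrow> i < k \<Longrightarrow> j < k \<Longrightarrow> i \<noteq> j \<Longrightarrow> xs ! i \<in> I \<Longrightarrow> xs ! j \<in> I \<Longrightarrow> f xs = \<zero>\<^bsub>N\<^esub>"
    and "set pre \<subseteq> carrier M" "set pre \<inter> I \<noteq> {}" "length pre + length zs = k"
    and "\<And>z. z \<in> set zs \<Longrightarrow> a z \<in> carrier M" "\<And>z. z \<in> set zs \<Longrightarrow> d z \<in> I"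
  shows "f (pre @ map (\<lambda>z. a z \<oplus>\<^bsub>M\<^esub> d z) zs) = f (pre @ map a zs)"
  using assms(3-)
proof (induction zs arbitrary: pre)
  case Nil
  then show ?case by simp
next
  case (Cons z zs)
  let ?rest = "map (\<lambda>z. a z \<oplus>\<^bsub>M\<^esub> d z) zs"
  have mem: "a z \<in> carrier M" "d z \<in> I" "d z \<in> carrier M" using Cons.prems assms(1) by auto
  have rest: "set ?rest \<subseteq> carrier M" using Cons.prems assms(1) by (fastforce intro!: M.add.m_closed)
  obtain i where i: "i < length pre" "pre ! i \<in> I"
    using Cons.prems(2) by (auto simp: in_set_conv_nth)
  have tup: "pre @ x # ?rest \<in> tuples k M" if "x \<in> carrier M" for x
    using that rest Cons.prems by (auto simp: tuples_def)
  have "f (pre @ d z # ?rest) = \<zero>\<^bsub>N\<^esub>"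
    by (rule two[OF tup, of _ i "length pre"]) (use i mem Cons.prems in \<open>auto simp: nth_append\<close>)
  moreover have "f (pre @ (a z \<oplus>\<^bsub>M\<^esub> d z) # ?rest) = f (pre @ a z # ?rest) \<oplus>\<^bsub>N\<^esub> f (pre @ d z # ?rest)"
    using mem by (intro add_middle tup) auto
  moreover have "f ((pre @ [a z]) @ ?rest) = f ((pre @ [a z]) @ map a zs)"
    using Cons.prems mem by (intro Cons.IH) auto
  ultimately show ?case using tup mem by simp
qed

text \<open>
  First-order expansion: if \<open>f\<close> vanishes as soon as two entries lie in \<open>I\<close>, then in the multilinear
  expansion at \<open>a + d\<close> with \<open>d\<close> in \<open>I\<close> only the terms with at most one \<open>d\<close> survive.
  The prefix \<open>pre\<close> makes the statement inductive in the remaining entries.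
\<close>

lemma first_order_expansion:
  assumes "I \<subseteq> carrier M"
    and two: "\<And>xs i j. xs \<in> tuples k M \<Longrightarrow> i < k \<Longrightarrow> j < k \<Longrightarrow> i \<noteq> j \<Longrightarrow> xs ! i \<in> I \<Longrightarrow> xs ! j \<in> I \<Longrightarrow> f xs = \<zero>\<^bsub>N\<^esub>"
    and "set pre \<subseteq> carrier M" "length pre + length zs = k"
    and "\<And>z. z \<in> set zs \<Longrightarrow> a z \<in> carrier M" "\<And>z. z \<in> set zs \<Longrightarrow> d z \<in> I"
  shows "f (pre @ map (\<lambda>z. a z \<oplus>\<^bsub>M\<^esub> d z) zs) =
    f (pre @ map a zs) \<oplus>\<^bsub>N\<^esub> (\<Oplus>\<^bsub>N\<^esub>i\<in>{..<length zs}. f (pre @ (map a zs)[i := d (zs ! i)]))"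
  using assms(3-)
proof (induction zs arbitrary: pre)
  case Nil
  then have "pre \<in> tuples k M" by (auto simp: tuples_def)
  then show ?case using Nil by simp
next
  case (Cons z zs)
  let ?rest = "map (\<lambda>z. a z \<oplus>\<^bsub>M\<^esub> d z) zs"
  have mem: "a z \<in> carrier M" "d z \<in> I" "d z \<in> carrier M" using Cons.prems assms(1) by auto
  have rest: "set ?rest \<subseteq> carrier M" "set (map a zs) \<subseteq> carrier M"
    using Cons.prems assms(1) by (fastforce intro!: M.add.m_closed)+
  have tup: "pre @ x # xs \<in> tuples k M"
    if "x \<in> carrier M" "set xs \<subseteq> carrier M" "length xs = length zs" for x xs
    using that rest Cons.prems by (auto simp: tuples_def)
  let ?g = "\<lambda>i. f (pre @ (map a (z # zs))[i := d ((z # zs) ! i)])"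
  have g: "?g i \<in> carrier N" if "i \<le> length zs" for i
  proof (cases i)
    case 0 then show ?thesis using mem rest by (auto intro!: closed tup)
  next
    case (Suc l)
    have "set ((map a zs)[l := d (zs ! l)]) \<subseteq> carrier M"
      using Suc that Cons.prems(4) assms(1) rest(2) by (intro subset_trans[OF set_update_subset_insert]) auto
    then show ?thesis using Suc mem by (auto intro!: closed tup)
  qed
  have "f (pre @ (a z \<oplus>\<^bsub>M\<^esub> d z) # ?rest) = f ((pre @ [a z]) @ ?rest) \<oplus>\<^bsub>N\<^esub> f ((pre @ [d z]) @ ?rest)"
    using mem rest by (simp, intro add_middle tup) auto
  also have "f ((pre @ [d z]) @ ?rest) = f ((pre @ [d z]) @ map a zs)"
  proof (rule perturbation_after_ideal_entry[OF assms(1)])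
    show "f xs = \<zero>\<^bsub>N\<^esub>" if "xs \<in> tuples k M" "i < k" "j < k" "i \<noteq> j" "xs ! i \<in> I" "xs ! j \<in> I" for xs i j
      using that by (rule two)
  qed (use Cons.prems mem in auto)
  also have "\<dots> = ?g 0" by simp
  also have "f ((pre @ [a z]) @ ?rest) = f ((pre @ [a z]) @ map a zs) \<oplus>\<^bsub>N\<^esub>
      (\<Oplus>\<^bsub>N\<^esub>i\<in>{..<length zs}. f ((pre @ [a z]) @ (map a zs)[i := d (zs ! i)]))"
    using Cons.prems mem by (intro Cons.IH) auto
  also have "(\<Oplus>\<^bsub>N\<^esub>i\<in>{..<length zs}. f ((pre @ [a z]) @ (map a zs)[i := d (zs ! i)])) =
      (\<Oplus>\<^bsub>N\<^esub>i\<in>{..<length zs}. ?g (Suc i))"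
    by simp
  finally have "f (pre @ (a z \<oplus>\<^bsub>M\<^esub> d z) # ?rest) = f ((pre @ [a z]) @ map a zs) \<oplus>\<^bsub>N\<^esub>
      (\<Oplus>\<^bsub>N\<^esub>i\<in>{..<length zs}. ?g (Suc i)) \<oplus>\<^bsub>N\<^esub> ?g 0" .
  also have "\<dots> = f ((pre @ [a z]) @ map a zs) \<oplus>\<^bsub>N\<^esub> (\<Oplus>\<^bsub>N\<^esub>i\<in>{..<Suc (length zs)}. ?g i)"
  proof -
    have "f ((pre @ [a z]) @ map a zs) \<in> carrier N" using mem rest by (auto intro!: closed tup)
    moreover have "(\<Oplus>\<^bsub>N\<^esub>i\<in>{..<length zs}. ?g (Suc i)) \<in> carrier N"
      by (intro N.finsum_closed Pi_I g) simp
    moreover note N.finsum_lessThan_Suc_shift[OF g] g[of 0]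
    ultimately show ?thesis by (simp add: N.a_ac)
  qed
  finally show ?case by simp
qed

end

section \<open>Representations\<close>

locale n_Lie_module = G: module K G + V: module K V
  for K :: "('k, 'r) ring_scheme" and G :: "('k, 'g) nlie" and V :: "('k, 'v) module" +
  fixes n :: nat and \<rho> :: "'g list \<Rightarrow> 'v \<Rightarrow> 'v"
  assumes field: "field K" and n2: "n \<ge> 2" and G: "n_Lie_algebra K n G"
    and rep: "n_Lie_representation K n G V \<rho>"
begin

sublocale bracket: alternating K G G n "nbracket G"
  using G by unfold_locales (simp add: n_Lie_algebra_def)

lemma rho_linear: "xs \<in> tuples (n - 1) G \<Longrightarrow> linear_map K V V (\<rho> xs)"
  using rep by (simp add: n_Lie_representation_def)

lemma rho_closed [simp, intro]: "xs \<in> tuples (n - 1) G \<Longrightarrow> v \<in> carrier V \<Longrightarrow> \<rho> xs v \<in> carrier V"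
  by (rule linear_map_closed[OF rho_linear])

lemma rho_linear_map_between: "xs \<in> tuples (n - 1) G \<Longrightarrow> linear_map_between K V V (\<rho> xs)"
  by unfold_locales (rule rho_linear)

lemma rho_alternating: "v \<in> carrier V \<Longrightarrow> alternating K G V (n - 1) (\<lambda>xs. \<rho> xs v)"
  using rep by unfold_locales (simp add: n_Lie_representation_def)

lemma rho_zero: "xs \<in> tuples (n - 1) G \<Longrightarrow> \<rho> xs \<zero>\<^bsub>V\<^esub> = \<zero>\<^bsub>V\<^esub>"
  by (rule linear_map_between.zero[OF rho_linear_map_between])

lemma omit_tuple [simp, intro]: "xs \<in> tuples n G \<Longrightarrow> i < n \<Longrightarrow> omit_nth i xs \<in> tuples (n - 1) G"
  by (rule tuples_omit_nth)

text \<open>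
  The \<open>V\<close>-component of the bracket of \<open>(x\<^sub>1, v\<^sub>1), \<dots>, (x\<^sub>n, v\<^sub>n)\<close> in the semidirect product: each
  \<open>v\<^sub>i\<close> is carried to the last place, at the cost of a sign, and acted on by the other \<open>x\<close>'s.
\<close>

definition act :: "'g list \<Rightarrow> 'v list \<Rightarrow> 'v" where
  "act xs vs = (\<Oplus>\<^bsub>V\<^esub>i\<in>{..<n}. sgn_smult K V (n - Suc i) (\<rho> (omit_nth i xs) (vs ! i)))"

lemma act_term_closed:
  "xs \<in> tuples n G \<Longrightarrow> i < n \<Longrightarrow> v \<in> carrier V \<Longrightarrow>
    sgn_smult K V (n - Suc i) (\<rho> (omit_nth i xs) v) \<in> carrier V"
  by (intro V.sgn_smult_closed rho_closed omit_tuple)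

lemma act_closed [simp, intro]: "xs \<in> tuples n G \<Longrightarrow> vs \<in> tuples n V \<Longrightarrow> act xs vs \<in> carrier V"
  unfolding act_def by (intro V.finsum_closed) (auto intro!: act_term_closed tuples_nth)

lemma act_single:
  assumes "xs \<in> tuples n G" "j < n" "vs ! j \<in> carrier V" "\<And>i. i < n \<Longrightarrow> i \<noteq> j \<Longrightarrow> vs ! i = \<zero>\<^bsub>V\<^esub>"
  shows "act xs vs = sgn_smult K V (n - Suc j) (\<rho> (omit_nth j xs) (vs ! j))"
  unfolding act_def using assms
  by (intro V.finsum_single) (auto simp: rho_zero V.sgn_smult_zero intro!: act_term_closed)

lemma act_zero:
  assumes "xs \<in> tuples n G" "\<And>i. i < n \<Longrightarrow> vs ! i = \<zero>\<^bsub>V\<^esub>"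
  shows "act xs vs = \<zero>\<^bsub>V\<^esub>"
  using act_single[OF assms(1), of 0 vs] assms n2
  by (simp add: rho_zero V.sgn_smult_zero)

lemma act_add:
  assumes "xs \<in> tuples n G" "length es = n"
    and "\<And>e. e \<in> set es \<Longrightarrow> f e \<in> carrier V" "\<And>e. e \<in> set es \<Longrightarrow> g e \<in> carrier V"
  shows "act xs (map (\<lambda>e. f e \<oplus>\<^bsub>V\<^esub> g e) es) = act xs (map f es) \<oplus>\<^bsub>V\<^esub> act xs (map g es)"
proof -
  let ?t = "\<lambda>i v. sgn_smult K V (n - Suc i) (\<rho> (omit_nth i xs) v)"
  have "?t i (f (es ! i) \<oplus>\<^bsub>V\<^esub> g (es ! i)) = ?t i (f (es ! i)) \<oplus>\<^bsub>V\<^esub> ?t i (g (es ! i))" if "i < n" for i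
    using that assms
    by (simp add: linear_map_add[OF rho_linear] linear_map_add[OF V.linear_map_sgn_smult] rho_closed)
  then have "act xs (map (\<lambda>e. f e \<oplus>\<^bsub>V\<^esub> g e) es) =
      (\<Oplus>\<^bsub>V\<^esub>i\<in>{..<n}. ?t i (f (es ! i)) \<oplus>\<^bsub>V\<^esub> ?t i (g (es ! i)))"
    unfolding act_def using assms by (intro V.finsum_cong') (auto intro!: act_term_closed)
  also have "\<dots> = (\<Oplus>\<^bsub>V\<^esub>i\<in>{..<n}. ?t i (f (es ! i))) \<oplus>\<^bsub>V\<^esub> (\<Oplus>\<^bsub>V\<^esub>i\<in>{..<n}. ?t i (g (es ! i)))"
    using assms by (intro V.finsum_addf) (auto intro!: act_term_closed)
  also have "(\<Oplus>\<^bsub>V\<^esub>i\<in>{..<n}. ?t i (f (es ! i))) = act xs (map f es)"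
    unfolding act_def using assms by (intro V.finsum_cong') (auto intro!: act_term_closed)
  also have "(\<Oplus>\<^bsub>V\<^esub>i\<in>{..<n}. ?t i (g (es ! i))) = act xs (map g es)"
    unfolding act_def using assms by (intro V.finsum_cong') (auto intro!: act_term_closed)
  finally show ?thesis .
qed

lemma act_update:
  assumes "xs \<in> tuples n G" "vs \<in> tuples n V" "w \<in> carrier V" "j < n"
  shows "act xs (vs[j := w]) = sgn_smult K V (n - Suc j) (\<rho> (omit_nth j xs) w) \<oplus>\<^bsub>V\<^esub>
    (\<Oplus>\<^bsub>V\<^esub>i\<in>{..<n - 1}. let l = (if i < j then i else Suc i)
       in sgn_smult K V (n - Suc l) (\<rho> (omit_nth l xs) (vs ! l)))"
proof -
  let ?t = "\<lambda>i. sgn_smult K V (n - Suc i) (\<rho> (omit_nth i xs) (vs[j := w] ! i))"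
  have t: "?t i \<in> carrier V" if "i < n" for i
    using that assms by (intro act_term_closed tuples_nth[OF tuples_update]) auto
  show ?thesis
    unfolding act_def V.finsum_split_off[of n ?t, OF t assms(4), simplified]
    using assms 
    apply (simp add: length_tuples)
    apply (rule arg_cong[where f = "\<lambda>z. _ \<oplus>\<^bsub>V\<^esub> z"])
    apply (rule V.finsum_cong')
    apply (auto simp: Let_def intro!: act_term_closed tuples_nth)
    done
qed

text \<open>
  This separates the two kinds of terms in a bracket \<open>[x\<^sub>1, \<dots>, x\<^bsub>n-1\<^esub>, a]\<close>: those in which the representation is
  applied to a tuple containing \<open>a\<close>, and the one in which \<open>\<rho>(x\<^sub>1, \<dots>, x\<^bsub>n-1\<^esub>)\<close> acts on the component of \<open>a\<close>.
\<close>

lemma act_snoc: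
  assumes "xs \<in> tuples (n - 1) G" "us \<in> tuples (n - 1) V" "a \<in> carrier G" "b \<in> carrier V"
  shows "act (xs @ [a]) (us @ [b]) =
    (\<Oplus>\<^bsub>V\<^esub>k\<in>{..<n - 1}. sgn_smult K V (n - Suc k) (\<rho> (omit_nth k xs @ [a]) (us ! k))) \<oplus>\<^bsub>V\<^esub> \<rho> xs b"
proof -
  have n: "n = Suc (n - 1)" using n2 by simp
  have len: "length xs = n - 1" "length us = n - 1" using assms by (auto simp: length_tuples)
  let ?t = "\<lambda>i. sgn_smult K V (n - Suc i) (\<rho> (omit_nth i (xs @ [a])) ((us @ [b]) ! i))"
  have tup: "xs @ [a] \<in> tuples n G" "us @ [b] \<in> tuples n V"
    using assms n tuples_snoc by metis+
  have t: "?t i \<in> carrier V" if "i < n" for i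
    using that tup by (intro act_term_closed tuples_nth) auto
  have "act (xs @ [a]) (us @ [b]) = (\<Oplus>\<^bsub>V\<^esub>i\<in>{..<Suc (n - 1)}. ?t i)"
    unfolding act_def using n by simp
  also have "\<dots> = ?t (n - 1) \<oplus>\<^bsub>V\<^esub> (\<Oplus>\<^bsub>V\<^esub>i\<in>{..<n - 1}. ?t i)"
    using t n2 by (intro V.finsum_lessThan_Suc) auto
  also have "(\<Oplus>\<^bsub>V\<^esub>i\<in>{..<n - 1}. ?t i) =
      (\<Oplus>\<^bsub>V\<^esub>k\<in>{..<n - 1}. sgn_smult K V (n - Suc k) (\<rho> (omit_nth k xs @ [a]) (us ! k)))"
  proof (rule V.finsum_cong')
    fix k assume k: "k \<in> {..<n - 1}"
    then show *: "?t k = sgn_smult K V (n - Suc k) (\<rho> (omit_nth k xs @ [a]) (us ! k))"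
      using len by (simp add: omit_nth_snoc nth_append)
  next
    show "(\<lambda>k. sgn_smult K V (n - Suc k) (\<rho> (omit_nth k xs @ [a]) (us ! k))) \<in> {..<n - 1} \<rightarrow> carrier V"
    proof
      fix k assume k: "k \<in> {..<n - 1}"
      then show "sgn_smult K V (n - Suc k) (\<rho> (omit_nth k xs @ [a]) (us ! k)) \<in> carrier V"
        using len t[of k] by (simp add: omit_nth_snoc nth_append)
    qed
  qed simp
  also have "?t (n - 1) = \<rho> xs b"
    using len n2 assms omit_nth_snoc_last[of xs a] by (simp add: nth_append)
  finally show ?thesis
  proof (subst V.a_comm)
    show "(\<Oplus>\<^bsub>V\<^esub>k\<in>{..<n - 1}. sgn_smult K V (n - Suc k) (\<rho> (omit_nth k xs @ [a]) (us ! k))) \<in> carrier V"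
    proof (intro V.finsum_closed Pi_I)
      fix k assume k: "k \<in> {..<n - 1}"
      then show "sgn_smult K V (n - Suc k) (\<rho> (omit_nth k xs @ [a]) (us ! k)) \<in> carrier V"
        using len t[of k] by (simp add: omit_nth_snoc nth_append)
    qed
  qed (use assms in auto)
qed

end

section \<open>Linear sections\<close>

text \<open>
  A maximal subspace \<open>W\<close> on which \<open>p\<close> is injective exists by Zorn's lemma, and is mapped onto \<open>p(E)\<close>: if \<open>p e\<close> were
  missing from \<open>p(W)\<close>, then \<open>p\<close> would still be injective on the span of \<open>W\<close> and \<open>e\<close>, because scalars are
  invertible.  The section is the inverse of \<open>p\<close> on \<open>W\<close>.
\<close>

lemma linear_section_exists:
  assumes "field K" "module K E" "module K G" "linear_map K E G p" "p ` carrier E = carrier G"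
  shows "\<exists>\<sigma>. linear_section K E G p \<sigma>"
proof -
  interpret K: field K by fact
  interpret E: module K E by fact
  interpret p: linear_map_between K E G p
    using assms by (simp add: linear_map_between_def linear_map_between_axioms_def)
  define sub where "sub W \<longleftrightarrow> W \<subseteq> carrier E \<and> \<zero>\<^bsub>E\<^esub> \<in> W \<and> (\<forall>x\<in>W. \<forall>y\<in>W. x \<oplus>\<^bsub>E\<^esub> y \<in> W) \<and>
      (\<forall>a\<in>carrier K. \<forall>x\<in>W. a \<odot>\<^bsub>E\<^esub> x \<in> W) \<and> (\<forall>x\<in>W. p x = \<zero>\<^bsub>G\<^esub> \<longrightarrow> x = \<zero>\<^bsub>E\<^esub>)" for W
  have "\<exists>W\<in>Collect sub. \<forall>U\<in>Collect sub. W \<subseteq> U \<longrightarrow> U = W"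
  proof (rule subset_Zorn_nonempty)
    have "sub {\<zero>\<^bsub>E\<^esub>}" by (simp add: sub_def)
    then show "Collect sub \<noteq> {}" by blast
    fix C assume C: "C \<noteq> {}" "subset.chain (Collect sub) C"
    have mem: "sub U" if "U \<in> C" for U using C that by (auto simp: subset_chain_def)
    have "x \<oplus>\<^bsub>E\<^esub> y \<in> \<Union> C" if xy: "x \<in> \<Union> C" "y \<in> \<Union> C" for x y
    proof -
      obtain U U' where XY: "U \<in> C" "U' \<in> C" "x \<in> U" "y \<in> U'" using xy by blast
      have "U \<subseteq> U' \<or> U' \<subseteq> U" using C XY by (auto simp: subset_chain_def)
      then obtain Z where Z: "Z \<in> C" "x \<in> Z" "y \<in> Z" using XY by blast
      then have "x \<oplus>\<^bsub>E\<^esub> y \<in> Z" using mem[OF Z(1)] by (simp add: sub_def)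
      then show ?thesis using Z by blast
    qed
    moreover obtain U where "U \<in> C" using C by blast
    then have "\<zero>\<^bsub>E\<^esub> \<in> \<Union> C" using mem unfolding sub_def by blast
    moreover have "\<Union> C \<subseteq> carrier E" using mem unfolding sub_def by blast
    moreover have "a \<odot>\<^bsub>E\<^esub> x \<in> \<Union> C" if "a \<in> carrier K" "x \<in> \<Union> C" for a x
      using that mem unfolding sub_def by blast
    moreover have "x = \<zero>\<^bsub>E\<^esub>" if "x \<in> \<Union> C" "p x = \<zero>\<^bsub>G\<^esub>" for x
      using that mem unfolding sub_def by blast
    ultimately show "\<Union> C \<in> Collect sub"
      unfolding mem_Collect_eq sub_def by (intro conjI ballI impI)
  qed
  then obtain W where W: "sub W" and max: "\<And>U. sub U \<Longrightarrow> W \<subseteq> U \<Longrightarrow> U = W" by blast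
  have Wc: "W \<subseteq> carrier E" and W0: "\<zero>\<^bsub>E\<^esub> \<in> W"
    and Wadd: "\<And>x y. x \<in> W \<Longrightarrow> y \<in> W \<Longrightarrow> x \<oplus>\<^bsub>E\<^esub> y \<in> W"
    and Wsm: "\<And>a x. a \<in> carrier K \<Longrightarrow> x \<in> W \<Longrightarrow> a \<odot>\<^bsub>E\<^esub> x \<in> W"
    and Winj: "\<And>x. x \<in> W \<Longrightarrow> p x = \<zero>\<^bsub>G\<^esub> \<Longrightarrow> x = \<zero>\<^bsub>E\<^esub>"
    using W unfolding sub_def by blast+
  have Wneg: "\<ominus>\<^bsub>E\<^esub> x \<in> W" if "x \<in> W" for x
    using Wsm[of "\<ominus>\<^bsub>K\<^esub> \<one>\<^bsub>K\<^esub>" x] that Wc by (auto simp: E.smult_l_minus)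
  have surj: "p e \<in> p ` W" if e: "e \<in> carrier E" for e
  proof (rule ccontr)
    assume notin: "p e \<notin> p ` W"
    define U where "U = {w \<oplus>\<^bsub>E\<^esub> a \<odot>\<^bsub>E\<^esub> e | w a. w \<in> W \<and> a \<in> carrier K}"
    have XI: "w \<oplus>\<^bsub>E\<^esub> a \<odot>\<^bsub>E\<^esub> e \<in> U" if "w \<in> W" "a \<in> carrier K" for w a
      using that unfolding U_def by blast
    have WX: "W \<subseteq> U"
    proof
      fix w assume "w \<in> W"
      then show "w \<in> U" using XI[of w "\<zero>\<^bsub>K\<^esub>"] e Wc by auto
    qed
    have "sub U"
      unfolding sub_def
    proof (intro conjI ballI impI)
      show "U \<subseteq> carrier E" using e Wc unfolding U_def by auto
      show "\<zero>\<^bsub>E\<^esub> \<in> U" using WX W0 by blast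
    next
      fix x y assume "x \<in> U" "y \<in> U"
      then obtain w a w' a' where x: "x = w \<oplus>\<^bsub>E\<^esub> a \<odot>\<^bsub>E\<^esub> e" "w \<in> W" "a \<in> carrier K"
        and y: "y = w' \<oplus>\<^bsub>E\<^esub> a' \<odot>\<^bsub>E\<^esub> e" "w' \<in> W" "a' \<in> carrier K"
        unfolding U_def by blast
      have "w \<in> carrier E" "w' \<in> carrier E" using Wc x y by auto
      then have "x \<oplus>\<^bsub>E\<^esub> y = (w \<oplus>\<^bsub>E\<^esub> w') \<oplus>\<^bsub>E\<^esub> (a \<oplus>\<^bsub>K\<^esub> a') \<odot>\<^bsub>E\<^esub> e"
        using x y e by (simp add: E.smult_l_distr E.M.a_ac)
      then show "x \<oplus>\<^bsub>E\<^esub> y \<in> U" using XI Wadd x y by simp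
    next
      fix b x assume b: "b \<in> carrier K" and "x \<in> U"
      then obtain w a where x: "x = w \<oplus>\<^bsub>E\<^esub> a \<odot>\<^bsub>E\<^esub> e" "w \<in> W" "a \<in> carrier K"
        unfolding U_def by blast
      have "b \<odot>\<^bsub>E\<^esub> x = b \<odot>\<^bsub>E\<^esub> w \<oplus>\<^bsub>E\<^esub> (b \<otimes>\<^bsub>K\<^esub> a) \<odot>\<^bsub>E\<^esub> e"
        using x b e Wc by (auto simp: E.smult_r_distr E.smult_assoc1)
      then show "b \<odot>\<^bsub>E\<^esub> x \<in> U" using XI Wsm x b by simp
    next
      fix x assume "x \<in> U" and px: "p x = \<zero>\<^bsub>G\<^esub>"
      then obtain w a where x: "x = w \<oplus>\<^bsub>E\<^esub> a \<odot>\<^bsub>E\<^esub> e" "w \<in> W" "a \<in> carrier K"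
        unfolding U_def by blast
      have w: "w \<in> carrier E" using x Wc by auto
      have sum: "p w \<oplus>\<^bsub>G\<^esub> a \<odot>\<^bsub>G\<^esub> p e = \<zero>\<^bsub>G\<^esub>"
        using px x w e by (simp add: p.add p.smult)
      have "a = \<zero>\<^bsub>K\<^esub>"
      proof (rule ccontr)
        assume "a \<noteq> \<zero>\<^bsub>K\<^esub>"
        then have a: "inv\<^bsub>K\<^esub> a \<in> carrier K" "inv\<^bsub>K\<^esub> a \<otimes>\<^bsub>K\<^esub> a = \<one>\<^bsub>K\<^esub>"
          using x K.field_Units by (auto intro: K.Units_l_inv K.Units_inv_closed)
        have "a \<odot>\<^bsub>G\<^esub> p e = \<ominus>\<^bsub>G\<^esub> p w"
          using sum x w e by (intro p.N.minus_equality[symmetric]) (simp_all add: p.N.a_comm)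
        then have "inv\<^bsub>K\<^esub> a \<odot>\<^bsub>G\<^esub> (a \<odot>\<^bsub>G\<^esub> p e) = inv\<^bsub>K\<^esub> a \<odot>\<^bsub>G\<^esub> (\<ominus>\<^bsub>G\<^esub> p w)" by simp
        then have "p e = p (inv\<^bsub>K\<^esub> a \<odot>\<^bsub>E\<^esub> (\<ominus>\<^bsub>E\<^esub> w))"
          using a x w e by (simp add: p.N.smult_assoc1[symmetric] p.smult p.neg)
        then show False using notin Wsm[OF a(1) Wneg[OF x(2)]] by blast
      qed
      then show "x = \<zero>\<^bsub>E\<^esub>" using x px Winj w e by simp
    qed
    then have "U = W" using max WX by blast
    moreover have "e \<in> U" using XI[OF W0 K.one_closed] e by simp
    ultimately show False using notin by blast
  qed
  have "\<exists>w. w \<in> W \<and> p w = x" if "x \<in> carrier G" for x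
  proof -
    have "x \<in> p ` carrier E" using that by (simp add: assms(5))
    then obtain e where "e \<in> carrier E" "x = p e" by (elim imageE)
    then have "x \<in> p ` W" using surj[of e] by simp
    then show ?thesis by (elim imageE) auto
  qed
  then obtain \<sigma> where \<sigma>: "\<And>x. x \<in> carrier G \<Longrightarrow> \<sigma> x \<in> W \<and> p (\<sigma> x) = x"
    using bchoice[of "carrier G" "\<lambda>x w. w \<in> W \<and> p w = x"] by blast
  have uniq: "w = w'" if "w \<in> W" "w' \<in> W" "p w = p w'" for w w'
  proof -
    have c: "w \<in> carrier E" "w' \<in> carrier E" using that Wc by auto
    have "p (w \<oplus>\<^bsub>E\<^esub> \<ominus>\<^bsub>E\<^esub> w') = \<zero>\<^bsub>G\<^esub>" using that c by (simp add: p.add p.neg p.N.r_neg)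
    then have "w \<oplus>\<^bsub>E\<^esub> \<ominus>\<^bsub>E\<^esub> w' = \<zero>\<^bsub>E\<^esub>" using that Wadd Wneg by (intro Winj) auto
    then show ?thesis using c E.minus_eq_zero_iff by (simp add: E.M.minus_eq)
  qed
  have "linear_section K E G p \<sigma>"
    unfolding linear_section_def linear_map_def
  proof (intro conjI ballI)
    show "\<sigma> \<in> carrier G \<rightarrow> carrier E" using \<sigma> Wc by blast
    fix x assume x: "x \<in> carrier G"
    then have sx: "\<sigma> x \<in> carrier E" using \<sigma> Wc by blast
    show "p (\<sigma> x) = x" using x \<sigma> by blast
    { fix y assume y: "y \<in> carrier G"
      have "\<sigma> y \<in> carrier E" using y \<sigma> Wc by blast
      then show "\<sigma> (x \<oplus>\<^bsub>G\<^esub> y) = \<sigma> x \<oplus>\<^bsub>E\<^esub> \<sigma> y"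
        using x y \<sigma> sx by (intro uniq) (auto simp: Wadd p.add) }
    fix a assume a: "a \<in> carrier K"
    show "\<sigma> (a \<odot>\<^bsub>G\<^esub> x) = a \<odot>\<^bsub>E\<^esub> \<sigma> x"
      using x a \<sigma> sx by (intro uniq) (auto simp: Wsm p.smult)
  qed
  then show ?thesis by blast
qed

section \<open>The cocycle of an abelian extension\<close>

text \<open>
  The link between extensions and cocycles.  A retraction \<open>r\<close> of \<open>i\<close> identifies \<open>E\<close> with \<open>G \<times> V\<close> through
  \<open>e \<mapsto> (p e, r e)\<close>, and in these coordinates the bracket is that of the semidirect product twisted by \<open>\<omega>\<close>.
  Working with \<open>r\<close> rather than with a section of \<open>p\<close> gives the coordinates of every element of \<open>E\<close> directly,
  not only those of the elements in the image of the section.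
\<close>

definition (in n_Lie_module) presents :: "('g list \<Rightarrow> 'v) \<Rightarrow> ('k, 'v, 'e, 'g) ext \<Rightarrow> ('e \<Rightarrow> 'v) \<Rightarrow> bool" where
  "presents \<omega> = (\<lambda>(E, i, p) r.
     linear_map K E V r \<and> (\<forall>v\<in>carrier V. r (i v) = v) \<and>
     (\<forall>es\<in>tuples n E. r (nbracket E es) = \<omega> (map p es) \<oplus>\<^bsub>V\<^esub> act (map p es) (map r es)))"

lemma linear_map_abelian_nlie [simp]: "linear_map K (abelian_nlie V) E i = linear_map K V E i"
  by (simp add: linear_map_def abelian_nlie_def module.extend_def)

lemma carrier_abelian_nlie [simp]: "carrier (abelian_nlie V) = carrier V"
  by (simp add: abelian_nlie_def module.extend_def)

locale abelian_extension = n_Lie_module K G V n \<rho>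
  for K :: "('k, 'r) ring_scheme" and G :: "('k, 'g) nlie" and V :: "('k, 'v) module" and n \<rho> +
  fixes E :: "('k, 'e) nlie" and i :: "'v \<Rightarrow> 'e" and p :: "'e \<Rightarrow> 'g"
  assumes extension: "(E, i, p) \<in> abelian_extensions K n G V \<rho>"
begin

lemma extension_facts:
  shows E_nlie: "n_Lie_algebra K n E"
    and i_hom: "n_Lie_hom K n (abelian_nlie V) E i" and p_hom: "n_Lie_hom K n E G p"
    and i_inj: "inj_on i (carrier V)"
    and exact: "i ` carrier V = {e \<in> carrier E. p e = \<zero>\<^bsub>G\<^esub>}"
    and p_surj: "p ` carrier E = carrier G"
    and induces: "induces_representation K n G V \<rho> (E, i, p)"
  using extension unfolding abelian_extensions_def n_Lie_extension_def by simp_all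

lemma ideal: "abelian_ideal K n E (i ` carrier V)"
  using extension unfolding abelian_extensions_def by blast

sublocale E: module K E
  using E_nlie by (simp add: n_Lie_algebra_def vector_space_over_def)

sublocale B: alternating K E E n "nbracket E"
  using E_nlie by unfold_locales (simp add: n_Lie_algebra_def)

sublocale i: linear_map_between K V E i
  using i_hom by unfold_locales (simp add: n_Lie_hom_def)

sublocale p: linear_map_between K E G p
  using p_hom by unfold_locales (simp add: n_Lie_hom_def)

lemma p_bracket: "es \<in> tuples n E \<Longrightarrow> p (nbracket E es) = nbracket G (map p es)"
  using p_hom by (simp add: n_Lie_hom_def)

lemma p_i [simp]: "v \<in> carrier V \<Longrightarrow> p (i v) = \<zero>\<^bsub>G\<^esub>"
  using exact by blast

lemma kernelE:
  assumes "e \<in> carrier E" "p e = \<zero>\<^bsub>G\<^esub>" obtains v where "v \<in> carrier V" "e = i v"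
  using assms exact by blast

lemma bracket_two_ideal:
  "xs \<in> tuples n E \<Longrightarrow> l < n \<Longrightarrow> j < n \<Longrightarrow> l \<noteq> j \<Longrightarrow> xs ! l \<in> i ` carrier V \<Longrightarrow> xs ! j \<in> i ` carrier V \<Longrightarrow>
     nbracket E xs = \<zero>\<^bsub>E\<^esub>"
  using ideal unfolding abelian_ideal_def by blast

lemma section_exists: "\<exists>\<sigma>. linear_section K E G p \<sigma>"
  using linear_section_exists[OF field E.module_axioms G.module_axioms p.linear p_surj] .

lemma jointly_injective:
  assumes r: "linear_map K E V r" "\<And>v. v \<in> carrier V \<Longrightarrow> r (i v) = v"
    and e: "e \<in> carrier E" "e' \<in> carrier E" "p e = p e'" "r e = r e'"
  shows "e = e'"
proof -
  interpret r: linear_map_between K E V r by unfold_locales (rule r)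
  have "p (e \<ominus>\<^bsub>E\<^esub> e') = \<zero>\<^bsub>G\<^esub>" using e by (simp add: p.minus G.minus_eq_zero_iff)
  then obtain v where v: "v \<in> carrier V" "e \<ominus>\<^bsub>E\<^esub> e' = i v"
    using e by (elim kernelE[rotated]) auto
  then have "v = r (e \<ominus>\<^bsub>E\<^esub> e')" using r by simp
  also have "\<dots> = \<zero>\<^bsub>V\<^esub>" using e by (simp add: r.minus V.minus_eq_zero_iff)
  finally show ?thesis using v e E.minus_eq_zero_iff[of e e'] by simp
qed

end

text \<open>
  A linear section \<open>\<sigma>\<close> yields the retraction \<open>e \<mapsto> e - \<sigma>(p e)\<close> onto the kernel of \<open>p\<close>, which is \<open>V\<close>.
\<close>

locale split_abelian_extension = abelian_extension +
  fixes \<sigma>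
  assumes \<sigma>: "linear_section K E G p \<sigma>"
begin

sublocale \<sigma>: linear_map_between K G E \<sigma>
  using \<sigma> by unfold_locales (simp add: linear_section_def)

lemma p_\<sigma> [simp]: "x \<in> carrier G \<Longrightarrow> p (\<sigma> x) = x"
  using \<sigma> by (simp add: linear_section_def)

lemma induced: "xs \<in> tuples (n - 1) G \<Longrightarrow> u \<in> carrier V \<Longrightarrow> nbracket E (map \<sigma> xs @ [i u]) = i (\<rho> xs u)"
  using induces \<sigma> by (simp add: induces_representation_def)

definition r where "r e = the_inv_into (carrier V) i (e \<ominus>\<^bsub>E\<^esub> \<sigma> (p e))"

lemma
  assumes e: "e \<in> carrier E"
  shows r_closed [simp]: "r e \<in> carrier V" and i_r: "i (r e) = e \<ominus>\<^bsub>E\<^esub> \<sigma> (p e)"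
proof -
  have "p (e \<ominus>\<^bsub>E\<^esub> \<sigma> (p e)) = \<zero>\<^bsub>G\<^esub>" using e by (simp add: p.minus G.minus_eq_zero_iff)
  then have *: "e \<ominus>\<^bsub>E\<^esub> \<sigma> (p e) \<in> i ` carrier V" using e exact by auto
  show "r e \<in> carrier V" unfolding r_def by (rule the_inv_into_into[OF i_inj * order_refl])
  show "i (r e) = e \<ominus>\<^bsub>E\<^esub> \<sigma> (p e)" unfolding r_def by (rule f_the_inv_into_f[OF i_inj *])
qed

lemma decompose: "e \<in> carrier E \<Longrightarrow> e = \<sigma> (p e) \<oplus>\<^bsub>E\<^esub> i (r e)"
  by (simp add: i_r E.minus_eq E.M.a_ac E.M.r_neg2 E.M.r_neg1 E.M.r_neg)

lemma r_linear: "linear_map K E V r"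
proof (rule linear_map_of_comp_inj[OF E.module_axioms V.module_axioms i.linear i_inj])
  have "linear_map K E E (\<lambda>e. e)" by (auto simp: linear_map_def)
  then have "linear_map K E E (\<lambda>e. e \<ominus>\<^bsub>E\<^esub> \<sigma> (p e))"
    by (intro linear_map_pointwise_minus linear_map_comp[OF p.linear \<sigma>.linear] E.module_axioms)
  then show "linear_map K E E (\<lambda>e. i (r e))"
    by (rule linear_map_cong) (auto simp: i_r E.abelian_monoid_axioms E.module_axioms)
qed auto

sublocale r: linear_map_between K E V r
  by unfold_locales (rule r_linear)

lemma r_i [simp]: "v \<in> carrier V \<Longrightarrow> r (i v) = v"
  by (rule inj_onD[OF i_inj]) (simp_all add: i_r E.minus_eq)

lemma r_\<sigma> [simp]: "x \<in> carrier G \<Longrightarrow> r (\<sigma> x) = \<zero>\<^bsub>V\<^esub>"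
  by (rule inj_onD[OF i_inj]) (simp_all add: i_r E.minus_eq E.M.r_neg)

text \<open>
  The defect of \<open>\<sigma>\<close> from being a homomorphism, \<open>[\<sigma> x\<^sub>1, \<dots>, \<sigma> x\<^sub>n] - \<sigma>[x\<^sub>1, \<dots>, x\<^sub>n]\<close>.  As \<open>r\<close> kills the image of \<open>\<sigma>\<close>,
  the first term alone already has this defect as its \<open>V\<close>-component.
\<close>

definition \<omega> where "\<omega> = (\<lambda>xs\<in>tuples n G. r (nbracket E (map \<sigma> xs)))"

lemma map_\<sigma> [simp, intro]: "xs \<in> tuples k G \<Longrightarrow> map \<sigma> xs \<in> tuples k E"
  by (erule tuples_map) simp

lemma map_p [simp, intro]: "xs \<in> tuples k E \<Longrightarrow> map p xs \<in> tuples k G"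
  by (erule tuples_map) simp

lemma map_r [simp, intro]: "xs \<in> tuples k E \<Longrightarrow> map r xs \<in> tuples k V"
  by (erule tuples_map) simp

lemma bracket_ideal_entry:
  assumes "xs \<in> tuples n G" "l < n" "v \<in> carrier V"
  shows "nbracket E ((map \<sigma> xs)[l := i v]) = i (sgn_smult K V (n - Suc l) (\<rho> (omit_nth l xs) v))"
proof -
  have len: "length xs = n" using assms by (simp add: length_tuples)
  have "nbracket E ((map \<sigma> xs)[l := i v]) =
      sgn_smult K E (n - Suc l) (nbracket E (omit_nth l (map \<sigma> xs) @ [i v]))"
    using B.move_nth_to_end[OF tuples_update[OF map_\<sigma>[OF assms(1)]] assms(2), of "i v" l] assms len
    by simp
  also have "nbracket E (omit_nth l (map \<sigma> xs) @ [i v]) = i (\<rho> (omit_nth l xs) v)"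
    using assms by (simp add: omit_nth_map induced)
  finally show ?thesis using assms by (simp add: i.sgn rho_closed)
qed

text \<open>
  Write each entry as \<open>\<sigma>(p e) + i(r e)\<close> and expand: brackets with two entries in the abelian ideal vanish, the
  term without any gives \<open>\<omega>\<close>, and the terms with exactly one give the action of the induced representation.
\<close>

lemma r_bracket:
  assumes es: "es \<in> tuples n E"
  shows "r (nbracket E es) = \<omega> (map p es) \<oplus>\<^bsub>V\<^esub> act (map p es) (map r es)"
proof -
  have len: "length es = n" using es by (simp add: length_tuples)
  have mem: "e \<in> carrier E" if "e \<in> set es" for e using that es by (auto simp: tuples_def)
  have esl: "es ! l \<in> carrier E" if "l < n" for l using tuples_nth[OF es that] .
  let ?t = "\<lambda>l. sgn_smult K V (n - Suc l) (\<rho> (omit_nth l (map p es)) (map r es ! l))"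
  have t: "?t l \<in> carrier V" if "l < n" for l
    using that len esl es by (intro act_term_closed) auto
  have "es = [] @ map (\<lambda>e. \<sigma> (p e) \<oplus>\<^bsub>E\<^esub> i (r e)) es"
    using mem decompose by (simp add: map_idI)
  then have "nbracket E es = nbracket E ([] @ map (\<lambda>e. \<sigma> (p e) \<oplus>\<^bsub>E\<^esub> i (r e)) es)" by simp
  also have "\<dots> = nbracket E ([] @ map (\<lambda>e. \<sigma> (p e)) es) \<oplus>\<^bsub>E\<^esub>
      (\<Oplus>\<^bsub>E\<^esub>l\<in>{..<length es}. nbracket E ([] @ (map (\<lambda>e. \<sigma> (p e)) es)[l := i (r (es ! l))]))"
    using bracket_two_ideal len mem by (intro B.first_order_expansion[where I = "i ` carrier V"]) auto
  also have "(\<Oplus>\<^bsub>E\<^esub>l\<in>{..<length es}. nbracket E ([] @ (map (\<lambda>e. \<sigma> (p e)) es)[l := i (r (es ! l))])) =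
      (\<Oplus>\<^bsub>E\<^esub>l\<in>{..<n}. i (?t l))"
    using len t esl es bracket_ideal_entry[of "map p es"]
    by (intro E.M.finsum_cong') (auto simp: comp_def)
  also have "\<dots> = i (act (map p es) (map r es))"
    unfolding act_def using t by (intro i.finsum[symmetric]) auto
  finally have "nbracket E es = nbracket E (map \<sigma> (map p es)) \<oplus>\<^bsub>E\<^esub> i (act (map p es) (map r es))"
    by (simp add: comp_def)
  then show ?thesis using es map_\<sigma>[OF map_p[OF es]] by (simp add: r.add \<omega>_def B.closed act_closed del: map_map)
qed

lemma \<omega>_closed [simp, intro]: "xs \<in> tuples n G \<Longrightarrow> \<omega> xs \<in> carrier V"
  by (simp add: \<omega>_def)

lemma \<omega>_alternating: "alternating_map K n G V \<omega>"
  unfolding alternating_map_def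
proof (intro conjI ballI allI impI)
  show "\<omega> \<in> tuples n G \<rightarrow> carrier V" by auto
next
  fix xs l assume xs: "xs \<in> tuples n G" and l: "l < n"
  have "linear_map K G V (\<lambda>x. r (nbracket E ((map \<sigma> xs)[l := \<sigma> x])))"
    using xs l by (intro linear_map_comp[OF \<sigma>.linear linear_map_comp[OF B.linear r_linear]]) auto
  then show "linear_map K G V (\<lambda>x. \<omega> (xs[l := x]))"
    by (rule linear_map_cong)
      (use xs in \<open>auto simp: \<omega>_def map_update tuples_update G.abelian_monoid_axioms G.module_axioms\<close>)
next
  fix xs l j assume xs: "xs \<in> tuples n G" and lj: "l < n" "j < n" "l \<noteq> j \<and> xs ! l = xs ! j"
  then have "nbracket E (map \<sigma> xs) = \<zero>\<^bsub>E\<^esub>"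
    by (intro B.eq_zero[of _ l j]) (auto simp: length_tuples)
  then show "\<omega> xs = \<zero>\<^bsub>V\<^esub>" using xs by (simp add: \<omega>_def)
qed

text \<open>
  The cocycle identity is the \<open>V\<close>-component, in the coordinates \<open>(p, r)\<close>, of the fundamental identity of \<open>E\<close> at
  elements \<open>\<sigma> x\<^sub>i\<close> and \<open>\<sigma> y\<^sub>j\<close>.  As \<open>r\<close> vanishes at these elements, each action sum that occurs has
  at most one nonzero term.
\<close>

lemma \<omega>_cocycle: "\<omega> \<in> one_cocycles K n G V \<rho>"
  unfolding one_cocycles_def
proof (intro CollectI conjI ballI)
  show "\<omega> \<in> extensional (tuples n G)" by (simp add: \<omega>_def)
  show "alternating_map K n G V \<omega>" by (rule \<omega>_alternating)
  fix xs ys assume xs: "xs \<in> tuples (n - 1) G" and ys: "ys \<in> tuples n G"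
  let ?X = "map \<sigma> xs" and ?Y = "map \<sigma> ys"
  have lenx: "length xs = n - 1" and leny: "length ys = n" using xs ys by (auto simp: length_tuples)
  have snocG: "xs @ [z] \<in> tuples n G" if "z \<in> carrier G" for z
    using tuples_snoc[OF xs that] n2 by simp
  have snocE: "?X @ [z] \<in> tuples n E" if "z \<in> carrier E" for z
    using tuples_snoc[OF map_\<sigma>[OF xs] that] n2 by simp
  have pX: "map p ?X = xs" and pY: "map p ?Y = ys"
    using xs ys by (auto simp: tuples_def intro!: map_idI)
  have r_sigma: "map r ?X ! l = \<zero>\<^bsub>V\<^esub>" if "l < n - 1" for l
    using that lenx tuples_nth[OF xs that] by simp
  have r_Y: "map r ?Y ! l = \<zero>\<^bsub>V\<^esub>" if "l < n" for l
    using that leny tuples_nth[OF ys that] by simp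
  \<comment> \<open>brackets with at most one entry outside the image of \<open>\<sigma>\<close>\<close>
  have last: "r (nbracket E (?X @ [e])) = \<omega> (xs @ [p e]) \<oplus>\<^bsub>V\<^esub> \<rho> xs (r e)" if e: "e \<in> carrier E" for e
  proof -
    have "act (xs @ [p e]) (map r ?X @ [r e]) =
        sgn_smult K V (n - Suc (n - 1)) (\<rho> (omit_nth (n - 1) (xs @ [p e])) ((map r ?X @ [r e]) ! (n - 1)))"
    proof (rule act_single)
      fix l assume "l < n" "l \<noteq> n - 1"
      then have "l < n - 1" by simp
      then show "(map r ?X @ [r e]) ! l = \<zero>\<^bsub>V\<^esub>" using r_sigma[of l] lenx by (simp add: nth_append)
    qed (use e lenx n2 snocG in \<open>auto simp: nth_append\<close>)
    also have "\<dots> = \<rho> xs (r e)"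
      using lenx n2 e xs omit_nth_snoc_last[of xs "p e"] by (simp add: nth_append rho_closed)
    finally show ?thesis using r_bracket[OF snocE[OF e]] pX by simp
  qed
  have slot: "r (nbracket E (?Y[j := e])) =
      \<omega> (ys[j := p e]) \<oplus>\<^bsub>V\<^esub> sgn_smult K V (n - Suc j) (\<rho> (omit_nth j ys) (r e))"
    if e: "e \<in> carrier E" and j: "j < n" for e j
  proof -
    have "act (ys[j := p e]) ((map r ?Y)[j := r e]) =
        sgn_smult K V (n - Suc j) (\<rho> (omit_nth j (ys[j := p e])) ((map r ?Y)[j := r e] ! j))"
      by (rule act_single) (use e j ys leny r_Y in \<open>auto intro: tuples_update\<close>)
    then show ?thesis
      using r_bracket[OF tuples_update[OF map_\<sigma>[OF ys] e, of j]] pY j leny by (simp add: map_update)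
  qed
  have yj: "ys ! j \<in> carrier G" if "j < n" for j using tuples_nth[OF ys that] .
  have rY: "r (nbracket E ?Y) = \<omega> ys" and pbY: "p (nbracket E ?Y) = nbracket G ys"
    using ys pY p_bracket[of ?Y] by (simp_all add: \<omega>_def)
  have inner: "r (nbracket E (?X @ [?Y ! j])) = \<omega> (xs @ [ys ! j])"
      "p (nbracket E (?X @ [?Y ! j])) = nbracket G (xs @ [ys ! j])" if j: "j < n" for j
    using last[of "?Y ! j"] yj[OF j] leny j xs snocG snocE p_bracket[OF snocE, of "?Y ! j"] pX
    by (auto simp: rho_zero)
  have "\<omega> (xs @ [nbracket G ys]) \<oplus>\<^bsub>V\<^esub> \<rho> xs (\<omega> ys) = r (nbracket E (?X @ [nbracket E ?Y]))"
    using last[of "nbracket E ?Y"] ys rY pbY by simp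
  also have "nbracket E (?X @ [nbracket E ?Y]) =
      (\<Oplus>\<^bsub>E\<^esub>j\<in>{..<n}. nbracket E (?Y[j := nbracket E (?X @ [?Y ! j])]))"
    using E_nlie map_\<sigma>[OF xs] map_\<sigma>[OF ys] by (simp add: n_Lie_algebra_def)
  also have "r \<dots> = (\<Oplus>\<^bsub>V\<^esub>j\<in>{..<n}. r (nbracket E (?Y[j := nbracket E (?X @ [?Y ! j])])))"
    using ys yj leny snocE by (intro r.finsum) (auto intro!: B.closed tuples_update)
  also have "\<dots> = (\<Oplus>\<^bsub>V\<^esub>j\<in>{..<n}. \<omega> (ys[j := nbracket G (xs @ [ys ! j])]) \<oplus>\<^bsub>V\<^esub>
      sgn_smult K V (n - Suc j) (\<rho> (omit_nth j ys) (\<omega> (xs @ [ys ! j]))))"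
  proof (rule V.finsum_cong'[OF refl])
    fix j assume "j \<in> {..<n}"
    then have j: "j < n" by simp
    show "r (nbracket E (?Y[j := nbracket E (?X @ [?Y ! j])])) = \<omega> (ys[j := nbracket G (xs @ [ys ! j])]) \<oplus>\<^bsub>V\<^esub>
      sgn_smult K V (n - Suc j) (\<rho> (omit_nth j ys) (\<omega> (xs @ [ys ! j])))"
      using slot[OF _ j, of "nbracket E (?X @ [?Y ! j])"] inner[OF j] snocE[of "?Y ! j"] yj[OF j] leny j
      by auto
  qed (auto intro!: act_term_closed ys tuples_update snocG yj bracket.closed)
  also have "\<dots> = (\<Oplus>\<^bsub>V\<^esub>j\<in>{..<n}. \<omega> (ys[j := nbracket G (xs @ [ys ! j])])) \<oplus>\<^bsub>V\<^esub>
      (\<Oplus>\<^bsub>V\<^esub>j\<in>{..<n}. sgn_smult K V (n - Suc j) (\<rho> (omit_nth j ys) (\<omega> (xs @ [ys ! j]))))"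
    by (intro V.finsum_addf) (auto intro!: act_term_closed ys tuples_update snocG yj bracket.closed)
  finally show "\<omega> (xs @ [nbracket G ys]) \<oplus>\<^bsub>V\<^esub> \<rho> xs (\<omega> ys) =
    (\<Oplus>\<^bsub>V\<^esub>i\<in>{..<n}. \<omega> (ys[i := nbracket G (xs @ [ys ! i])])) \<oplus>\<^bsub>V\<^esub>
    (\<Oplus>\<^bsub>V\<^esub>i\<in>{..<n}. sgn_smult K V (n - Suc i) (\<rho> (omit_nth i ys) (\<omega> (xs @ [ys ! i]))))" .
qed

lemma presents: "presents \<omega> (E, i, p) r"
  using r_linear r_bracket by (simp add: presents_def)

end

lemma (in abelian_extension) presentation_exists: "\<exists>\<omega>\<in>one_cocycles K n G V \<rho>. \<exists>r. presents \<omega> (E, i, p) r"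
proof -
  obtain \<sigma> where "linear_section K E G p \<sigma>" using section_exists by blast
  then interpret split_abelian_extension K G V n \<rho> E i p \<sigma> by unfold_locales
  show ?thesis using \<omega>_cocycle presents by blast
qed

section \<open>The twisted semidirect product bracket\<close>

context n_Lie_module
begin

lemma rho_zero_entry:
  assumes "xs \<in> tuples (n - 1) G" "l < n - 1" "xs ! l = \<zero>\<^bsub>G\<^esub>" "v \<in> carrier V"
  shows "\<rho> xs v = \<zero>\<^bsub>V\<^esub>"
  using alternating.update_zero[OF rho_alternating[OF assms(4)] assms(1-3)] .

lemma act_zero_entry:
  assumes "xs \<in> tuples n G" "vs \<in> tuples n V" "j < n" "xs ! j = \<zero>\<^bsub>G\<^esub>"
  shows "act xs vs = sgn_smult K V (n - Suc j) (\<rho> (omit_nth j xs) (vs ! j))"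
  unfolding act_def
proof (rule V.finsum_single)
  fix l assume l: "l \<in> {..<n}" "l \<noteq> j"
  have "omit_nth l xs ! (if j < l then j else j - 1) = xs ! j"
    using l assms by (subst nth_omit_nth) (auto simp: length_tuples)
  then have "\<rho> (omit_nth l xs) (vs ! l) = \<zero>\<^bsub>V\<^esub>"
    using l assms by (intro rho_zero_entry[of _ "if j < l then j else j - 1"]) (auto intro: tuples_nth)
  then show "sgn_smult K V (n - Suc l) (\<rho> (omit_nth l xs) (vs ! l)) = \<zero>\<^bsub>V\<^esub>" by simp
qed (use assms in \<open>auto intro!: act_term_closed tuples_nth\<close>)

lemma act_linear:
  assumes "module K M" "xs \<in> tuples n G" "vs \<in> tuples n V" "l < n"
    and f: "linear_map K M G f" and g: "linear_map K M V g"
  shows "linear_map K M V (\<lambda>e. act (xs[l := f e]) (vs[l := g e]))"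
proof -
  interpret M: module K M by fact
  have len: "length xs = n" "length vs = n" using assms by (auto simp: length_tuples)
  have term_linear: "linear_map K M V (\<lambda>e. sgn_smult K V (n - Suc k) (\<rho> (omit_nth k (xs[l := f e])) (vs[l := g e] ! k)))"
    if k: "k < n" for k
  proof (rule linear_map_comp[OF _ V.linear_map_sgn_smult])
    show "linear_map K M V (\<lambda>e. \<rho> (omit_nth k (xs[l := f e])) (vs[l := g e] ! k))"
    proof (cases "k = l")
      case True
      then show ?thesis using linear_map_comp[OF g rho_linear[OF omit_tuple[OF assms(2) k]]] k len by simp
    next
      case False
      let ?l = "if l < k then l else l - 1"
      have "linear_map K M V (\<lambda>e. \<rho> ((omit_nth k xs)[?l := f e]) (vs ! k))"
        using k False assms
        by (intro linear_map_comp[OF f alternating.linear[OF rho_alternating]]) (auto intro: tuples_nth)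
      moreover have "omit_nth k (xs[l := f e]) = (omit_nth k xs)[?l := f e]" for e
        using k False assms len by (intro omit_nth_update) auto
      ultimately show ?thesis using False by simp
    qed
  qed
  show ?thesis unfolding act_def
    by (rule linear_map_finsum[OF assms(1) V.module_axioms]) (use term_linear in auto)
qed

text \<open>
  Only the terms that omit position \<open>a\<close> or position \<open>b\<close> avoid a repeated argument of \<open>\<rho>\<close>.  They carry the same vector and,
  after the remaining copy of \<open>x\<close> is moved to the end, the same arguments; the two total exponents of \<open>-1\<close>,
  from the transpositions and from the signs in the sum, differ by exactly one.
\<close>

lemma act_equal_entries:
  assumes xs: "xs \<in> tuples n G" and vs: "vs \<in> tuples n V" and ab: "a < b" "b < n"
    and eq: "xs ! a = xs ! b" "vs ! a = vs ! b"
  shows "act xs vs = \<zero>\<^bsub>V\<^esub>"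
proof -
  define x where "x = xs ! a"
  define v where "v = vs ! a"
  define pre where "pre = take a xs"
  define mid where "mid = take (b - Suc a) (drop (Suc a) xs)"
  define post where "post = drop (Suc b) xs"
  have len: "length xs = n" using xs by (simp add: length_tuples)
  have "drop (Suc a) xs = mid @ x # post"
    using id_take_nth_drop[of "b - Suc a" "drop (Suc a) xs"] ab len eq
    by (simp add: mid_def post_def x_def)
  then have dec: "xs = pre @ x # mid @ x # post"
    using id_take_nth_drop[of a xs] ab len by (simp add: pre_def x_def)
  have lens: "length pre = a" "length mid = b - Suc a" "length post = n - Suc b"
    using ab len by (simp_all add: pre_def mid_def post_def)
  have v: "v \<in> carrier V" "v = vs ! b" unfolding v_def using tuples_nth[OF vs, of a] ab eq by auto
  interpret R: alternating K G V "n - 1" "\<lambda>zs. \<rho> zs v" by (rule rho_alternating[OF v(1)])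
  let ?t = "\<lambda>k. sgn_smult K V (n - Suc k) (\<rho> (omit_nth k xs) (vs ! k))"
  have t: "?t k \<in> carrier V" if "k < n" for k
    using that xs vs by (intro act_term_closed tuples_nth[OF vs])
  have other: "?t k = \<zero>\<^bsub>V\<^esub>" if k: "k < n" "k \<noteq> a" "k \<noteq> b" for k
  proof -
    have "\<rho> (omit_nth k xs) (vs ! k) = \<zero>\<^bsub>V\<^esub>"
      by (rule alternating.eq_zero[OF rho_alternating[OF tuples_nth[OF vs k(1)]] omit_tuple[OF xs k(1)],
            of "if a < k then a else a - 1" "if b < k then b else b - 1"])
        (use k ab len eq in \<open>auto simp: nth_omit_nth\<close>)
    then show ?thesis by simp
  qed
  have omit: "omit_nth a xs = (pre @ mid) @ x # post" "omit_nth b xs = pre @ x # (mid @ post)"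
  proof -
    have "b = Suc (length pre + length mid)" "a = length pre" using lens ab by simp_all
    then show "omit_nth a xs = (pre @ mid) @ x # post" "omit_nth b xs = pre @ x # (mid @ post)"
      by (simp_all add: omit_nth_def dec)
  qed
  have tup: "(pre @ mid) @ x # post \<in> tuples (n - 1) G" "pre @ x # (mid @ post) \<in> tuples (n - 1) G"
    using omit omit_tuple[OF xs] ab by (metis less_trans)+
  let ?w = "\<rho> (pre @ mid @ post @ [x]) v"
  have w: "?w \<in> carrier V" using tup by (intro R.closed) (auto simp: tuples_def)
  have "act xs vs = ?t a \<oplus>\<^bsub>V\<^esub> (\<Oplus>\<^bsub>V\<^esub>k\<in>{..<n - 1}. ?t (if k < a then k else Suc k))"
    unfolding act_def using t ab by (intro V.finsum_split_off) auto
  also have "(\<Oplus>\<^bsub>V\<^esub>k\<in>{..<n - 1}. ?t (if k < a then k else Suc k)) =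
      ?t (if b - 1 < a then b - 1 else Suc (b - 1))"
  proof (rule V.finsum_single)
    fix k assume k: "k \<in> {..<n - 1}" "k \<noteq> b - 1"
    show "?t (if k < a then k else Suc k) = \<zero>\<^bsub>V\<^esub>"
      by (rule other) (use k ab in auto)
  next
    show "?t (if b - 1 < a then b - 1 else Suc (b - 1)) \<in> carrier V" by (rule t) (use ab in auto)
  qed (use ab in auto)
  also have "\<dots> = ?t b" using ab by auto
  also have "?t b = sgn_smult K V (length post) (sgn_smult K V (length (mid @ post)) ?w)"
    unfolding omit v(2)[symmetric] R.move_to_end[OF tup(2)] lens(3) by simp
  also have "\<dots> = sgn_smult K V (length post + (length mid + length post)) ?w"
    using w by (simp add: V.sgn_smult_add)
  also have "?t a = sgn_smult K V (Suc (length mid + length post)) (sgn_smult K V (length post) ?w)"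
  proof -
    have "n - Suc a = Suc (length mid + length post)" using ab lens by simp
    then show ?thesis unfolding omit v_def[symmetric] R.move_to_end[OF tup(1)] by simp
  qed
  also have "\<dots> = sgn_smult K V (Suc (length post + (length mid + length post))) ?w"
    using w V.sgn_smult_add[OF w, of "Suc (length mid + length post)" "length post"] by (simp add: ac_simps)
  also have "\<dots> \<oplus>\<^bsub>V\<^esub> sgn_smult K V (length post + (length mid + length post)) ?w = \<zero>\<^bsub>V\<^esub>"
    using w by (simp add: V.sgn_smult_Suc V.M.l_neg)
  finally show ?thesis .
qed

end

locale n_Lie_cocycle = n_Lie_module K G V n \<rho>
  for K :: "('k, 'r) ring_scheme" and G :: "('k, 'g) nlie" and V :: "('k, 'v) module" and n \<rho> +
  fixes \<omega>
  assumes cocycle: "\<omega> \<in> one_cocycles K n G V \<rho>"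
begin

sublocale \<omega>: alternating K G V n \<omega>
  using cocycle by unfold_locales (simp add: one_cocycles_def)

definition twisted :: "'g list \<Rightarrow> 'v list \<Rightarrow> 'v" where
  "twisted xs vs = \<omega> xs \<oplus>\<^bsub>V\<^esub> act xs vs"

lemma twisted_closed [simp, intro]:
  "xs \<in> tuples n G \<Longrightarrow> vs \<in> tuples n V \<Longrightarrow> twisted xs vs \<in> carrier V"
  unfolding twisted_def by (intro V.M.add.m_closed \<omega>.closed act_closed)

text \<open>
  Both sides are affine in the vectors \<open>us\<close> and \<open>vs\<close>, and the identity splits accordingly.  The terms
  containing \<open>us\<close> match by the second axiom of a representation, those containing \<open>vs\<close> by the first, and the
  constant terms by the cocycle identity.
\<close>

lemma twisted_fundamental_identity:
  assumes xs: "xs \<in> tuples (n - 1) G" and us: "us \<in> tuples (n - 1) V"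
    and ys: "ys \<in> tuples n G" and vs: "vs \<in> tuples n V"
  shows "twisted (xs @ [nbracket G ys]) (us @ [twisted ys vs]) =
    (\<Oplus>\<^bsub>V\<^esub>j\<in>{..<n}. twisted (ys[j := nbracket G (xs @ [ys ! j])])
                          (vs[j := twisted (xs @ [ys ! j]) (us @ [vs ! j])]))"
proof -
  have n1: "Suc (n - 1) = n" using n2 by simp
  have lens: "length xs = n - 1" "length us = n - 1" "length ys = n" "length vs = n"
    using assms by (auto simp: length_tuples)
  have snoc: "xs @ [z] \<in> tuples n G" if "z \<in> carrier G" for z
    using tuples_snoc[OF xs that] n1 by simp
  have snocV: "us @ [z] \<in> tuples n V" if "z \<in> carrier V" for z
    using tuples_snoc[OF us that] n1 by simp
  have yj: "ys ! j \<in> carrier G" and vj: "vs ! j \<in> carrier V" if "j < n" for j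
    using tuples_nth ys vs that by metis+
  have uk: "us ! k \<in> carrier V" if "k < n - 1" for k using tuples_nth us that by metis
  define z where "z j = nbracket G (xs @ [ys ! j])" for j
  have zj: "z j \<in> carrier G" if "j < n" for j
    unfolding z_def using that by (intro bracket.closed snoc yj)
  have yz: "ys[j := z j] \<in> tuples n G" if "j < n" for j
    using that by (intro tuples_update ys zj)
  let ?y = "nbracket G ys"
  have y: "?y \<in> carrier G" using ys by (rule bracket.closed)
  have omit_snoc: "omit_nth k xs @ [a] \<in> tuples (n - 1) G" if "k < n - 1" "a \<in> carrier G" for k a
    using omit_tuple[OF snoc[OF that(2)], of k] that lens by (simp add: omit_nth_snoc)
  let ?s = "\<lambda>k. sgn_smult K V (n - Suc k)"
  note s_add = linear_map_add[OF V.linear_map_sgn_smult]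
  have s_sum: "?s k (\<Oplus>\<^bsub>V\<^esub>i\<in>A. g i) = (\<Oplus>\<^bsub>V\<^esub>i\<in>A. ?s k (g i))"
    if "finite A" "\<And>i. i \<in> A \<Longrightarrow> g i \<in> carrier V" for k g and A :: "nat set"
  proof -
    interpret linear_map_between K V V "?s k" by unfold_locales (rule V.linear_map_sgn_smult)
    show ?thesis using that by (rule finsum)
  qed
  have rho_sum: "\<rho> zs (\<Oplus>\<^bsub>V\<^esub>i\<in>A. g i) = (\<Oplus>\<^bsub>V\<^esub>i\<in>A. \<rho> zs (g i))"
    if "zs \<in> tuples (n - 1) G" "finite A" "\<And>i. i \<in> A \<Longrightarrow> g i \<in> carrier V" for zs g and A :: "nat set"
    using linear_map_between.finsum[OF rho_linear_map_between[OF that(1)] that(2,3)] .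
  have s_rho: "\<rho> zs (?s k w) = ?s k (\<rho> zs w)"
    if "zs \<in> tuples (n - 1) G" "w \<in> carrier V" for zs k w
    using linear_map_between.sgn[OF rho_linear_map_between[OF that(1)] that(2)] .
  have s_comm: "?s k (?s j w) = ?s j (?s k w)" if "w \<in> carrier V" for k j w
    using that by (simp add: V.sgn_smult_add[symmetric] add.commute)
  have rho_add: "\<rho> zs (a \<oplus>\<^bsub>V\<^esub> b) = \<rho> zs a \<oplus>\<^bsub>V\<^esub> \<rho> zs b"
    if "zs \<in> tuples (n - 1) G" "a \<in> carrier V" "b \<in> carrier V" for zs a b
    using linear_map_add[OF rho_linear[OF that(1)] that(2,3)] .
  note [intro] = V.finsum_closed V.sgn_smult_closed rho_closed

  \<comment> \<open>\<open>U\<close> collects the \<open>us\<close>-terms of an action sum.  In the \<open>j\<close>-th summand of the right-hand side, \<open>c j\<close>, \<open>e j\<close>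
    and \<open>d j\<close> come from the \<open>\<omega>\<close>-, \<open>us\<close>- and \<open>vs\<close>-parts of the inner bracket, and \<open>f j\<close> from the untouched entries of \<open>vs\<close>.\<close>
  define U where "U a = (\<Oplus>\<^bsub>V\<^esub>k\<in>{..<n - 1}. ?s k (\<rho> (omit_nth k xs @ [a]) (us ! k)))" for a
  define F where "F l j = ?s l (\<rho> (omit_nth l (ys[j := z j])) (vs ! l))" for l j
  define c where "c j = ?s j (\<rho> (omit_nth j ys) (\<omega> (xs @ [ys ! j])))" for j
  define d where "d j = ?s j (\<rho> (omit_nth j ys) (\<rho> xs (vs ! j)))" for j
  define e where "e j = ?s j (\<rho> (omit_nth j ys) (U (ys ! j)))" for j
  define f where "f j = (\<Oplus>\<^bsub>V\<^esub>i\<in>{..<n - 1}. F (if i < j then i else Suc i) j)" for j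
  have U: "U a \<in> carrier V" if "a \<in> carrier G" for a
    unfolding U_def by (intro V.finsum_closed Pi_I V.sgn_smult_closed rho_closed)
      (use that omit_snoc uk in auto)
  have F: "F l j \<in> carrier V" if "l < n" "j < n" for l j
    unfolding F_def using that by (intro act_term_closed yz vj)
  have cde: "c j \<in> carrier V" "d j \<in> carrier V" "e j \<in> carrier V" if "j < n" for j
    unfolding c_def d_def e_def using that
    by (intro act_term_closed \<omega>.closed snoc yj ys U rho_closed xs vj; assumption)+
  have f: "f j \<in> carrier V" if "j < n" for j
    unfolding f_def using that by (intro V.finsum_closed Pi_I F) auto
  have \<omega>z: "\<omega> (ys[j := z j]) \<in> carrier V" if "j < n" for j using that by (intro \<omega>.closed yz)

  \<comment> \<open>the terms in the entries of \<open>us\<close>: second axiom of a representation\<close>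
  have us_terms: "U ?y = (\<Oplus>\<^bsub>V\<^esub>j\<in>{..<n}. e j)"
  proof -
    let ?h = "\<lambda>k j. ?s k (?s j (\<rho> (omit_nth j ys) (\<rho> (omit_nth k xs @ [ys ! j]) (us ! k))))"
    have h0: "\<rho> (omit_nth j ys) (\<rho> (omit_nth k xs @ [ys ! j]) (us ! k)) \<in> carrier V"
      if "k < n - 1" "j < n" for k j
      using that by (intro rho_closed omit_tuple ys omit_snoc yj uk)
    have "U ?y = (\<Oplus>\<^bsub>V\<^esub>k\<in>{..<n - 1}. \<Oplus>\<^bsub>V\<^esub>j\<in>{..<n}. ?h k j)"
      unfolding U_def
    proof (rule V.finsum_cong'[OF refl])
      fix k assume "k \<in> {..<n - 1}"
      then have k: "k < n - 1" by simp
      have "omit_nth k xs \<in> tuples (n - 2) G"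
        using tuples_omit_nth[OF xs k] by (simp add: numeral_2_eq_2 One_nat_def)
      then have rep2: "\<rho> (omit_nth k xs @ [?y]) (us ! k) =
          (\<Oplus>\<^bsub>V\<^esub>j\<in>{..<n}. ?s j (\<rho> (omit_nth j ys) (\<rho> (omit_nth k xs @ [ys ! j]) (us ! k))))"
        using rep ys uk[OF k] unfolding n_Lie_representation_def by blast
      have "?s k (\<Oplus>\<^bsub>V\<^esub>j\<in>{..<n}. ?s j (\<rho> (omit_nth j ys) (\<rho> (omit_nth k xs @ [ys ! j]) (us ! k)))) = (\<Oplus>\<^bsub>V\<^esub>j\<in>{..<n}. ?h k j)"
        by (rule s_sum) (use h0 k in auto)
      with rep2 show "?s k (\<rho> (omit_nth k xs @ [?y]) (us ! k)) = (\<Oplus>\<^bsub>V\<^esub>j\<in>{..<n}. ?h k j)" by simp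
    qed (use h0 in auto)
    also have "\<dots> = (\<Oplus>\<^bsub>V\<^esub>j\<in>{..<n}. \<Oplus>\<^bsub>V\<^esub>k\<in>{..<n - 1}. ?h k j)"
      by (rule V.finsum_swap) (use h0 in auto)
    also have "\<dots> = (\<Oplus>\<^bsub>V\<^esub>j\<in>{..<n}. e j)"
    proof (rule V.finsum_cong'[OF refl])
      fix j assume "j \<in> {..<n}"
      then have j: "j < n" by simp
      have g: "\<rho> (omit_nth k xs @ [ys ! j]) (us ! k) \<in> carrier V" if "k < n - 1" for k
        using that j by (intro rho_closed omit_snoc yj uk)
      have "e j = (\<Oplus>\<^bsub>V\<^esub>k\<in>{..<n - 1}. ?s j (\<rho> (omit_nth j ys) (?s k (\<rho> (omit_nth k xs @ [ys ! j]) (us ! k)))))"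
      proof -
        let ?g = "\<lambda>k. ?s k (\<rho> (omit_nth k xs @ [ys ! j]) (us ! k))"
        have "\<rho> (omit_nth j ys) (\<Oplus>\<^bsub>V\<^esub>k\<in>{..<n - 1}. ?g k) = (\<Oplus>\<^bsub>V\<^esub>k\<in>{..<n - 1}. \<rho> (omit_nth j ys) (?g k))"
          by (rule rho_sum) (use g j ys in auto)
        moreover have "?s j (\<Oplus>\<^bsub>V\<^esub>k\<in>{..<n - 1}. \<rho> (omit_nth j ys) (?g k)) =
            (\<Oplus>\<^bsub>V\<^esub>k\<in>{..<n - 1}. ?s j (\<rho> (omit_nth j ys) (?g k)))"
          by (rule s_sum) (use g j ys in auto)
        ultimately show ?thesis by (simp add: e_def U_def)
      qed
      also have "\<dots> = (\<Oplus>\<^bsub>V\<^esub>k\<in>{..<n - 1}. ?h k j)"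
        using g j ys h0 by (intro V.finsum_cong' refl) (auto simp: s_rho s_comm)
      finally show "(\<Oplus>\<^bsub>V\<^esub>k\<in>{..<n - 1}. ?h k j) = e j" ..
    qed (use cde in auto)
    finally show ?thesis .
  qed

  \<comment> \<open>the terms in the entries of \<open>vs\<close>: first axiom of a representation\<close>
  have vs_terms: "\<rho> xs (act ys vs) = (\<Oplus>\<^bsub>V\<^esub>j\<in>{..<n}. d j) \<oplus>\<^bsub>V\<^esub> (\<Oplus>\<^bsub>V\<^esub>j\<in>{..<n}. f j)"
  proof -
    have "\<rho> xs (act ys vs) = (\<Oplus>\<^bsub>V\<^esub>l\<in>{..<n}. \<rho> xs (?s l (\<rho> (omit_nth l ys) (vs ! l))))"
      unfolding act_def using xs ys vj by (intro rho_sum) (auto intro!: act_term_closed)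
    also have "\<dots> = (\<Oplus>\<^bsub>V\<^esub>l\<in>{..<n}. d l \<oplus>\<^bsub>V\<^esub> (\<Oplus>\<^bsub>V\<^esub>i\<in>{..<n - 1}. F l (if i < l then i else Suc i)))"
    proof (rule V.finsum_cong'[OF refl])
      fix l assume "l \<in> {..<n}"
      then have l: "l < n" by simp
      let ?o = "omit_nth l ys"
      have o: "?o \<in> tuples (n - 1) G" using ys l by (rule omit_tuple)
      have oi: "?o[i := nbracket G (xs @ [?o ! i])] =
          omit_nth l (ys[(if i < l then i else Suc i) := z (if i < l then i else Suc i)])" if "i < n - 1" for i
        using that l lens omit_nth_update[of "if i < l then i else Suc i" ys l]
        by (auto simp: z_def nth_omit_nth)
      have oz: "\<rho> (?o[i := nbracket G (xs @ [?o ! i])]) (vs ! l) \<in> carrier V" if "i < n - 1" for i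
        unfolding oi[OF that] using that l by (intro rho_closed omit_tuple yz vj) auto
      have A: "\<rho> xs (\<rho> ?o (vs ! l)) \<in> carrier V" "\<rho> ?o (\<rho> xs (vs ! l)) \<in> carrier V"
        using xs o vj[OF l] by auto
      have "\<rho> xs (\<rho> ?o (vs ! l)) \<ominus>\<^bsub>V\<^esub> \<rho> ?o (\<rho> xs (vs ! l)) =
          (\<Oplus>\<^bsub>V\<^esub>i\<in>{..<n - 1}. \<rho> (?o[i := nbracket G (xs @ [?o ! i])]) (vs ! l))" (is "_ = ?S")
        using rep xs o vj[OF l] unfolding n_Lie_representation_def by blast
      moreover have S: "?S \<in> carrier V" using oz by (intro V.finsum_closed) auto
      ultimately have "\<rho> xs (\<rho> ?o (vs ! l)) = \<rho> ?o (\<rho> xs (vs ! l)) \<oplus>\<^bsub>V\<^esub> ?S"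
        using V.add_minus_cancel[OF A] by simp
      then have "?s l (\<rho> xs (\<rho> ?o (vs ! l))) = d l \<oplus>\<^bsub>V\<^esub> ?s l ?S"
        using A S by (simp add: s_add d_def)
      also have "?s l ?S = (\<Oplus>\<^bsub>V\<^esub>i\<in>{..<n - 1}. ?s l (\<rho> (?o[i := nbracket G (xs @ [?o ! i])]) (vs ! l)))"
        using oz by (intro s_sum) auto
      also have "\<dots> = (\<Oplus>\<^bsub>V\<^esub>i\<in>{..<n - 1}. F l (if i < l then i else Suc i))"
        by (rule V.finsum_cong'[OF refl]) (use l oi F in \<open>auto simp: F_def\<close>)
      finally show "\<rho> xs (?s l (\<rho> ?o (vs ! l))) = d l \<oplus>\<^bsub>V\<^esub> (\<Oplus>\<^bsub>V\<^esub>i\<in>{..<n - 1}. F l (if i < l then i else Suc i))"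
        using s_rho[OF xs] o vj[OF l] by (simp add: rho_closed)
    next
      show "(\<lambda>l. d l \<oplus>\<^bsub>V\<^esub> (\<Oplus>\<^bsub>V\<^esub>i\<in>{..<n - 1}. F l (if i < l then i else Suc i))) \<in> {..<n} \<rightarrow> carrier V"
        by (intro Pi_I V.M.add.m_closed V.finsum_closed cde F) auto
    qed
    also have "\<dots> = (\<Oplus>\<^bsub>V\<^esub>l\<in>{..<n}. d l) \<oplus>\<^bsub>V\<^esub> (\<Oplus>\<^bsub>V\<^esub>l\<in>{..<n}. \<Oplus>\<^bsub>V\<^esub>i\<in>{..<n - 1}. F l (if i < l then i else Suc i))"
      by (intro V.finsum_addf Pi_I V.finsum_closed cde F) auto
    \<comment> \<open>\<open>f\<close> fixes the bracketed entry \<open>j\<close> and sums over the omitted entries \<open>l\<close>; above it is \<open>l\<close> that is fixed\<close>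
    also have "(\<Oplus>\<^bsub>V\<^esub>l\<in>{..<n}. \<Oplus>\<^bsub>V\<^esub>i\<in>{..<n - 1}. F l (if i < l then i else Suc i)) = (\<Oplus>\<^bsub>V\<^esub>j\<in>{..<n}. f j)"
      unfolding f_def using F by (intro V.finsum_off_diagonal[symmetric])
    finally show ?thesis .
  qed

  \<comment> \<open>the remaining terms: the cocycle identity\<close>
  have \<omega>_terms: "\<omega> (xs @ [?y]) \<oplus>\<^bsub>V\<^esub> \<rho> xs (\<omega> ys) =
      (\<Oplus>\<^bsub>V\<^esub>j\<in>{..<n}. \<omega> (ys[j := z j])) \<oplus>\<^bsub>V\<^esub> (\<Oplus>\<^bsub>V\<^esub>j\<in>{..<n}. c j)"
    using cocycle xs ys unfolding one_cocycles_def c_def z_def by blast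

  have rhs: "twisted (ys[j := z j]) (vs[j := twisted (xs @ [ys ! j]) (us @ [vs ! j])]) =
      \<omega> (ys[j := z j]) \<oplus>\<^bsub>V\<^esub> (c j \<oplus>\<^bsub>V\<^esub> (e j \<oplus>\<^bsub>V\<^esub> d j) \<oplus>\<^bsub>V\<^esub> f j)" if j: "j < n" for j
  proof -
    let ?w = "twisted (xs @ [ys ! j]) (us @ [vs ! j])"
    have w: "?w \<in> carrier V" using j by (intro twisted_closed snoc snocV yj vj)
    have "?s j (\<rho> (omit_nth j ys) ?w) = c j \<oplus>\<^bsub>V\<^esub> (e j \<oplus>\<^bsub>V\<^esub> d j)"
    proof -
      have "?w = \<omega> (xs @ [ys ! j]) \<oplus>\<^bsub>V\<^esub> (U (ys ! j) \<oplus>\<^bsub>V\<^esub> \<rho> xs (vs ! j))"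
        unfolding twisted_def U_def using act_snoc[OF xs us yj vj] j by simp
      moreover have "\<omega> (xs @ [ys ! j]) \<in> carrier V" "U (ys ! j) \<in> carrier V" "\<rho> xs (vs ! j) \<in> carrier V"
        using j by (auto intro: U yj snoc xs vj)
      ultimately show ?thesis
        using omit_tuple[OF ys j] by (simp add: rho_add s_add rho_closed c_def d_def e_def)
    qed
    then have "act (ys[j := z j]) (vs[j := ?w]) = (c j \<oplus>\<^bsub>V\<^esub> (e j \<oplus>\<^bsub>V\<^esub> d j)) \<oplus>\<^bsub>V\<^esub> f j"
      unfolding act_update[OF yz[OF j] vs w j] f_def F_def Let_def by simp
    then show ?thesis by (simp add: twisted_def)
  qed
  have "twisted (xs @ [?y]) (us @ [twisted ys vs]) =
      \<omega> (xs @ [?y]) \<oplus>\<^bsub>V\<^esub> (U ?y \<oplus>\<^bsub>V\<^esub> \<rho> xs (\<omega> ys \<oplus>\<^bsub>V\<^esub> act ys vs))"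
    unfolding twisted_def[of "xs @ _"] U_def
    using act_snoc[OF xs us y twisted_closed[OF ys vs]] by (simp add: twisted_def)
  also have "\<dots> = (\<omega> (xs @ [?y]) \<oplus>\<^bsub>V\<^esub> \<rho> xs (\<omega> ys)) \<oplus>\<^bsub>V\<^esub> (U ?y \<oplus>\<^bsub>V\<^esub> \<rho> xs (act ys vs))"
    using U[OF y] xs ys vs snoc[OF y] by (simp add: rho_add rho_closed V.M.a_ac)
  also have "\<dots> = (\<Oplus>\<^bsub>V\<^esub>j\<in>{..<n}. \<omega> (ys[j := z j]) \<oplus>\<^bsub>V\<^esub> (c j \<oplus>\<^bsub>V\<^esub> (e j \<oplus>\<^bsub>V\<^esub> d j) \<oplus>\<^bsub>V\<^esub> f j))"
  proof -
    have "(\<Oplus>\<^bsub>V\<^esub>j\<in>{..<n}. \<omega> (ys[j := z j]) \<oplus>\<^bsub>V\<^esub> (c j \<oplus>\<^bsub>V\<^esub> (e j \<oplus>\<^bsub>V\<^esub> d j) \<oplus>\<^bsub>V\<^esub> f j)) =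
        (\<Oplus>\<^bsub>V\<^esub>j\<in>{..<n}. \<omega> (ys[j := z j])) \<oplus>\<^bsub>V\<^esub> ((\<Oplus>\<^bsub>V\<^esub>j\<in>{..<n}. c j) \<oplus>\<^bsub>V\<^esub>
          ((\<Oplus>\<^bsub>V\<^esub>j\<in>{..<n}. e j) \<oplus>\<^bsub>V\<^esub> (\<Oplus>\<^bsub>V\<^esub>j\<in>{..<n}. d j)) \<oplus>\<^bsub>V\<^esub> (\<Oplus>\<^bsub>V\<^esub>j\<in>{..<n}. f j))"
      using \<omega>z cde f by (simp add: V.M.finsum_addf Pi_def)
    moreover have "(\<Oplus>\<^bsub>V\<^esub>j\<in>{..<n}. \<omega> (ys[j := z j])) \<in> carrier V" "(\<Oplus>\<^bsub>V\<^esub>j\<in>{..<n}. c j) \<in> carrier V"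
      "(\<Oplus>\<^bsub>V\<^esub>j\<in>{..<n}. e j) \<in> carrier V" "(\<Oplus>\<^bsub>V\<^esub>j\<in>{..<n}. d j) \<in> carrier V" "(\<Oplus>\<^bsub>V\<^esub>j\<in>{..<n}. f j) \<in> carrier V"
      using \<omega>z cde f by (auto intro!: V.finsum_closed)
    ultimately show ?thesis unfolding us_terms vs_terms \<omega>_terms by (simp add: V.M.a_ac)
  qed
  also have "\<dots> = (\<Oplus>\<^bsub>V\<^esub>j\<in>{..<n}. twisted (ys[j := z j]) (vs[j := twisted (xs @ [ys ! j]) (us @ [vs ! j])]))"
    using rhs \<omega>z cde f
    by (intro V.finsum_cong'[OF refl]) (auto intro!: twisted_closed yz tuples_update vs snoc snocV yj vj)
  finally show ?thesis by (simp add: z_def)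
qed

end

section \<open>The extension defined by a cocycle\<close>

lemma n_Lie_algebra_abelian_nlie:
  assumes "field K" "module K V"
  shows "n_Lie_algebra K n (abelian_nlie V)"
proof -
  interpret V: module K V by fact
  have ops: "carrier (abelian_nlie V) = carrier V" "add (abelian_nlie V) = add V"
      "\<zero>\<^bsub>abelian_nlie V\<^esub> = \<zero>\<^bsub>V\<^esub>" "smult (abelian_nlie V) = smult V"
      "nbracket (abelian_nlie V) = (\<lambda>_. \<zero>\<^bsub>V\<^esub>)"
    by (simp_all add: abelian_nlie_def module.extend_def)
  have module: "module K (abelian_nlie V)"
  proof (rule moduleI)
    show "abelian_group (abelian_nlie V)"
      by (rule abelian_groupI) (auto simp: ops V.M.a_ac intro: V.M.l_neg)
  qed (auto simp: ops V.smult_l_distr V.smult_r_distr V.smult_assoc1 V.R.cring_axioms)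
  interpret A: module K "abelian_nlie V" by (rule module)
  have "alternating_map K n (abelian_nlie V) (abelian_nlie V) (nbracket (abelian_nlie V))"
    using linear_map_const_zero[OF module module] by (simp add: alternating_map_def ops)
  moreover have "\<zero>\<^bsub>V\<^esub> = (\<Oplus>\<^bsub>abelian_nlie V\<^esub>i\<in>A. \<zero>\<^bsub>V\<^esub>)" for A :: "nat set"
    using A.M.finsum_zero[of A] by (simp add: ops)
  ultimately show ?thesis
    using assms(1) module by (auto simp: n_Lie_algebra_def vector_space_over_def ops)
qed

text \<open>
  The elements of the constructed extension are the values of an injection \<open>h\<close> on \<open>G \<times> V\<close>, so that the
  extension can live in any type that is large enough.
\<close>

locale n_Lie_cocycle_copy = n_Lie_cocycle K G V n \<rho> \<omega>
  for K :: "('k, 'r) ring_scheme" and G :: "('k, 'g) nlie" and V :: "('k, 'v) module" and n \<rho> \<omega> +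
  fixes h :: "'g \<times> 'v \<Rightarrow> 'e"
  assumes h_inj: "inj_on h (carrier G \<times> carrier V)"
begin

definition base :: "'e \<Rightarrow> 'g" where "base e = fst (the_inv_into (carrier G \<times> carrier V) h e)"
definition fibre :: "'e \<Rightarrow> 'v" where "fibre e = snd (the_inv_into (carrier G \<times> carrier V) h e)"

definition E :: "('k, 'e) nlie" where
  "E = \<lparr>carrier = h ` (carrier G \<times> carrier V), monoid.mult = undefined, one = undefined,
        ring.zero = h (\<zero>\<^bsub>G\<^esub>, \<zero>\<^bsub>V\<^esub>),
        add = (\<lambda>a b. h (base a \<oplus>\<^bsub>G\<^esub> base b, fibre a \<oplus>\<^bsub>V\<^esub> fibre b)),
        smult = (\<lambda>c a. h (c \<odot>\<^bsub>G\<^esub> base a, c \<odot>\<^bsub>V\<^esub> fibre a)),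
        nbracket = (\<lambda>es. h (nbracket G (map base es), twisted (map base es) (map fibre es)))\<rparr>"

lemma base_h [simp]: "x \<in> carrier G \<Longrightarrow> v \<in> carrier V \<Longrightarrow> base (h (x, v)) = x"
  and fibre_h [simp]: "x \<in> carrier G \<Longrightarrow> v \<in> carrier V \<Longrightarrow> fibre (h (x, v)) = v"
  by (simp_all add: base_def fibre_def the_inv_into_f_f[OF h_inj])

lemma carrier_E: "carrier E = h ` (carrier G \<times> carrier V)" by (simp add: E_def)

lemma h_closed [simp, intro]: "x \<in> carrier G \<Longrightarrow> v \<in> carrier V \<Longrightarrow> h (x, v) \<in> carrier E"
  by (simp add: carrier_E)

lemma base_closed [simp]: "e \<in> carrier E \<Longrightarrow> base e \<in> carrier G"
  and fibre_closed [simp]: "e \<in> carrier E \<Longrightarrow> fibre e \<in> carrier V"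
  and h_base_fibre: "e \<in> carrier E \<Longrightarrow> h (base e, fibre e) = e"
  by (auto simp: carrier_E)

lemma E_eqI:
  assumes "e \<in> carrier E" "e' \<in> carrier E" "base e = base e'" "fibre e = fibre e'"
  shows "e = e'"
proof -
  have "e = h (base e, fibre e)" by (rule h_base_fibre[OF assms(1), symmetric])
  also have "\<dots> = h (base e', fibre e')" by (simp only: assms(3,4))
  also have "\<dots> = e'" by (rule h_base_fibre[OF assms(2)])
  finally show ?thesis .
qed

lemma map_base [simp, intro]: "es \<in> tuples k E \<Longrightarrow> map base es \<in> tuples k G"
  and map_fibre [simp, intro]: "es \<in> tuples k E \<Longrightarrow> map fibre es \<in> tuples k V"
  by (auto intro: tuples_map)

lemma E_ops:
  "\<zero>\<^bsub>E\<^esub> = h (\<zero>\<^bsub>G\<^esub>, \<zero>\<^bsub>V\<^esub>)"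
  "a \<oplus>\<^bsub>E\<^esub> b = h (base a \<oplus>\<^bsub>G\<^esub> base b, fibre a \<oplus>\<^bsub>V\<^esub> fibre b)"
  "c \<odot>\<^bsub>E\<^esub> a = h (c \<odot>\<^bsub>G\<^esub> base a, c \<odot>\<^bsub>V\<^esub> fibre a)"
  "nbracket E es = h (nbracket G (map base es), twisted (map base es) (map fibre es))"
  by (simp_all add: E_def)

lemma bracket_closed [simp, intro]: "es \<in> tuples n E \<Longrightarrow> nbracket E es \<in> carrier E"
  unfolding E_ops by (intro h_closed bracket.closed twisted_closed map_base map_fibre)

lemma base_bracket: "es \<in> tuples n E \<Longrightarrow> base (nbracket E es) = nbracket G (map base es)"
  and fibre_bracket: "es \<in> tuples n E \<Longrightarrow> fibre (nbracket E es) = twisted (map base es) (map fibre es)"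
  unfolding E_ops by (intro base_h fibre_h bracket.closed twisted_closed map_base map_fibre; assumption)+

lemma E_ops_closed [simp, intro]:
  "\<zero>\<^bsub>E\<^esub> \<in> carrier E"
  "a \<in> carrier E \<Longrightarrow> b \<in> carrier E \<Longrightarrow> a \<oplus>\<^bsub>E\<^esub> b \<in> carrier E"
  "c \<in> carrier K \<Longrightarrow> a \<in> carrier E \<Longrightarrow> c \<odot>\<^bsub>E\<^esub> a \<in> carrier E"
  by (simp_all add: E_ops)

lemma base_ops:
  "base \<zero>\<^bsub>E\<^esub> = \<zero>\<^bsub>G\<^esub>"
  "a \<in> carrier E \<Longrightarrow> b \<in> carrier E \<Longrightarrow> base (a \<oplus>\<^bsub>E\<^esub> b) = base a \<oplus>\<^bsub>G\<^esub> base b"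
  "c \<in> carrier K \<Longrightarrow> a \<in> carrier E \<Longrightarrow> base (c \<odot>\<^bsub>E\<^esub> a) = c \<odot>\<^bsub>G\<^esub> base a"
  by (simp_all add: E_ops)

lemma fibre_ops:
  "fibre \<zero>\<^bsub>E\<^esub> = \<zero>\<^bsub>V\<^esub>"
  "a \<in> carrier E \<Longrightarrow> b \<in> carrier E \<Longrightarrow> fibre (a \<oplus>\<^bsub>E\<^esub> b) = fibre a \<oplus>\<^bsub>V\<^esub> fibre b"
  "c \<in> carrier K \<Longrightarrow> a \<in> carrier E \<Longrightarrow> fibre (c \<odot>\<^bsub>E\<^esub> a) = c \<odot>\<^bsub>V\<^esub> fibre a"
  by (simp_all add: E_ops)

lemma abelian_group_E: "abelian_group E"
proof (rule abelian_groupI)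
  fix x y z assume x: "x \<in> carrier E" "y \<in> carrier E" "z \<in> carrier E"
  show "x \<oplus>\<^bsub>E\<^esub> y \<oplus>\<^bsub>E\<^esub> z = x \<oplus>\<^bsub>E\<^esub> (y \<oplus>\<^bsub>E\<^esub> z)"
    by (rule E_eqI) (simp_all add: x base_ops fibre_ops G.M.a_assoc V.M.a_assoc)
next
  fix x y assume x: "x \<in> carrier E" "y \<in> carrier E"
  show "x \<oplus>\<^bsub>E\<^esub> y = y \<oplus>\<^bsub>E\<^esub> x"
    by (rule E_eqI) (simp_all add: x base_ops fibre_ops G.M.a_comm V.M.a_comm)
next
  fix x assume x: "x \<in> carrier E"
  show "\<zero>\<^bsub>E\<^esub> \<oplus>\<^bsub>E\<^esub> x = x"
    by (rule E_eqI) (simp_all add: x base_ops fibre_ops)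
  show "\<exists>y\<in>carrier E. y \<oplus>\<^bsub>E\<^esub> x = \<zero>\<^bsub>E\<^esub>"
  proof (rule bexI)
    show "h (\<ominus>\<^bsub>G\<^esub> base x, \<ominus>\<^bsub>V\<^esub> fibre x) \<in> carrier E" using x by simp
    show "h (\<ominus>\<^bsub>G\<^esub> base x, \<ominus>\<^bsub>V\<^esub> fibre x) \<oplus>\<^bsub>E\<^esub> x = \<zero>\<^bsub>E\<^esub>"
      using x by (simp add: E_ops G.M.l_neg V.M.l_neg)
  qed
qed simp_all

lemma module_E: "module K E"
proof (rule moduleI)
  fix a b x assume x: "a \<in> carrier K" "b \<in> carrier K" "x \<in> carrier E"
  show "(a \<oplus>\<^bsub>K\<^esub> b) \<odot>\<^bsub>E\<^esub> x = a \<odot>\<^bsub>E\<^esub> x \<oplus>\<^bsub>E\<^esub> b \<odot>\<^bsub>E\<^esub> x"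
    by (rule E_eqI) (simp_all add: x base_ops fibre_ops G.smult_l_distr V.smult_l_distr)
  show "(a \<otimes>\<^bsub>K\<^esub> b) \<odot>\<^bsub>E\<^esub> x = a \<odot>\<^bsub>E\<^esub> (b \<odot>\<^bsub>E\<^esub> x)"
    by (rule E_eqI) (simp_all add: x base_ops fibre_ops G.smult_assoc1 V.smult_assoc1)
next
  fix a x y assume x: "a \<in> carrier K" "x \<in> carrier E" "y \<in> carrier E"
  show "a \<odot>\<^bsub>E\<^esub> (x \<oplus>\<^bsub>E\<^esub> y) = a \<odot>\<^bsub>E\<^esub> x \<oplus>\<^bsub>E\<^esub> a \<odot>\<^bsub>E\<^esub> y"
    by (rule E_eqI) (simp_all add: x base_ops fibre_ops G.smult_r_distr V.smult_r_distr)
next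
  fix x assume x: "x \<in> carrier E"
  show "\<one>\<^bsub>K\<^esub> \<odot>\<^bsub>E\<^esub> x = x"
    by (rule E_eqI) (simp_all add: x base_ops fibre_ops)
qed (simp_all add: abelian_group_E G.R.cring_axioms)

sublocale E: module K E by (rule module_E)

lemma base_linear: "linear_map K E G base"
  by (simp add: linear_map_def base_ops)

lemma fibre_linear: "linear_map K E V fibre"
  by (simp add: linear_map_def fibre_ops)

sublocale base: linear_map_between K E G base
  by unfold_locales (rule base_linear)

sublocale fibre: linear_map_between K E V fibre
  by unfold_locales (rule fibre_linear)

text \<open>Since \<open>(base, fibre)\<close> are linear coordinates, linearity is tested on them.\<close>

lemma linear_map_into_E:
  assumes "module K M" "f \<in> carrier M \<rightarrow> carrier E"
    and b: "linear_map K M G (\<lambda>x. base (f x))" and v: "linear_map K M V (\<lambda>x. fibre (f x))"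
  shows "linear_map K M E f"
proof -
  interpret M: module K M by fact
  have [simp]: "f x \<in> carrier E" if "x \<in> carrier M" for x using assms(2) that by blast
  show ?thesis
    unfolding linear_map_def
  proof (intro conjI ballI)
    fix x y assume "x \<in> carrier M" "y \<in> carrier M"
    then show "f (x \<oplus>\<^bsub>M\<^esub> y) = f x \<oplus>\<^bsub>E\<^esub> f y"
      by (intro E_eqI) (simp_all add: linear_map_add[OF b] linear_map_add[OF v] base.add fibre.add)
  next
    fix a x assume "a \<in> carrier K" "x \<in> carrier M"
    then show "f (a \<odot>\<^bsub>M\<^esub> x) = a \<odot>\<^bsub>E\<^esub> f x"
      by (intro E_eqI) (simp_all add: linear_map_smult[OF b] linear_map_smult[OF v] base.smult fibre.smult)
  qed (use assms(2) in blast)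
qed

lemma twisted_equal_entries:
  assumes "xs \<in> tuples n G" "vs \<in> tuples n V" "a < n" "b < n" "a \<noteq> b"
    and "xs ! a = xs ! b" "vs ! a = vs ! b"
  shows "twisted xs vs = \<zero>\<^bsub>V\<^esub>"
proof -
  have "act xs vs = \<zero>\<^bsub>V\<^esub>"
    using act_equal_entries[of xs vs a b] act_equal_entries[of xs vs b a] assms by (cases "a < b") auto
  moreover have "\<omega> xs = \<zero>\<^bsub>V\<^esub>" using \<omega>.eq_zero[OF assms(1,3,4,5,6)] .
  ultimately show ?thesis by (simp add: twisted_def)
qed

lemma alternating_E: "alternating_map K n E E (nbracket E)"
  unfolding alternating_map_def
proof (intro conjI ballI allI impI)
  show "nbracket E \<in> tuples n E \<rightarrow> carrier E" by auto
next
  fix es l assume es: "es \<in> tuples n E" and l: "l < n"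
  note es' = map_base[OF es] map_fibre[OF es]
  have up: "es[l := e] \<in> tuples n E" if "e \<in> carrier E" for e using es that by (rule tuples_update)
  show "linear_map K E E (\<lambda>e. nbracket E (es[l := e]))"
  proof (rule linear_map_into_E[OF module_E])
    show "linear_map K E G (\<lambda>e. base (nbracket E (es[l := e])))"
      by (rule linear_map_cong[OF linear_map_comp[OF base_linear bracket.linear[OF es'(1) l]]])
        (auto simp: base_bracket up map_update E.abelian_monoid_axioms module_E E.M.abelian_monoid_axioms)
    have "linear_map K E V (\<lambda>e. \<omega> ((map base es)[l := base e]) \<oplus>\<^bsub>V\<^esub>
        act ((map base es)[l := base e]) ((map fibre es)[l := fibre e]))"
      by (intro linear_map_pointwise_add[OF module_E V.module_axioms]
          linear_map_comp[OF base_linear \<omega>.linear[OF es'(1) l]]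
          act_linear[OF module_E es' l base_linear fibre_linear])
    then show "linear_map K E V (\<lambda>e. fibre (nbracket E (es[l := e])))"
      by (rule linear_map_cong)
        (auto simp: fibre_bracket up map_update twisted_def module_E E.M.abelian_monoid_axioms)
  qed (use up in auto)
next
  fix es a b assume es: "es \<in> tuples n E" and ab: "a < n" "b < n" "a \<noteq> b \<and> es ! a = es ! b"
  have len: "length es = n" using es by (simp add: length_tuples)
  have "nbracket G (map base es) = \<zero>\<^bsub>G\<^esub>"
    using ab len by (intro bracket.eq_zero[OF map_base[OF es], of a b]) auto
  moreover have "twisted (map base es) (map fibre es) = \<zero>\<^bsub>V\<^esub>"
    using ab len by (intro twisted_equal_entries[OF map_base[OF es] map_fibre[OF es], of a b]) auto
  ultimately show "nbracket E es = \<zero>\<^bsub>E\<^esub>" by (simp add: E_ops)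
qed

lemma n_Lie_algebra_E: "n_Lie_algebra K n E"
  unfolding n_Lie_algebra_def
proof (intro conjI ballI)
  show "vector_space_over K E" using field module_E by (simp add: vector_space_over_def)
  show "alternating_map K n E E (nbracket E)" by (rule alternating_E)
  fix xs ys assume xs: "xs \<in> tuples (n - 1) E" and ys: "ys \<in> tuples n E"
  have snoc: "xs @ [z] \<in> tuples n E" if "z \<in> carrier E" for z
    using tuples_snoc[OF xs that] n2 by simp
  have yj: "ys ! j \<in> carrier E" if "j < n" for j using tuples_nth[OF ys that] .
  have len: "length ys = n" using ys by (simp add: length_tuples)
  let ?t = "\<lambda>j. ys[j := nbracket E (xs @ [ys ! j])]"
  have t: "?t j \<in> tuples n E" if "j < n" for j
    using that by (intro tuples_update ys bracket_closed snoc yj)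
  have sum: "(\<Oplus>\<^bsub>E\<^esub>j\<in>{..<n}. nbracket E (?t j)) \<in> carrier E"
    using t by (intro E.M.finsum_closed) auto
  show "nbracket E (xs @ [nbracket E ys]) = (\<Oplus>\<^bsub>E\<^esub>j\<in>{..<n}. nbracket E (?t j))"
  proof (rule E_eqI[OF bracket_closed[OF snoc[OF bracket_closed[OF ys]]] sum])
    have "base (nbracket E (xs @ [nbracket E ys])) = nbracket G (map base xs @ [nbracket G (map base ys)])"
      using snoc[OF bracket_closed[OF ys]] ys by (simp add: base_bracket)
    also have "\<dots> = (\<Oplus>\<^bsub>G\<^esub>j\<in>{..<n}. nbracket G ((map base ys)[j := nbracket G (map base xs @ [map base ys ! j])]))"
      using G xs ys unfolding n_Lie_algebra_def by blast
    also have "\<dots> = (\<Oplus>\<^bsub>G\<^esub>j\<in>{..<n}. base (nbracket E (?t j)))"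
    proof (rule G.M.finsum_cong'[OF refl])
      show "(\<lambda>j. base (nbracket E (?t j))) \<in> {..<n} \<rightarrow> carrier G" using t by auto
    qed (use t yj snoc len in \<open>auto simp: base_bracket map_update\<close>)
    also have "\<dots> = base (\<Oplus>\<^bsub>E\<^esub>j\<in>{..<n}. nbracket E (?t j))"
      using t by (intro base.finsum[symmetric]) auto
    finally show "base (nbracket E (xs @ [nbracket E ys])) = base (\<Oplus>\<^bsub>E\<^esub>j\<in>{..<n}. nbracket E (?t j))" .
  next
    have "fibre (nbracket E (xs @ [nbracket E ys])) =
        twisted (map base xs @ [nbracket G (map base ys)]) (map fibre xs @ [twisted (map base ys) (map fibre ys)])"
      using snoc[OF bracket_closed[OF ys]] ys by (simp add: base_bracket fibre_bracket)
    also have "\<dots> = (\<Oplus>\<^bsub>V\<^esub>j\<in>{..<n}. twisted ((map base ys)[j := nbracket G (map base xs @ [map base ys ! j])])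
        ((map fibre ys)[j := twisted (map base xs @ [map base ys ! j]) (map fibre xs @ [map fibre ys ! j])]))"
      using xs ys by (intro twisted_fundamental_identity) auto
    also have "\<dots> = (\<Oplus>\<^bsub>V\<^esub>j\<in>{..<n}. fibre (nbracket E (?t j)))"
    proof (rule V.M.finsum_cong'[OF refl])
      show "(\<lambda>j. fibre (nbracket E (?t j))) \<in> {..<n} \<rightarrow> carrier V" using t by auto
    qed (use t yj snoc len in \<open>auto simp: base_bracket fibre_bracket map_update\<close>)
    also have "\<dots> = fibre (\<Oplus>\<^bsub>E\<^esub>j\<in>{..<n}. nbracket E (?t j))"
      using t by (intro fibre.finsum[symmetric]) auto
    finally show "fibre (nbracket E (xs @ [nbracket E ys])) = fibre (\<Oplus>\<^bsub>E\<^esub>j\<in>{..<n}. nbracket E (?t j))" .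
  qed
qed

definition incl :: "'v \<Rightarrow> 'e" where "incl v = h (\<zero>\<^bsub>G\<^esub>, v)"

lemma base_incl [simp]: "v \<in> carrier V \<Longrightarrow> base (incl v) = \<zero>\<^bsub>G\<^esub>"
  and fibre_incl [simp]: "v \<in> carrier V \<Longrightarrow> fibre (incl v) = v"
  and incl_closed [simp, intro]: "v \<in> carrier V \<Longrightarrow> incl v \<in> carrier E"
  by (simp_all add: incl_def)

lemma incl_image: "incl ` carrier V = {e \<in> carrier E. base e = \<zero>\<^bsub>G\<^esub>}"
proof (intro equalityI subsetI)
  fix e assume "e \<in> {e \<in> carrier E. base e = \<zero>\<^bsub>G\<^esub>}"
  then have "e = incl (fibre e)" "fibre e \<in> carrier V" by (auto intro!: E_eqI)
  then show "e \<in> incl ` carrier V" by blast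
qed auto

lemma twisted_zero_entry:
  assumes "xs \<in> tuples n G" "vs \<in> tuples n V" "j < n" "xs ! j = \<zero>\<^bsub>G\<^esub>"
  shows "twisted xs vs = sgn_smult K V (n - Suc j) (\<rho> (omit_nth j xs) (vs ! j))"
  using act_zero_entry[OF assms] \<omega>.update_zero[OF assms(1,3,4)] tuples_nth[OF assms(2,3)] omit_tuple[OF assms(1,3)]
  by (simp add: twisted_def rho_closed)

lemma bracket_two_base_zero:
  assumes es: "es \<in> tuples n E" and ab: "a < n" "b < n" "a \<noteq> b"
    and zero: "base (es ! a) = \<zero>\<^bsub>G\<^esub>" "base (es ! b) = \<zero>\<^bsub>G\<^esub>"
  shows "nbracket E es = \<zero>\<^bsub>E\<^esub>"
proof -
  have len: "length es = n" using es by (simp add: length_tuples)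
  note es' = map_base[OF es] map_fibre[OF es]
  have v: "map fibre es ! a \<in> carrier V" using tuples_nth[OF es'(2) ab(1)] .
  have "\<rho> (omit_nth a (map base es)) (map fibre es ! a) = \<zero>\<^bsub>V\<^esub>"
    by (rule rho_zero_entry[OF omit_tuple[OF es'(1) ab(1)] _ _ v, of "if b < a then b else b - 1"])
      (use ab zero len in \<open>auto simp: nth_omit_nth\<close>)
  then have "twisted (map base es) (map fibre es) = \<zero>\<^bsub>V\<^esub>"
    using twisted_zero_entry[OF es' ab(1)] ab len zero by simp
  moreover have "nbracket G (map base es) = \<zero>\<^bsub>G\<^esub>"
    using bracket.update_zero[OF es'(1) ab(1)] ab len zero by simp
  ultimately show ?thesis by (simp add: E_ops)
qed

lemma abelian_ideal_incl: "abelian_ideal K n E (incl ` carrier V)"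
  unfolding abelian_ideal_def
proof (intro conjI ballI allI impI)
  show "submodule (incl ` carrier V) K E"
    unfolding incl_image by (rule E.submoduleI) (auto simp: base.neg base.add base.smult)
next
  fix es l assume es: "es \<in> tuples n E" and l: "l < n" "es ! l \<in> incl ` carrier V"
  then have "nbracket G (map base es) = \<zero>\<^bsub>G\<^esub>"
    by (intro bracket.update_zero[OF map_base l(1)]) (auto simp: length_tuples)
  then show "nbracket E es \<in> incl ` carrier V"
    unfolding incl_image using es by (simp add: base_bracket)
next
  fix es l j assume "es \<in> tuples n E" "l < n" "j < n" "l \<noteq> j \<and> es ! l \<in> incl ` carrier V \<and> es ! j \<in> incl ` carrier V"
  then show "nbracket E es = \<zero>\<^bsub>E\<^esub>" by (intro bracket_two_base_zero[of es l j]) auto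
qed

lemma extension_E: "n_Lie_extension K n G (abelian_nlie V) (E, incl, base)"
  unfolding n_Lie_extension_def prod.case carrier_abelian_nlie
proof (intro conjI)
  show "n_Lie_algebra K n (abelian_nlie V)" by (rule n_Lie_algebra_abelian_nlie[OF field V.module_axioms])
  have "linear_map K V E incl"
    by (rule linear_map_into_E[OF V.module_axioms]) (auto simp: linear_map_def)
  moreover have "incl (nbracket (abelian_nlie V) vs) = nbracket E (map incl vs)"
    if "vs \<in> tuples n (abelian_nlie V)" for vs
  proof -
    have vs: "vs \<in> tuples n V" using that by (simp add: tuples_def)
    have es: "map incl vs \<in> tuples n E" using vs by (rule tuples_map) simp
    have base0: "base (map incl vs ! j) = \<zero>\<^bsub>G\<^esub>" if "j < n" for j
      using that length_tuples[OF vs] tuples_nth[OF vs that] by simp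
    have "nbracket E (map incl vs) = \<zero>\<^bsub>E\<^esub>"
      using bracket_two_base_zero[OF es, of 0 1] base0 n2 by simp
    then show ?thesis by (simp add: incl_def E_ops abelian_nlie_def module.extend_def)
  qed
  ultimately show "n_Lie_hom K n (abelian_nlie V) E incl" by (simp add: n_Lie_hom_def)
  show "n_Lie_hom K n E G base"
    using base_linear by (simp add: n_Lie_hom_def base_bracket)
  show "inj_on incl (carrier V)" by (rule inj_on_inverseI[of _ fibre]) simp
  have "base (h (x, \<zero>\<^bsub>V\<^esub>)) = x" if "x \<in> carrier G" for x using that by simp
  then show "base ` carrier E = carrier G" by (force simp: image_iff)
qed (rule n_Lie_algebra_E G incl_image)+

lemma induces_E: "induces_representation K n G V \<rho> (E, incl, base)"
  unfolding induces_representation_def prod.case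
proof (intro allI impI ballI)
  fix \<sigma> xs u assume \<sigma>: "linear_section K E G base \<sigma>" and xs: "xs \<in> tuples (n - 1) G" and u: "u \<in> carrier V"
  have \<sigma>c: "\<sigma> x \<in> carrier E" "base (\<sigma> x) = x" if "x \<in> carrier G" for x
    using \<sigma> that by (auto simp: linear_section_def linear_map_def)
  let ?es = "map \<sigma> xs @ [incl u]"
  have es: "?es \<in> tuples n E"
    using tuples_snoc[OF tuples_map[OF xs \<sigma>c(1)] incl_closed[OF u]] n2 by simp
  have len: "length xs = n - 1" using xs by (simp add: length_tuples)
  have mb: "map base ?es = xs @ [\<zero>\<^bsub>G\<^esub>]" using xs u \<sigma>c by (auto simp: tuples_def intro!: map_idI)
  have last: "map base ?es ! (n - 1) = \<zero>\<^bsub>G\<^esub>" "map fibre ?es ! (n - 1) = u"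
    using len u by (simp_all add: nth_append)
  have "nbracket G (map base ?es) = \<zero>\<^bsub>G\<^esub>"
    using bracket.update_zero[OF map_base[OF es] _ last(1)] n2 by simp
  moreover have "twisted (map base ?es) (map fibre ?es) = \<rho> xs u"
    using twisted_zero_entry[OF map_base[OF es] map_fibre[OF es] _ last(1)] n2 len
      omit_nth_snoc_last[of xs "\<zero>\<^bsub>G\<^esub>"] xs u
    unfolding last(2) mb by (simp add: rho_closed)
  ultimately show "incl (\<rho> xs u) = nbracket E ?es" unfolding E_ops incl_def by simp
qed

lemma E_abelian_extension: "(E, incl, base) \<in> abelian_extensions K n G V \<rho>"
  using extension_E abelian_ideal_incl induces_E by (simp add: abelian_extensions_def)

lemma E_presents: "presents \<omega> (E, incl, base) fibre"
  using fibre_linear by (simp add: presents_def fibre_bracket twisted_def)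

end

lemma (in n_Lie_module) cocycle_presented:
  assumes "\<omega> \<in> one_cocycles K n G V \<rho>" and "inj_on (h :: _ \<Rightarrow> 'e) (carrier G \<times> carrier V)"
  shows "\<exists>S\<in>(abelian_extensions K n G V \<rho> :: ('k, 'v, 'e, 'g) ext set). \<exists>r. presents \<omega> S r"
proof -
  interpret n_Lie_cocycle_copy K G V n \<rho> \<omega> h using assms by unfold_locales
  show ?thesis using E_abelian_extension E_presents by blast
qed

section \<open>Cohomologous cocycles and equivalent extensions\<close>

context n_Lie_module
begin

text \<open>
  \<open>\<omega> - \<omega>' = d\<^sup>0 \<nu>\<close>, with the negative terms moved to the other side so that it can be compared with brackets
  without subtraction.
\<close>

definition cohomologous_via :: "('g \<Rightarrow> 'v) \<Rightarrow> ('g list \<Rightarrow> 'v) \<Rightarrow> ('g list \<Rightarrow> 'v) \<Rightarrow> bool" where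
  "cohomologous_via \<nu> \<omega> \<omega>' \<longleftrightarrow> linear_map K G V \<nu> \<and>
     (\<forall>xs\<in>tuples n G. \<omega> xs \<oplus>\<^bsub>V\<^esub> \<nu> (nbracket G xs) = \<omega>' xs \<oplus>\<^bsub>V\<^esub> act xs (map \<nu> xs))"

lemma cocycle_closed: "\<omega> \<in> one_cocycles K n G V \<rho> \<Longrightarrow> xs \<in> tuples n G \<Longrightarrow> \<omega> xs \<in> carrier V"
  by (auto simp: one_cocycles_def alternating_map_def)

lemma d0_act:
  assumes "xs \<in> tuples n G" "linear_map K G V \<nu>"
  shows "d0 K n G V \<rho> \<nu> xs = act xs (map \<nu> xs) \<ominus>\<^bsub>V\<^esub> \<nu> (nbracket G xs)"
proof -
  have "(\<Oplus>\<^bsub>V\<^esub>i\<in>{..<n}. sgn_smult K V (n - Suc i) (\<rho> (omit_nth i xs) (\<nu> (xs ! i)))) = act xs (map \<nu> xs)"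
    unfolding act_def
  proof (rule V.finsum_cong'[OF refl])
    have "\<nu> (xs ! i) \<in> carrier V" if "i < n" for i
      using linear_map_closed[OF assms(2) tuples_nth[OF assms(1) that]] .
    then show "(\<lambda>i. sgn_smult K V (n - Suc i) (\<rho> (omit_nth i xs) (map \<nu> xs ! i))) \<in> {..<n} \<rightarrow> carrier V"
      by (intro Pi_I) (simp add: act_term_closed[OF assms(1)] length_tuples[OF assms(1)])
  qed (simp add: length_tuples[OF assms(1)])
  then show ?thesis using assms(1) by (simp add: d0_def)
qed

lemma cohomologous_iff:
  assumes "\<omega> \<in> one_cocycles K n G V \<rho>" "\<omega>' \<in> one_cocycles K n G V \<rho>"
  shows "(\<lambda>xs\<in>tuples n G. \<omega> xs \<ominus>\<^bsub>V\<^esub> \<omega>' xs) \<in> one_coboundaries K n G V \<rho> \<longleftrightarrow>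
         (\<exists>\<nu>. cohomologous_via \<nu> \<omega> \<omega>')"
proof -
  have "(\<lambda>xs\<in>tuples n G. \<omega> xs \<ominus>\<^bsub>V\<^esub> \<omega>' xs) = d0 K n G V \<rho> \<nu> \<longleftrightarrow> cohomologous_via \<nu> \<omega> \<omega>'"
    if \<nu>: "linear_map K G V \<nu>" for \<nu>
  proof -
    have "(\<lambda>xs\<in>tuples n G. \<omega> xs \<ominus>\<^bsub>V\<^esub> \<omega>' xs) = d0 K n G V \<rho> \<nu> \<longleftrightarrow>
        (\<forall>xs\<in>tuples n G. \<omega> xs \<ominus>\<^bsub>V\<^esub> \<omega>' xs = d0 K n G V \<rho> \<nu> xs)"
      by (auto simp: fun_eq_iff d0_def restrict_def)
    also have "\<dots> \<longleftrightarrow> cohomologous_via \<nu> \<omega> \<omega>'"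
      unfolding cohomologous_via_def using \<nu>
      by (simp add: d0_act V.minus_eq_minus_iff cocycle_closed[OF assms(1)] cocycle_closed[OF assms(2)]
          act_closed tuples_map linear_map_closed bracket.closed cong: ball_cong)
    finally show ?thesis .
  qed
  then show ?thesis unfolding one_coboundaries_def by (auto simp: cohomologous_via_def)
qed

lemma cohomologous_equiv:
  "equiv (one_cocycles K n G V \<rho>)
     {(\<omega>, \<omega>'). \<omega> \<in> one_cocycles K n G V \<rho> \<and> \<omega>' \<in> one_cocycles K n G V \<rho> \<and>
       (\<lambda>xs\<in>tuples n G. \<omega> xs \<ominus>\<^bsub>V\<^esub> \<omega>' xs) \<in> one_coboundaries K n G V \<rho>}" (is "equiv ?Z ?S")
proof -
  have S: "(\<omega>, \<omega>') \<in> ?S \<longleftrightarrow> \<omega> \<in> ?Z \<and> \<omega>' \<in> ?Z \<and> (\<exists>\<nu>. cohomologous_via \<nu> \<omega> \<omega>')" for \<omega> \<omega>'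
    using cohomologous_iff[of \<omega> \<omega>'] by auto
  have act0: "act xs (map (\<lambda>_. \<zero>\<^bsub>V\<^esub>) xs) = \<zero>\<^bsub>V\<^esub>" if "xs \<in> tuples n G" for xs
    using that by (intro act_zero) (auto simp: length_tuples)
  have add: "act xs (map (\<lambda>x. \<nu> x \<oplus>\<^bsub>V\<^esub> \<mu> x) xs) = act xs (map \<nu> xs) \<oplus>\<^bsub>V\<^esub> act xs (map \<mu> xs)"
    if "xs \<in> tuples n G" "linear_map K G V \<nu>" "linear_map K G V \<mu>" for xs \<nu> \<mu>
    using that by (intro act_add) (auto simp: tuples_def intro: linear_map_closed)
  have cl: "act xs (map \<nu> xs) \<in> carrier V" "\<nu> (nbracket G xs) \<in> carrier V"
    if "xs \<in> tuples n G" "linear_map K G V \<nu>" for xs \<nu>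
    using that by (auto intro!: act_closed tuples_map bracket.closed intro: linear_map_closed)
  show ?thesis
  proof (rule equivI)
    show "?S \<subseteq> ?Z \<times> ?Z" by auto
    show "refl_on ?Z ?S"
    proof (rule refl_onI)
      fix \<omega> assume \<omega>: "\<omega> \<in> ?Z"
      have "cohomologous_via (\<lambda>_. \<zero>\<^bsub>V\<^esub>) \<omega> \<omega>"
        using linear_map_const_zero[OF G.module_axioms V.module_axioms] by (simp add: cohomologous_via_def act0)
      then show "(\<omega>, \<omega>) \<in> ?S" unfolding S using \<omega> by blast
    qed
    show "sym ?S"
    proof (rule symI)
      fix \<omega> \<omega>' assume a: "(\<omega>, \<omega>') \<in> ?S"
      then obtain \<nu> where Z: "\<omega> \<in> ?Z" "\<omega>' \<in> ?Z" and \<nu>: "cohomologous_via \<nu> \<omega> \<omega>'" unfolding S by blast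
      have lin: "linear_map K G V \<nu>" using \<nu> by (simp add: cohomologous_via_def)
      interpret \<nu>: linear_map_between K G V \<nu> by unfold_locales (rule lin)
      let ?\<mu> = "\<lambda>x. \<zero>\<^bsub>V\<^esub> \<ominus>\<^bsub>V\<^esub> \<nu> x"
      have \<mu>: "linear_map K G V ?\<mu>"
        by (intro linear_map_pointwise_minus linear_map_const_zero G.module_axioms V.module_axioms lin)
      have "\<omega>' xs \<oplus>\<^bsub>V\<^esub> ?\<mu> (nbracket G xs) = \<omega> xs \<oplus>\<^bsub>V\<^esub> act xs (map ?\<mu> xs)" if xs: "xs \<in> tuples n G" for xs
      proof -
        note c = cl[OF xs lin] cl[OF xs \<mu>] cocycle_closed[OF Z(1) xs] cocycle_closed[OF Z(2) xs]
        have map0: "map (\<lambda>x. \<nu> x \<oplus>\<^bsub>V\<^esub> ?\<mu> x) xs = map (\<lambda>_. \<zero>\<^bsub>V\<^esub>) xs"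
          using xs by (auto simp: tuples_def V.add_minus_cancel subset_iff)
        have zero: "act xs (map \<nu> xs) \<oplus>\<^bsub>V\<^esub> act xs (map ?\<mu> xs) = \<zero>\<^bsub>V\<^esub>"
          using add[OF xs lin \<mu>] unfolding map0 act0[OF xs] by (rule sym)
        have cancel: "\<nu> (nbracket G xs) \<oplus>\<^bsub>V\<^esub> ?\<mu> (nbracket G xs) = \<zero>\<^bsub>V\<^esub>"
          using xs by (simp add: V.add_minus_cancel)
        have eq: "\<omega> xs \<oplus>\<^bsub>V\<^esub> \<nu> (nbracket G xs) = \<omega>' xs \<oplus>\<^bsub>V\<^esub> act xs (map \<nu> xs)"
          using \<nu> xs by (simp add: cohomologous_via_def)
        have "\<omega>' xs \<oplus>\<^bsub>V\<^esub> ?\<mu> (nbracket G xs) =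
            (\<omega>' xs \<oplus>\<^bsub>V\<^esub> ?\<mu> (nbracket G xs)) \<oplus>\<^bsub>V\<^esub> (act xs (map \<nu> xs) \<oplus>\<^bsub>V\<^esub> act xs (map ?\<mu> xs))"
          unfolding zero using c by (simp del: V.M.l_zero)
        also have "\<dots> = (\<omega>' xs \<oplus>\<^bsub>V\<^esub> act xs (map \<nu> xs)) \<oplus>\<^bsub>V\<^esub> (?\<mu> (nbracket G xs) \<oplus>\<^bsub>V\<^esub> act xs (map ?\<mu> xs))"
          by (simp only: c V.M.a_ac V.M.add.m_closed)
        also have "\<dots> = (\<omega> xs \<oplus>\<^bsub>V\<^esub> \<nu> (nbracket G xs)) \<oplus>\<^bsub>V\<^esub> (?\<mu> (nbracket G xs) \<oplus>\<^bsub>V\<^esub> act xs (map ?\<mu> xs))"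
          by (simp only: eq)
        also have "\<dots> = (\<nu> (nbracket G xs) \<oplus>\<^bsub>V\<^esub> ?\<mu> (nbracket G xs)) \<oplus>\<^bsub>V\<^esub> (\<omega> xs \<oplus>\<^bsub>V\<^esub> act xs (map ?\<mu> xs))"
          by (simp only: c V.M.a_ac V.M.add.m_closed)
        also have "\<dots> = \<omega> xs \<oplus>\<^bsub>V\<^esub> act xs (map ?\<mu> xs)" unfolding cancel using c by (intro V.M.l_zero V.M.add.m_closed)
        finally show ?thesis .
      qed
      then have "cohomologous_via ?\<mu> \<omega>' \<omega>" using \<mu> by (simp add: cohomologous_via_def)
      then show "(\<omega>', \<omega>) \<in> ?S" unfolding S using Z by blast
    qed
    show "trans ?S"
    proof (rule transI)
      fix \<omega>1 \<omega>2 \<omega>3 assume a: "(\<omega>1, \<omega>2) \<in> ?S" "(\<omega>2, \<omega>3) \<in> ?S"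
      then obtain \<nu> \<mu> where Z: "\<omega>1 \<in> ?Z" "\<omega>2 \<in> ?Z" "\<omega>3 \<in> ?Z"
        and \<nu>: "cohomologous_via \<nu> \<omega>1 \<omega>2" and \<mu>: "cohomologous_via \<mu> \<omega>2 \<omega>3" unfolding S by blast
      have lin: "linear_map K G V \<nu>" "linear_map K G V \<mu>" using \<nu> \<mu> by (simp_all add: cohomologous_via_def)
      have "\<omega>1 xs \<oplus>\<^bsub>V\<^esub> (\<nu> (nbracket G xs) \<oplus>\<^bsub>V\<^esub> \<mu> (nbracket G xs)) =
          \<omega>3 xs \<oplus>\<^bsub>V\<^esub> act xs (map (\<lambda>x. \<nu> x \<oplus>\<^bsub>V\<^esub> \<mu> x) xs)" if xs: "xs \<in> tuples n G" for xs
      proof -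
        note c = cl[OF xs lin(1)] cl[OF xs lin(2)] cocycle_closed[OF Z(1) xs] cocycle_closed[OF Z(2) xs] cocycle_closed[OF Z(3) xs]
        have eqs: "\<omega>1 xs \<oplus>\<^bsub>V\<^esub> \<nu> (nbracket G xs) = \<omega>2 xs \<oplus>\<^bsub>V\<^esub> act xs (map \<nu> xs)"
            "\<omega>2 xs \<oplus>\<^bsub>V\<^esub> \<mu> (nbracket G xs) = \<omega>3 xs \<oplus>\<^bsub>V\<^esub> act xs (map \<mu> xs)"
          using \<nu> \<mu> xs by (simp_all add: cohomologous_via_def)
        have "\<omega>1 xs \<oplus>\<^bsub>V\<^esub> (\<nu> (nbracket G xs) \<oplus>\<^bsub>V\<^esub> \<mu> (nbracket G xs)) =
            (\<omega>1 xs \<oplus>\<^bsub>V\<^esub> \<nu> (nbracket G xs)) \<oplus>\<^bsub>V\<^esub> \<mu> (nbracket G xs)"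
          by (simp only: c V.M.a_assoc)
        also have "\<dots> = (\<omega>2 xs \<oplus>\<^bsub>V\<^esub> \<mu> (nbracket G xs)) \<oplus>\<^bsub>V\<^esub> act xs (map \<nu> xs)"
          unfolding eqs(1) by (simp only: c V.M.a_ac V.M.add.m_closed)
        also have "\<dots> = \<omega>3 xs \<oplus>\<^bsub>V\<^esub> (act xs (map \<nu> xs) \<oplus>\<^bsub>V\<^esub> act xs (map \<mu> xs))"
          unfolding eqs(2) by (simp only: c V.M.a_ac V.M.add.m_closed)
        finally show ?thesis using add[OF xs lin] by simp
      qed
      then have "cohomologous_via (\<lambda>x. \<nu> x \<oplus>\<^bsub>V\<^esub> \<mu> x) \<omega>1 \<omega>3"
        using linear_map_pointwise_add[OF G.module_axioms V.module_axioms lin] by (simp add: cohomologous_via_def)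
      then show "(\<omega>1, \<omega>3) \<in> ?S" unfolding S using Z by blast
    qed
  qed
qed

end

text \<open>
  In the coordinates \<open>(p, r)\<close> and \<open>(q, r')\<close> of two presented extensions, an equivalence has to be of the form
  \<open>(x, v) \<mapsto> (x, v + \<nu> x)\<close> with \<open>\<nu>\<close> linear.  The two lemmas below show that such a map respects the twisted brackets
  exactly when \<open>\<nu>\<close> exhibits the two cocycles as cohomologous.
\<close>

locale presented_extension = abelian_extension K G V n \<rho> E i p
  for K :: "('k, 'r) ring_scheme" and G :: "('k, 'g) nlie" and V :: "('k, 'v) module" and n \<rho>
    and E :: "('k, 'e) nlie" and i p +
  fixes \<omega> r
  assumes presented: "presents \<omega> (E, i, p) r" and cocycle: "\<omega> \<in> one_cocycles K n G V \<rho>"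
begin

sublocale r: linear_map_between K E V r
  using presented by unfold_locales (simp add: presents_def)

lemma r_i [simp]: "v \<in> carrier V \<Longrightarrow> r (i v) = v"
  using presented by (simp add: presents_def)

lemma r_bracket:
  "es \<in> tuples n E \<Longrightarrow> r (nbracket E es) = \<omega> (map p es) \<oplus>\<^bsub>V\<^esub> act (map p es) (map r es)"
  using presented by (simp add: presents_def)

lemma eqI: "e \<in> carrier E \<Longrightarrow> e' \<in> carrier E \<Longrightarrow> p e = p e' \<Longrightarrow> r e = r e' \<Longrightarrow> e = e'"
  using jointly_injective[OF r.linear r_i] .

end

context n_Lie_module
begin

lemma equivalent_imp_cohomologous:
  assumes "presented_extension K G V n \<rho> E i p \<omega> r" "presented_extension K G V n \<rho> E' j q \<omega>' r'"
    and "equivalent_extensions K n V (E, i, p) (E', j, q)"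
  shows "\<exists>\<nu>. cohomologous_via \<nu> \<omega> \<omega>'"
proof -
  interpret S: presented_extension K G V n \<rho> E i p \<omega> r by fact
  interpret T: presented_extension K G V n \<rho> E' j q \<omega>' r' by fact
  obtain F where F: "n_Lie_hom K n E E' F" and Fi: "\<And>v. v \<in> carrier V \<Longrightarrow> F (i v) = j v"
    and qF: "\<And>e. e \<in> carrier E \<Longrightarrow> q (F e) = p e"
    using assms(3) unfolding equivalent_extensions_def by blast
  interpret F: linear_map_between K E E' F using F by unfold_locales (simp add: n_Lie_hom_def)
  obtain \<sigma> where \<sigma>: "linear_section K E G p \<sigma>" using S.section_exists by blast
  interpret \<sigma>: linear_map_between K G E \<sigma> using \<sigma> by unfold_locales (simp add: linear_section_def)
  have p\<sigma>: "p (\<sigma> x) = x" if "x \<in> carrier G" for x using \<sigma> that by (simp add: linear_section_def)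
  define \<nu> where "\<nu> x = r' (F (\<sigma> x)) \<ominus>\<^bsub>V\<^esub> r (\<sigma> x)" for x
  have \<nu>: "linear_map K G V \<nu>"
    unfolding \<nu>_def
    by (intro linear_map_pointwise_minus G.module_axioms V.module_axioms
        linear_map_comp[OF \<sigma>.linear] linear_map_comp[OF F.linear T.r.linear] S.r.linear)
  have \<nu>_closed: "\<nu> x \<in> carrier V" if "x \<in> carrier G" for x using linear_map_closed[OF \<nu> that] .
  \<comment> \<open>\<open>r' \<circ> F - r\<close> vanishes on \<open>i(V)\<close>, so its value at \<open>e\<close> depends on \<open>p e\<close> only\<close>
  have r'F: "r' (F e) = r e \<oplus>\<^bsub>V\<^esub> \<nu> (p e)" if e: "e \<in> carrier E" for e
  proof -
    have \<sigma>e: "\<sigma> (p e) \<in> carrier E" using e by simp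
    have "p (e \<ominus>\<^bsub>E\<^esub> \<sigma> (p e)) = \<zero>\<^bsub>G\<^esub>" using e by (simp add: S.p.minus p\<sigma> G.minus_eq_zero_iff)
    then obtain v where v: "v \<in> carrier V" "e \<ominus>\<^bsub>E\<^esub> \<sigma> (p e) = i v"
      using e by (elim S.kernelE[rotated]) auto
    have e_eq: "e = \<sigma> (p e) \<oplus>\<^bsub>E\<^esub> i v"
      using S.E.add_minus_cancel[OF e \<sigma>e] v by simp
    have "r' (F (\<sigma> (p e) \<oplus>\<^bsub>E\<^esub> i v)) = r' (F (\<sigma> (p e))) \<oplus>\<^bsub>V\<^esub> v"
      using \<sigma>e v by (simp add: F.add T.r.add Fi)
    moreover have "r (\<sigma> (p e) \<oplus>\<^bsub>E\<^esub> i v) = r (\<sigma> (p e)) \<oplus>\<^bsub>V\<^esub> v"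
      using \<sigma>e v by (simp add: S.r.add)
    moreover have "r' (F (\<sigma> (p e))) = r (\<sigma> (p e)) \<oplus>\<^bsub>V\<^esub> \<nu> (p e)"
      unfolding \<nu>_def using \<sigma>e by (simp add: V.add_minus_cancel)
    ultimately have "r' (F e) = r (\<sigma> (p e)) \<oplus>\<^bsub>V\<^esub> \<nu> (p e) \<oplus>\<^bsub>V\<^esub> v" "r e = r (\<sigma> (p e)) \<oplus>\<^bsub>V\<^esub> v"
      using e_eq by simp_all
    then show ?thesis using \<sigma>e v e \<nu>_closed by (simp add: V.M.a_ac)
  qed
  have "\<omega> xs \<oplus>\<^bsub>V\<^esub> \<nu> (nbracket G xs) = \<omega>' xs \<oplus>\<^bsub>V\<^esub> act xs (map \<nu> xs)" if xs: "xs \<in> tuples n G" for xs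
  proof -
    let ?es = "map \<sigma> xs"
    have mem: "x \<in> carrier G" if "x \<in> set xs" for x using that xs by (auto simp: tuples_def)
    have es: "?es \<in> tuples n E" using xs by (rule tuples_map) simp
    have Fes: "map F ?es \<in> tuples n E'" using es by (rule tuples_map) simp
    have pes: "map p ?es = xs" using mem by (auto intro!: map_idI simp: p\<sigma>)
    have qes: "map q (map F ?es) = xs" using mem by (auto intro!: map_idI simp: qF p\<sigma>)
    have res: "map r' (map F ?es) = map (\<lambda>x. r (\<sigma> x) \<oplus>\<^bsub>V\<^esub> \<nu> x) xs" using mem by (auto simp: r'F p\<sigma>)
    let ?a = "act xs (map (\<lambda>x. r (\<sigma> x)) xs)" and ?b = "act xs (map \<nu> xs)"
    have c: "?a \<in> carrier V" "?b \<in> carrier V" "\<omega> xs \<in> carrier V" "\<omega>' xs \<in> carrier V"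
        "\<nu> (nbracket G xs) \<in> carrier V"
      using act_closed[OF xs tuples_map[OF xs]] \<nu>_closed bracket.closed[OF xs]
        cocycle_closed[OF S.cocycle xs] cocycle_closed[OF T.cocycle xs] by simp_all
    have "r' (F (nbracket E ?es)) = \<omega> xs \<oplus>\<^bsub>V\<^esub> ?a \<oplus>\<^bsub>V\<^esub> \<nu> (nbracket G xs)"
      using S.r_bracket[OF es] S.p_bracket[OF es] es pes
      by (simp add: r'F S.B.closed comp_def)
    moreover have "r' (F (nbracket E ?es)) = \<omega>' xs \<oplus>\<^bsub>V\<^esub> (?a \<oplus>\<^bsub>V\<^esub> ?b)"
    proof -
      have "F (nbracket E ?es) = nbracket E' (map F ?es)" using F es by (simp add: n_Lie_hom_def)
      moreover have "act xs (map r' (map F ?es)) = ?a \<oplus>\<^bsub>V\<^esub> ?b"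
        unfolding res using xs mem by (intro act_add) (auto simp: length_tuples \<nu>_closed)
      ultimately show ?thesis using T.r_bracket[OF Fes] unfolding qes by simp
    qed
    ultimately have "\<omega> xs \<oplus>\<^bsub>V\<^esub> ?a \<oplus>\<^bsub>V\<^esub> \<nu> (nbracket G xs) = \<omega>' xs \<oplus>\<^bsub>V\<^esub> (?a \<oplus>\<^bsub>V\<^esub> ?b)" by simp
    then have "?a \<oplus>\<^bsub>V\<^esub> (\<omega> xs \<oplus>\<^bsub>V\<^esub> \<nu> (nbracket G xs)) = ?a \<oplus>\<^bsub>V\<^esub> (\<omega>' xs \<oplus>\<^bsub>V\<^esub> ?b)"
      by (simp only: c V.M.a_ac V.M.add.m_closed)
    then show ?thesis using c by simp
  qed
  then show ?thesis using \<nu> unfolding cohomologous_via_def by blast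
qed

lemma cohomologous_imp_equivalent:
  assumes "presented_extension K G V n \<rho> E i p \<omega> r" "presented_extension K G V n \<rho> E' j q \<omega>' r'"
    and "cohomologous_via \<nu> \<omega> \<omega>'"
  shows "equivalent_extensions K n V (E, i, p) (E', j, q)"
proof -
  interpret S: presented_extension K G V n \<rho> E i p \<omega> r by fact
  interpret T: presented_extension K G V n \<rho> E' j q \<omega>' r' by fact
  interpret \<nu>: linear_map_between K G V \<nu>
    using assms(3) by unfold_locales (simp add: cohomologous_via_def)
  obtain \<tau> where \<tau>: "linear_section K E' G q \<tau>" using T.section_exists by blast
  interpret \<tau>: linear_map_between K G E' \<tau> using \<tau> by unfold_locales (simp add: linear_section_def)
  have q\<tau>: "q (\<tau> x) = x" if "x \<in> carrier G" for x using \<tau> that by (simp add: linear_section_def)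
  \<comment> \<open>\<open>F e\<close> has to be the element with coordinates \<open>(p e, r e + \<nu> (p e))\<close>; \<open>f\<close> corrects the second coordinate of \<open>\<tau> (p e)\<close>\<close>
  define f where "f e = r e \<oplus>\<^bsub>V\<^esub> \<nu> (p e) \<ominus>\<^bsub>V\<^esub> r' (\<tau> (p e))" for e
  have f: "linear_map K E V f"
    unfolding f_def
    by (intro linear_map_pointwise_minus linear_map_pointwise_add S.E.module_axioms V.module_axioms
        S.r.linear linear_map_comp[OF S.p.linear] \<nu>.linear linear_map_comp[OF \<tau>.linear T.r.linear])
  have f_closed: "f e \<in> carrier V" if "e \<in> carrier E" for e using linear_map_closed[OF f that] .
  define F where "F e = \<tau> (p e) \<oplus>\<^bsub>E'\<^esub> j (f e)" for e
  have F: "linear_map K E E' F"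
    unfolding F_def
    by (intro linear_map_pointwise_add S.E.module_axioms T.E.module_axioms
        linear_map_comp[OF S.p.linear \<tau>.linear] linear_map_comp[OF f T.i.linear])
  have F_closed [simp]: "F e \<in> carrier E'" if "e \<in> carrier E" for e using linear_map_closed[OF F that] .
  have qF: "q (F e) = p e" if "e \<in> carrier E" for e
    using that f_closed by (simp add: F_def T.p.add q\<tau>)
  have r'F: "r' (F e) = r e \<oplus>\<^bsub>V\<^esub> \<nu> (p e)" if "e \<in> carrier E" for e
    using that f_closed by (simp add: F_def T.r.add f_def V.add_minus_cancel)
  have "F (nbracket E es) = nbracket E' (map F es)" if es: "es \<in> tuples n E" for es
  proof (rule T.eqI)
    have mem: "e \<in> carrier E" if "e \<in> set es" for e using that es by (auto simp: tuples_def)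
    have Fes: "map F es \<in> tuples n E'" using es by (rule tuples_map) simp
    have pes: "map p es \<in> tuples n G" using es by (rule tuples_map) simp
    have qes: "map q (map F es) = map p es" using mem by (auto simp: qF)
    have res: "map r' (map F es) = map (\<lambda>e. r e \<oplus>\<^bsub>V\<^esub> \<nu> (p e)) es" using mem by (auto simp: r'F)
    show "F (nbracket E es) \<in> carrier E'" using es by (simp add: S.B.closed)
    show "nbracket E' (map F es) \<in> carrier E'" using Fes by (rule T.B.closed)
    show "q (F (nbracket E es)) = q (nbracket E' (map F es))"
      using qF[OF S.B.closed[OF es]] S.p_bracket[OF es] T.p_bracket[OF Fes] unfolding qes by simp
    let ?a = "act (map p es) (map r es)" and ?b = "act (map p es) (map \<nu> (map p es))"
    have c: "?a \<in> carrier V" "?b \<in> carrier V" "\<omega> (map p es) \<in> carrier V" "\<omega>' (map p es) \<in> carrier V"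
        "\<nu> (nbracket G (map p es)) \<in> carrier V"
      using act_closed[OF pes tuples_map[OF pes]] act_closed[OF pes tuples_map[OF es]]
        cocycle_closed[OF S.cocycle pes] cocycle_closed[OF T.cocycle pes] bracket.closed[OF pes]
      by (simp_all del: map_map)
    have "act (map p es) (map r' (map F es)) = ?a \<oplus>\<^bsub>V\<^esub> act (map p es) (map (\<lambda>e. \<nu> (p e)) es)"
      unfolding res using pes es mem by (intro act_add) (auto simp: length_tuples)
    then have "r' (nbracket E' (map F es)) = \<omega>' (map p es) \<oplus>\<^bsub>V\<^esub> (?a \<oplus>\<^bsub>V\<^esub> ?b)"
      using T.r_bracket[OF Fes] unfolding qes by (simp add: comp_def)
    also have "\<dots> = (\<omega>' (map p es) \<oplus>\<^bsub>V\<^esub> ?b) \<oplus>\<^bsub>V\<^esub> ?a"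
      by (simp only: c V.M.a_ac V.M.add.m_closed)
    also have "\<omega>' (map p es) \<oplus>\<^bsub>V\<^esub> ?b = \<omega> (map p es) \<oplus>\<^bsub>V\<^esub> \<nu> (nbracket G (map p es))"
      using assms(3) pes unfolding cohomologous_via_def by simp
    also have "\<dots> \<oplus>\<^bsub>V\<^esub> ?a = \<omega> (map p es) \<oplus>\<^bsub>V\<^esub> ?a \<oplus>\<^bsub>V\<^esub> \<nu> (nbracket G (map p es))"
      by (simp only: c V.M.a_ac V.M.add.m_closed)
    also have "\<dots> = r' (F (nbracket E es))"
      using S.r_bracket[OF es] S.p_bracket[OF es] es by (simp add: r'F S.B.closed)
    finally show "r' (F (nbracket E es)) = r' (nbracket E' (map F es))" ..
  qed
  then have "n_Lie_hom K n E E' F" using F by (simp add: n_Lie_hom_def)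
  moreover have "F (i v) = j v" if "v \<in> carrier V" for v
    using that by (intro T.eqI) (simp_all add: qF r'F)
  ultimately show ?thesis unfolding equivalent_extensions_def using qF by auto
qed

end

section \<open>The classification\<close>

text \<open>
  A correspondence \<open>C\<close> that is total on both sides and matches the relations induces a bijection of the
  quotients.  The relation \<open>R\<close> is then the pullback of \<open>S\<close> along any choice of partners, hence itself an
  equivalence.
\<close>

lemma bij_betw_quotients:
  assumes "equiv B S" "R \<subseteq> A \<times> A"
    and total: "\<And>a. a \<in> A \<Longrightarrow> \<exists>b\<in>B. C a b" and onto: "\<And>b. b \<in> B \<Longrightarrow> \<exists>a\<in>A. C a b"
    and respects: "\<And>a a' b b'. a \<in> A \<Longrightarrow> a' \<in> A \<Longrightarrow> b \<in> B \<Longrightarrow> b' \<in> B \<Longrightarrow> C a b \<Longrightarrow> C a' b' \<Longrightarrow>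
      (a, a') \<in> R \<longleftrightarrow> (b, b') \<in> S"
  shows "\<exists>\<Phi>. bij_betw \<Phi> (A // R) (B // S)"
proof -
  obtain f where f: "\<And>a. a \<in> A \<Longrightarrow> f a \<in> B \<and> C a (f a)"
    using bchoice[of A "\<lambda>a b. b \<in> B \<and> C a b"] total by blast
  have R: "(a, a') \<in> R \<longleftrightarrow> a \<in> A \<and> a' \<in> A \<and> (f a, f a') \<in> S" for a a'
    using respects f assms(2) by blast
  have SB: "S \<subseteq> B \<times> B" and S_refl: "\<And>b. b \<in> B \<Longrightarrow> (b, b) \<in> S" and "trans S"
    using assms(1) by (auto simp: equiv_def refl_on_def)
  define \<Phi> where "\<Phi> U = S `` (f ` U)" for U
  have \<Phi>: "\<Phi> (R `` {a}) = S `` {f a}" if a: "a \<in> A" for a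
  proof -
    have "b \<in> S `` {f a}" if "b \<in> \<Phi> (R `` {a})" for b
      using that \<open>trans S\<close> unfolding \<Phi>_def by (auto simp: R dest: transD)
    moreover have "a \<in> R `` {a}" using a f S_refl by (simp add: R)
    then have "S `` {f a} \<subseteq> \<Phi> (R `` {a})" unfolding \<Phi>_def by blast
    ultimately show ?thesis by blast
  qed
  have class_eq: "S `` {b} = S `` {b'} \<longleftrightarrow> (b, b') \<in> S" if "b \<in> B" "b' \<in> B" for b b'
    using eq_equiv_class_iff[OF assms(1) that] .
  have "inj_on \<Phi> (A // R)"
  proof (rule inj_onI)
    fix U U' assume "U \<in> A // R" "U' \<in> A // R" and eq: "\<Phi> U = \<Phi> U'"
    then obtain a a' where a: "a \<in> A" "a' \<in> A" "U = R `` {a}" "U' = R `` {a'}" by (auto elim!: quotientE)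
    then have "S `` {f a} = S `` {f a'}" using eq \<Phi> by simp
    then have "(f a, b) \<in> S \<longleftrightarrow> (f a', b) \<in> S" for b by blast
    moreover have "U = {x \<in> A. (f a, f x) \<in> S}" "U' = {x \<in> A. (f a', f x) \<in> S}"
      using a R by blast+
    ultimately show "U = U'" by simp
  qed
  moreover have "\<Phi> ` (A // R) = B // S"
  proof (intro equalityI subsetI)
    fix W assume "W \<in> \<Phi> ` (A // R)"
    then obtain a where "a \<in> A" "W = \<Phi> (R `` {a})" by (auto elim!: quotientE)
    then show "W \<in> B // S" using \<Phi> f by (auto intro: quotientI)
  next
    fix W assume "W \<in> B // S"
    then obtain b where b: "b \<in> B" "W = S `` {b}" by (auto elim!: quotientE)
    obtain a where a: "a \<in> A" "C a b" using onto b by blast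
    have "(a, a) \<in> R" using a f S_refl by (simp add: R)
    then have "(f a, b) \<in> S" using respects a b f by blast
    then have "S `` {f a} = S `` {b}" using class_eq f a(1) b(1) by blast
    then have "W = \<Phi> (R `` {a})" using \<Phi>[OF a(1)] b(2) by simp
    then show "W \<in> \<Phi> ` (A // R)" using a by (auto intro: quotientI)
  qed
  ultimately show ?thesis by (auto simp: bij_betw_def)
qed

theorem theorem2p18:
  fixes K :: "('k, 'r) ring_scheme"
    and n :: nat
    and G :: "('k, 'g) nlie"
    and V :: "('k, 'v) module"
    and \<rho> :: "'g list \<Rightarrow> 'v \<Rightarrow> 'v"
  assumes "field K" and "char_zero K" and "n \<ge> 2"
    and "n_Lie_algebra K n G"
    and "vector_space_over K V"
    and "n_Lie_representation K n G V \<rho>"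
    \<comment> \<open>the ambient type of the extensions is large enough to contain a copy of the set G x V\<close>
    and "\<exists>h :: 'g \<times> 'v \<Rightarrow> 'e. inj_on h (carrier G \<times> carrier V)"
  shows "\<exists>\<Phi>. bij_betw \<Phi>
               (abelian_extension_classes K n G V \<rho> :: ('k, 'v, 'e, 'g) ext set set)
               (H1 K n G V \<rho>)"
proof -
  have modules: "module K G" "module K V"
    using assms by (auto simp: n_Lie_algebra_def vector_space_over_def)
  interpret n_Lie_module K G V n \<rho>
    by (intro n_Lie_module.intro n_Lie_module_axioms.intro modules assms)
  obtain h :: "'g \<times> 'v \<Rightarrow> 'e" where h: "inj_on h (carrier G \<times> carrier V)" using assms(7) by blast
  show ?thesis
    unfolding abelian_extension_classes_def H1_def
  proof (rule bij_betw_quotients[OF cohomologous_equiv, where C = "\<lambda>S \<omega>. \<exists>r. presents \<omega> S r"])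
    fix S :: "('k, 'v, 'e, 'g) ext" assume S: "S \<in> abelian_extensions K n G V \<rho>"
    obtain E i p where Eip: "S = (E, i, p)" by (cases S)
    interpret abelian_extension K G V n \<rho> E i p using S Eip by unfold_locales simp
    show "\<exists>\<omega>\<in>one_cocycles K n G V \<rho>. \<exists>r. presents \<omega> S r" using presentation_exists Eip by simp
  next
    fix \<omega> assume "\<omega> \<in> one_cocycles K n G V \<rho>"
    then show "\<exists>S\<in>(abelian_extensions K n G V \<rho> :: ('k, 'v, 'e, 'g) ext set). \<exists>r. presents \<omega> S r"
      using cocycle_presented h by blast
  next
    fix S T :: "('k, 'v, 'e, 'g) ext" and \<omega> \<omega>'
    assume S: "S \<in> abelian_extensions K n G V \<rho>" and T: "T \<in> abelian_extensions K n G V \<rho>"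
      and Z: "\<omega> \<in> one_cocycles K n G V \<rho>" "\<omega>' \<in> one_cocycles K n G V \<rho>"
      and "\<exists>r. presents \<omega> S r" "\<exists>r. presents \<omega>' T r"
    then obtain r r' where r: "presents \<omega> S r" "presents \<omega>' T r'" by blast
    obtain E i p E' j q where ST: "S = (E, i, p)" "T = (E', j, q)" by (cases S, cases T)
    have P: "presented_extension K G V n \<rho> E i p \<omega> r"
      using S Z r ST by unfold_locales simp_all
    have Q: "presented_extension K G V n \<rho> E' j q \<omega>' r'"
      using T Z r ST by unfold_locales simp_all
    have "equivalent_extensions K n V S T \<longleftrightarrow> (\<exists>\<nu>. cohomologous_via \<nu> \<omega> \<omega>')"
      unfolding ST using equivalent_imp_cohomologous[OF P Q] cohomologous_imp_equivalent[OF P Q] by blast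
    then show "(S, T) \<in> {(S, T). S \<in> abelian_extensions K n G V \<rho> \<and> T \<in> abelian_extensions K n G V \<rho> \<and>
          equivalent_extensions K n V S T} \<longleftrightarrow>
        (\<omega>, \<omega>') \<in> {(\<omega>, \<omega>'). \<omega> \<in> one_cocycles K n G V \<rho> \<and> \<omega>' \<in> one_cocycles K n G V \<rho> \<and>
          (\<lambda>xs\<in>tuples n G. \<omega> xs \<ominus>\<^bsub>V\<^esub> \<omega>' xs) \<in> one_coboundaries K n G V \<rho>}"
      using S T Z cohomologous_iff[OF Z] by simp
  qed auto
qed

end
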